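(* Let $\mathcal{N}\subset\mathbb{R}$ be a neighborhood of $0$ and let $\gamma\in(1/2,1]$. Let $f:\mathbb{R}\to\mathbb{R}$ be globally Lipschitz with $f(0)=0$ and $f(x)>0$ for all $x\in\mathcal{N}\setminus\{0\}$. Let $(L_t)_{t\ge 1}$ be a solution of $$\mathrm{d}L_t=\frac{f(L_t)}{t^{\gamma}}\,\mathrm{d}t+\frac{1}{t^{\gamma}}\,\mathrm{d}B_t .$$ Suppose that at least one of the following holds: (1) $\gamma=1$ and there are constants $k_1,k_2$ with $0<k_i<1/2$ $(i=1,2)$ such that $k_1|x|\le f(x)\le k_2|x|$ for all $x\in\mathcal{N}\cap(-\infty,0]$; (2) there are constants $k>1$ and $c>0$ with $\frac12+\frac1{2k}<\gamma$ such that $c|x|^k\le f(x)\le |x|^k$ for all $x\in\mathcal{N}\cap(-\infty,0]$. Then $\mathbb{P}(L_t\to 0\text{ as }t\to\infty)>0$.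
   Context: $(B_t)$ is a standard one-dimensional Brownian motion. *)

theory Defs
  imports "HOL-Probability.Probability"
begin

(* Filtrations are indexed by all reals because the library locale needs a linearly ordered
   index type; only F t with t >= 0 is used, and a filtration given for t >= 0 extends
   trivially by F t = F 0 for t < 0. The usual conditions are not imposed. *)

locale brownian_motion = prob_space M + filtration "space M" F
  for M :: "'a measure" and F :: "real \<Rightarrow> 'a measure" +
  fixes B :: "real \<Rightarrow> 'a \<Rightarrow> real"
  assumes subalgebra_F: "t \<ge> 0 \<Longrightarrow> subalgebra M (F t)"
    and adapted: "t \<ge> 0 \<Longrightarrow> B t \<in> borel_measurable (F t)"
    and continuous_paths: "\<omega> \<in> space M \<Longrightarrow> continuous_on {0..} (\<lambda>t. B t \<omega>)"
    and start: "AE \<omega> in M. B 0 \<omega> = 0"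
    and increments_normal: "0 \<le> s \<Longrightarrow> s < t \<Longrightarrow>
      distributed M lborel (\<lambda>\<omega>. B t \<omega> - B s \<omega>) (normal_density 0 (sqrt (t - s)))"
    and increments_indep: "0 \<le> s \<Longrightarrow> s < t \<Longrightarrow>
      indep_set (sets (F s)) {(\<lambda>\<omega>. B t \<omega> - B s \<omega>) -` A \<inter> space M | A. A \<in> sets borel}"

definition simple_integrand ::
  "(real \<Rightarrow> 'a measure) \<Rightarrow> real \<Rightarrow> real \<Rightarrow> nat \<Rightarrow> (nat \<Rightarrow> real) \<Rightarrow> (nat \<Rightarrow> 'a \<Rightarrow> real) \<Rightarrow> bool" where
  "simple_integrand F a b n \<tau> \<xi> \<longleftrightarrow>
     \<tau> 0 = a \<and> \<tau> n = b \<and> (\<forall>i<n. \<tau> i \<le> \<tau> (Suc i)) \<and>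
     (\<forall>i<n. \<xi> i \<in> borel_measurable (F (\<tau> i)) \<and> (\<exists>C. \<forall>\<omega>\<in>space (F (\<tau> i)). \<bar>\<xi> i \<omega>\<bar> \<le> C))"

definition simple_process ::
  "nat \<Rightarrow> (nat \<Rightarrow> real) \<Rightarrow> (nat \<Rightarrow> 'a \<Rightarrow> real) \<Rightarrow> real \<Rightarrow> 'a \<Rightarrow> real" where
  "simple_process n \<tau> \<xi> s \<omega> = (\<Sum>i<n. \<xi> i \<omega> * indicator {\<tau> i<..\<tau> (Suc i)} s)"

definition simple_integral ::
  "(real \<Rightarrow> 'a \<Rightarrow> real) \<Rightarrow> nat \<Rightarrow> (nat \<Rightarrow> real) \<Rightarrow> (nat \<Rightarrow> 'a \<Rightarrow> real) \<Rightarrow> 'a \<Rightarrow> real" where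
  "simple_integral B n \<tau> \<xi> \<omega> = (\<Sum>i<n. \<xi> i \<omega> * (B (\<tau> (Suc i)) \<omega> - B (\<tau> i) \<omega>))"

(* I is a version of the Ito integral of H against dB over [a,b], in the L^2 theory: the
   L^2(P)-limit of the integrals of simple adapted processes that converge to H in
   L^2(ds x P). By the Ito isometry, I is determined up to null sets by H. *)

definition has_ito_integral ::
  "'a measure \<Rightarrow> (real \<Rightarrow> 'a measure) \<Rightarrow> (real \<Rightarrow> 'a \<Rightarrow> real) \<Rightarrow> real \<Rightarrow> real \<Rightarrow>
   (real \<Rightarrow> 'a \<Rightarrow> real) \<Rightarrow> ('a \<Rightarrow> real) \<Rightarrow> bool" where
  "has_ito_integral M F B a b H I \<longleftrightarrow>
     (\<lambda>(s, \<omega>). indicator {a..b} s * H s \<omega>) \<in> borel_measurable (lborel \<Otimes>\<^sub>M M) \<and>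
     (\<forall>s\<in>{a..b}. H s \<in> borel_measurable (F s)) \<and>
     I \<in> borel_measurable M \<and>
     (\<exists>n \<tau> \<xi>.
        (\<forall>m. simple_integrand F a b (n m) (\<tau> m) (\<xi> m)) \<and>
        (\<lambda>m. \<integral>\<^sup>+\<omega>. (\<integral>\<^sup>+s. ennreal ((H s \<omega> - simple_process (n m) (\<tau> m) (\<xi> m) s \<omega>)\<^sup>2)
               * indicator {a..b} s \<partial>lborel) \<partial>M) \<longlonglongrightarrow> 0 \<and>
        (\<lambda>m. \<integral>\<^sup>+\<omega>. ennreal ((I \<omega> - simple_integral B (n m) (\<tau> m) (\<xi> m) \<omega>)\<^sup>2) \<partial>M) \<longlonglongrightarrow> 0)"

(* X solves dX_t = b(t, X_t) dt + \<sigma>(t) dB_t for t >= t0. The diffusion coefficient is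
   deterministic and the initial value X_t0 is an arbitrary F_t0-measurable variable. *)

definition additive_sde_solution ::
  "'a measure \<Rightarrow> (real \<Rightarrow> 'a measure) \<Rightarrow> (real \<Rightarrow> 'a \<Rightarrow> real) \<Rightarrow> real \<Rightarrow>
   (real \<Rightarrow> real \<Rightarrow> real) \<Rightarrow> (real \<Rightarrow> real) \<Rightarrow> (real \<Rightarrow> 'a \<Rightarrow> real) \<Rightarrow> bool" where
  "additive_sde_solution M F B t0 b \<sigma> X \<longleftrightarrow>
     (\<forall>t\<ge>t0. X t \<in> borel_measurable (F t)) \<and>
     (\<forall>\<omega>\<in>space M. continuous_on {t0..} (\<lambda>t. X t \<omega>)) \<and>
     (\<forall>t\<ge>t0. \<exists>I. has_ito_integral M F B t0 t (\<lambda>s \<omega>. \<sigma> s) I \<and>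
        (AE \<omega> in M. set_integrable lborel {t0..t} (\<lambda>s. b s (X s \<omega>)) \<and>
           X t \<omega> = X t0 \<omega> + (LINT s:{t0..t}|lborel. b s (X s \<omega>)) + I \<omega>))"

end

theory Submission
  imports Defs
begin

text \<open>
  Left of \<open>0\<close> the drift pushes the process towards \<open>0\<close>, but too weakly to carry it across. Without
  noise the distance \<open>y = - L\<close> solves \<open>y' = - f (- y) / t\<^sup>\<gamma>\<close> and stays above a multiple of
  \<open>t powr - q\<close> for some \<open>q < \<gamma> - 1/2\<close>; the two alternative hypotheses (\<open>k\<^sub>2 < 1/2\<close> when
  \<open>\<gamma> = 1\<close>, or \<open>1/2 + 1/(2 k) < \<gamma>\<close>) say precisely that there is room for such a \<open>q\<close>. The noise that is
  still to come after time \<open>t\<close> is the tail of \<open>W t = \<integral> s powr - \<gamma> dB s\<close>; its standard deviation is of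
  order \<open>t powr (1/2 - \<gamma>)\<close>, which is smaller than \<open>t powr - q\<close>. Hence a path that is slightly negative at
  a late time \<open>T\<close>, and whose noise after \<open>T\<close> is as small as expected, remains in an interval
  \<open>[- r, 0]\<close> inside the neighbourhood for ever. There the drift is nonnegative and its time integral is
  bounded, so the path converges; its limit is \<open>0\<close>, because \<open>\<integral> t powr - \<gamma> dt\<close> diverges and a limit where
  \<open>f\<close> is positive would make the accumulated drift infinite.

  Three ingredients turn this into a proof. The lemma \<open>path_converges_to_zero\<close> is the argument above for a
  single path. The lemma \<open>dyadic_oscillations_small\<close> shows that, given any event of the past of a late
  time \<open>T\<close>, the noise after \<open>T\<close> is as small as required with conditional probability at least \<open>1/2\<close>.
  The theorem \<open>reaches_every_interval\<close> shows that at any time \<open>T > 1\<close> every interval carries positive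
  probability, so that the slightly negative starting position is attained, whatever the initial value and
  the behaviour of \<open>f\<close> away from \<open>0\<close>.

  What the last two ingredients use of \<open>W\<close>, apart from its continuity, is that its increment over \<open>[s, t]\<close> is independent of
  the past of \<open>s\<close> and centred Gaussian with variance \<open>\<integral> r powr (- 2 \<gamma>) dr\<close>. This is
  \<open>ito_increment_law\<close>. Since the Ito integral is given by arbitrary approximating simple processes, the
  isometry is used first to replace these by explicit Riemann sums of Brownian increments, whose
  characteristic function is known; the passage to the limit is then made in the characteristic function.
\<close>

section \<open>Increments of Brownian motion and the Ito isometry\<close>

context brownian_motion
begin

lemma measurable_from_past: "X \<in> borel_measurable (F t) \<Longrightarrow> 0 \<le> t \<Longrightarrow> X \<in> borel_measurable M"
  using measurable_from_subalg[OF subalgebra_F] by blast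

lemma measurable_later: "X \<in> borel_measurable (F s) \<Longrightarrow> s \<le> t \<Longrightarrow> X \<in> borel_measurable (F t)"
  by (rule measurable_from_subalg[of "F t" "F s"]) (auto simp: subalgebra_def space_F sets_F_mono)

lemma B_measurable [measurable]: "0 \<le> t \<Longrightarrow> B t \<in> borel_measurable M"
  using measurable_from_past adapted by blast

lemma adapted_later: "0 \<le> s \<Longrightarrow> s \<le> t \<Longrightarrow> B s \<in> borel_measurable (F t)"
  using measurable_later adapted by blast

lemma past_event: "A \<in> sets (F s) \<Longrightarrow> 0 \<le> s \<Longrightarrow> A \<in> sets M"
  using subalgebra_F[of s] by (auto simp: subalgebra_def)

text \<open>The independence of an increment from the past is an assertion about events. It is needed for
  products of integrable functions, with values in the reals for the isometry and in the complex numbers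
  for characteristic functions.\<close>

lemma
  fixes Y :: "'a \<Rightarrow> 'b::{real_normed_field, banach, second_countable_topology}"
  assumes st: "0 \<le> s" "s < t"
    and Y: "Y \<in> borel_measurable (F s)" "integrable M Y"
    and g: "g \<in> borel_measurable borel" "integrable M (\<lambda>\<omega>. g (B t \<omega> - B s \<omega>))"
  shows integrable_mult_increment: "integrable M (\<lambda>\<omega>. Y \<omega> * g (B t \<omega> - B s \<omega>))" (is ?int)
    and expectation_mult_increment:
      "(\<integral>\<omega>. Y \<omega> * g (B t \<omega> - B s \<omega>) \<partial>M) = (\<integral>\<omega>. Y \<omega> \<partial>M) * (\<integral>\<omega>. g (B t \<omega> - B s \<omega>) \<partial>M)" (is ?eq)
proof -
  let ?D = "\<lambda>\<omega>. B t \<omega> - B s \<omega>"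
  have DM [measurable]: "?D \<in> borel_measurable M"
    using st by (intro borel_measurable_diff B_measurable) auto
  have YM [measurable]: "Y \<in> borel_measurable M"
    using measurable_from_past Y st by blast
  have "sigma_sets (space M) {Y -` A \<inter> space M |A. A \<in> sets borel} \<subseteq> sets (F s)"
  proof -
    have "{Y -` A \<inter> space M |A. A \<in> sets borel} \<subseteq> sets (F s)"
      using measurable_sets[OF Y(1)] by (auto simp: space_F)
    then show ?thesis
      using sets.sigma_sets_subset[of _ "F s"] by (simp add: space_F)
  qed
  moreover have "sigma_sets (space M) {(\<lambda>\<omega>. g (?D \<omega>)) -` A \<inter> space M |A. A \<in> sets borel}
      \<subseteq> sigma_sets (space M) {?D -` A \<inter> space M |A. A \<in> sets borel}"
  proof (intro sigma_sets_mono subsetI)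
    fix X assume "X \<in> {(\<lambda>\<omega>. g (?D \<omega>)) -` A \<inter> space M |A. A \<in> sets borel}"
    then obtain A where "A \<in> sets borel" and X: "X = (\<lambda>\<omega>. g (?D \<omega>)) -` A \<inter> space M" by auto
    moreover have "g -` A \<in> sets borel"
      using measurable_sets[OF g(1) \<open>A \<in> sets borel\<close>] by simp
    moreover have "X = ?D -` (g -` A) \<inter> space M" using X by auto
    ultimately show "X \<in> sigma_sets (space M) {?D -` A \<inter> space M |A. A \<in> sets borel}" by blast
  qed
  moreover have "indep_set (sigma_sets (space M) (sets (F s)))
      (sigma_sets (space M) {?D -` A \<inter> space M |A. A \<in> sets borel})"
  proof (rule indep_set_sigma_sets[OF increments_indep[OF st]])
    show "Int_stable (sets (F s))" by (auto simp: Int_stable_def)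
    show "Int_stable {?D -` A \<inter> space M |A. A \<in> sets borel}"
    proof (clarsimp simp: Int_stable_def)
      fix A A' :: "real set" assume "A \<in> sets borel" "A' \<in> sets borel"
      then show "\<exists>A''. ?D -` A \<inter> space M \<inter> (?D -` A' \<inter> space M) = ?D -` A'' \<inter> space M \<and> A'' \<in> sets borel"
        by (intro exI[of _ "A \<inter> A'"]) auto
    qed
  qed
  moreover have "sigma_sets (space M) (sets (F s)) = sets (F s)"
    using sets.sigma_sets_eq[of "F s"] by (simp add: space_F)
  ultimately have "indep_set (sigma_sets (space M) {Y -` A \<inter> space M |A. A \<in> sets borel})
      (sigma_sets (space M) {(\<lambda>\<omega>. g (?D \<omega>)) -` A \<inter> space M |A. A \<in> sets borel})"
    unfolding indep_sets2_eq by (blast intro: order_trans)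
  then have "indep_var borel Y borel (\<lambda>\<omega>. g (?D \<omega>))"
    unfolding indep_var_eq using g(1) by auto
  then show ?int ?eq
    using indep_var_integrable indep_var_lebesgue_integral Y(2) g(2) by blast+
qed

lemma
  assumes "0 \<le> s" "s \<le> t"
  shows integrable_increment: "integrable M (\<lambda>\<omega>. B t \<omega> - B s \<omega>)"
    and integrable_increment_sq: "integrable M (\<lambda>\<omega>. (B t \<omega> - B s \<omega>)\<^sup>2)"
    and expectation_increment: "expectation (\<lambda>\<omega>. B t \<omega> - B s \<omega>) = 0"
    and expectation_increment_sq: "expectation (\<lambda>\<omega>. (B t \<omega> - B s \<omega>)\<^sup>2) = t - s"
proof -
  let ?D = "\<lambda>\<omega>. B t \<omega> - B s \<omega>"
  have "integrable M ?D \<and> integrable M (\<lambda>\<omega>. (?D \<omega>)\<^sup>2) \<and> expectation ?D = 0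
      \<and> expectation (\<lambda>\<omega>. (?D \<omega>)\<^sup>2) = t - s"
  proof (cases "s = t")
    case False
    then have st: "0 \<le> s" "s < t" and sd: "0 < sqrt (t - s)" using assms by auto
    note D = increments_normal[OF st]
    have 1: "integrable M ?D"
      using distributed_integrable[OF D, of "\<lambda>x. x"] integrable_normal_moment[OF sd, of 0 1] by simp
    have 2: "integrable M (\<lambda>\<omega>. (?D \<omega>)\<^sup>2)"
      using distributed_integrable[OF D, of "\<lambda>x. x\<^sup>2"] integrable_normal_moment[OF sd, of 0 2] by simp
    show ?thesis
      using 1 2 normal_distributed_expectation[OF sd D] normal_distributed_variance[OF sd D] st by simp
  qed simp
  then show "integrable M ?D" "integrable M (\<lambda>\<omega>. (?D \<omega>)\<^sup>2)" "expectation ?D = 0"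
      "expectation (\<lambda>\<omega>. (?D \<omega>)\<^sup>2) = t - s" by blast+
qed

lemma
  assumes st: "0 \<le> s" "s \<le> t" and X: "X \<in> borel_measurable (F s)" "integrable M X"
  shows integrable_martingale_diff: "integrable M (\<lambda>\<omega>. X \<omega> * (B t \<omega> - B s \<omega>))"
    and expectation_martingale_diff: "expectation (\<lambda>\<omega>. X \<omega> * (B t \<omega> - B s \<omega>)) = 0"
proof -
  have "integrable M (\<lambda>\<omega>. X \<omega> * (B t \<omega> - B s \<omega>)) \<and> expectation (\<lambda>\<omega>. X \<omega> * (B t \<omega> - B s \<omega>)) = 0"
  proof (cases "s = t")
    case False
    then show ?thesis
      using integrable_mult_increment[of s t X "\<lambda>x. x"] expectation_mult_increment[of s t X "\<lambda>x. x"]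
        integrable_increment[of s t] expectation_increment[of s t] X st by simp
  qed simp
  then show "integrable M (\<lambda>\<omega>. X \<omega> * (B t \<omega> - B s \<omega>))"
    "expectation (\<lambda>\<omega>. X \<omega> * (B t \<omega> - B s \<omega>)) = 0" by blast+
qed

lemma
  assumes st: "0 \<le> s" "s \<le> t" and X: "X \<in> borel_measurable (F s)" "integrable M X"
  shows integrable_mult_increment_sq: "integrable M (\<lambda>\<omega>. X \<omega> * (B t \<omega> - B s \<omega>)\<^sup>2)"
    and expectation_mult_increment_sq:
      "expectation (\<lambda>\<omega>. X \<omega> * (B t \<omega> - B s \<omega>)\<^sup>2) = expectation X * (t - s)"
proof -
  have "integrable M (\<lambda>\<omega>. X \<omega> * (B t \<omega> - B s \<omega>)\<^sup>2) \<and>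
      expectation (\<lambda>\<omega>. X \<omega> * (B t \<omega> - B s \<omega>)\<^sup>2) = expectation X * (t - s)"
  proof (cases "s = t")
    case False
    then show ?thesis
      using integrable_mult_increment[of s t X "\<lambda>x. x\<^sup>2"] expectation_mult_increment[of s t X "\<lambda>x. x\<^sup>2"]
        integrable_increment_sq[of s t] expectation_increment_sq[of s t] X st by simp
  qed simp
  then show "integrable M (\<lambda>\<omega>. X \<omega> * (B t \<omega> - B s \<omega>)\<^sup>2)"
    "expectation (\<lambda>\<omega>. X \<omega> * (B t \<omega> - B s \<omega>)\<^sup>2) = expectation X * (t - s)" by blast+
qed

text \<open>With the weight measurable at the later of the two left end points, the overlap of the two intervals
  contributes the square of one increment, and every other part of the product has a factor that is an
  increment lying in the future of all the others and so vanishes in the mean.\<close>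

lemma cross_moment_ordered:
  assumes u: "0 \<le> u" "u \<le> u'" and v: "u \<le> v" "u' \<le> v'"
    and Z: "Z \<in> borel_measurable (F u')" and C: "\<And>\<omega>. \<omega> \<in> space M \<Longrightarrow> \<bar>Z \<omega>\<bar> \<le> C"
  shows "integrable M (\<lambda>\<omega>. Z \<omega> * (B v \<omega> - B u \<omega>) * (B v' \<omega> - B u' \<omega>)) \<and>
    expectation (\<lambda>\<omega>. Z \<omega> * (B v \<omega> - B u \<omega>) * (B v' \<omega> - B u' \<omega>)) =
      expectation Z * measure lborel ({u<..v} \<inter> {u'<..v'})"
proof -
  have bdd: "integrable M (\<lambda>\<omega>. Z \<omega> * X \<omega>)" if "integrable M X" for X
  proof (rule Bochner_Integration.integrable_bound[of _ "\<lambda>\<omega>. C * X \<omega>"])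
    show "AE \<omega> in M. norm (Z \<omega> * X \<omega>) \<le> norm (C * X \<omega>)"
    proof (rule AE_I2)
      fix \<omega> assume "\<omega> \<in> space M"
      then have "\<bar>Z \<omega>\<bar> \<le> \<bar>C\<bar>" using C by force
      then show "norm (Z \<omega> * X \<omega>) \<le> norm (C * X \<omega>)" by (simp add: abs_mult mult_right_mono)
    qed
    show "(\<lambda>\<omega>. Z \<omega> * X \<omega>) \<in> borel_measurable M"
      using that measurable_from_past[OF Z] u by auto
  qed (use that in auto)
  have Zint: "integrable M Z" using bdd[of "\<lambda>_. 1"] by simp
  show ?thesis
  proof (cases "v \<le> u'")
    case True
    have "(\<lambda>\<omega>. Z \<omega> * (B v \<omega> - B u \<omega>)) \<in> borel_measurable (F u')"
      using Z True u v by (intro borel_measurable_times borel_measurable_diff adapted_later) auto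
    moreover have "integrable M (\<lambda>\<omega>. Z \<omega> * (B v \<omega> - B u \<omega>))"
      using bdd integrable_increment u v by auto
    moreover have "{u<..v} \<inter> {u'<..v'} = {}" using True by auto
    ultimately show ?thesis
      using integrable_martingale_diff expectation_martingale_diff u v by auto
  next
    case False
    define w where "w = min v v'"
    have w: "u' \<le> w" "w \<le> v" "w \<le> v'" "w = v \<or> w = v'" using False v by (auto simp: w_def)
    let ?X1 = "\<lambda>\<omega>. (Z \<omega> * (B u' \<omega> - B u \<omega>)) * (B v' \<omega> - B u' \<omega>)"
    let ?X2 = "\<lambda>\<omega>. Z \<omega> * (B w \<omega> - B u' \<omega>)\<^sup>2"
    let ?X3 = "\<lambda>\<omega>. (Z \<omega> * (B w \<omega> - B u' \<omega>)) * (B v' \<omega> - B w \<omega>)"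
    let ?X4 = "\<lambda>\<omega>. (Z \<omega> * (B w \<omega> - B u' \<omega>)) * (B v \<omega> - B w \<omega>)"
    (* Since w is v or v', one of the two overhanging increments is zero, and their product drops out. *)
    have split: "(\<lambda>\<omega>. Z \<omega> * (B v \<omega> - B u \<omega>) * (B v' \<omega> - B u' \<omega>)) = (\<lambda>\<omega>. ?X1 \<omega> + ?X2 \<omega> + ?X3 \<omega> + ?X4 \<omega>)"
      using w(4) by (auto simp: fun_eq_iff algebra_simps power2_eq_square)
    have mZ: "Z \<in> borel_measurable (F w)" using measurable_later Z w by blast
    have Xu: "(\<lambda>\<omega>. Z \<omega> * (B u' \<omega> - B u \<omega>)) \<in> borel_measurable (F u')"
      using Z u by (intro borel_measurable_times borel_measurable_diff adapted_later) auto
    have Xui: "integrable M (\<lambda>\<omega>. Z \<omega> * (B u' \<omega> - B u \<omega>))"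
      using u by (intro bdd integrable_increment) auto
    have 1: "integrable M ?X1 \<and> expectation ?X1 = 0"
      using u v integrable_martingale_diff[OF _ _ Xu Xui] expectation_martingale_diff[OF _ _ Xu Xui] by auto
    have 2: "integrable M ?X2 \<and> expectation ?X2 = expectation Z * (w - u')"
      using u v Z Zint w by (intro conjI integrable_mult_increment_sq expectation_mult_increment_sq) auto
    have Xw: "(\<lambda>\<omega>. Z \<omega> * (B w \<omega> - B u' \<omega>)) \<in> borel_measurable (F w)"
      using mZ u v w by (intro borel_measurable_times borel_measurable_diff adapted_later) auto
    have Xi: "integrable M (\<lambda>\<omega>. Z \<omega> * (B w \<omega> - B u' \<omega>))"
      using u w by (intro bdd integrable_increment) auto
    have 3: "integrable M ?X3 \<and> expectation ?X3 = 0"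
      using u v w integrable_martingale_diff[OF _ _ Xw Xi] expectation_martingale_diff[OF _ _ Xw Xi] by auto
    have 4: "integrable M ?X4 \<and> expectation ?X4 = 0"
      using u v w integrable_martingale_diff[OF _ _ Xw Xi] expectation_martingale_diff[OF _ _ Xw Xi] by auto
    have "{u<..v} \<inter> {u'<..v'} = {u'<..w}" using u False by (auto simp: w_def)
    then have "measure lborel ({u<..v} \<inter> {u'<..v'}) = w - u'" using w by simp
    then show ?thesis unfolding split using 1 2 3 4 by simp
  qed
qed

lemma cross_moment:
  assumes u: "0 \<le> u" "u \<le> v" "0 \<le> u'" "u' \<le> v'"
    and Z: "Z \<in> borel_measurable (F u)" "Z' \<in> borel_measurable (F u')"
    and C: "\<And>\<omega>. \<omega> \<in> space M \<Longrightarrow> \<bar>Z \<omega>\<bar> \<le> C" "\<And>\<omega>. \<omega> \<in> space M \<Longrightarrow> \<bar>Z' \<omega>\<bar> \<le> C'"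
  shows "integrable M (\<lambda>\<omega>. (Z \<omega> * (B v \<omega> - B u \<omega>)) * (Z' \<omega> * (B v' \<omega> - B u' \<omega>))) \<and>
    expectation (\<lambda>\<omega>. (Z \<omega> * (B v \<omega> - B u \<omega>)) * (Z' \<omega> * (B v' \<omega> - B u' \<omega>))) =
      expectation (\<lambda>\<omega>. Z \<omega> * Z' \<omega>) * measure lborel ({u<..v} \<inter> {u'<..v'})"
proof -
  have CC: "\<bar>Z \<omega> * Z' \<omega>\<bar> \<le> C * C'" if "\<omega> \<in> space M" for \<omega>
    using C[OF that] by (auto simp: abs_mult intro!: mult_mono)
  show ?thesis
  proof (cases "u \<le> u'")
    case True
    have "(\<lambda>\<omega>. Z \<omega> * Z' \<omega>) \<in> borel_measurable (F u')"
      using Z measurable_later[OF _ True] by (intro borel_measurable_times) auto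
    from cross_moment_ordered[OF _ True _ _ this CC, of v v'] show ?thesis
      using u by (simp add: mult_ac)
  next
    case False
    then have le: "u' \<le> u" by simp
    have "(\<lambda>\<omega>. Z \<omega> * Z' \<omega>) \<in> borel_measurable (F u)"
      using Z measurable_later[OF _ le] by (intro borel_measurable_times) auto
    from cross_moment_ordered[OF _ le _ _ this CC, of v' v] show ?thesis
      using u by (simp add: mult_ac Int_commute)
  qed
qed

end

lemma
  fixes h :: "'i \<Rightarrow> 'i \<Rightarrow> 'b \<Rightarrow> real"
  assumes "\<And>i j. i \<in> J \<Longrightarrow> j \<in> J \<Longrightarrow> integrable N (h i j)"
  shows integrable_double_sum: "integrable N (\<lambda>x. \<Sum>i\<in>J. \<Sum>j\<in>J. h i j x)"
    and integral_double_sum: "(\<integral>x. (\<Sum>i\<in>J. \<Sum>j\<in>J. h i j x) \<partial>N) = (\<Sum>i\<in>J. \<Sum>j\<in>J. \<integral>x. h i j x \<partial>N)"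
  using assms by (auto intro!: Bochner_Integration.integrable_sum)

context brownian_motion begin

text \<open>The intervals may overlap arbitrarily, so that the isometry applies directly to the difference of a given
  simple integral and a Riemann sum, whose partitions have nothing to do with each other.\<close>

theorem ito_isometry:
  fixes u v :: "'i \<Rightarrow> real" and Z :: "'i \<Rightarrow> 'a \<Rightarrow> real"
  assumes J: "finite J" and u: "\<And>j. j \<in> J \<Longrightarrow> 0 \<le> u j" "\<And>j. j \<in> J \<Longrightarrow> u j \<le> v j"
    and Z: "\<And>j. j \<in> J \<Longrightarrow> Z j \<in> borel_measurable (F (u j))"
    and C: "\<And>j. j \<in> J \<Longrightarrow> \<exists>C. \<forall>\<omega>\<in>space M. \<bar>Z j \<omega>\<bar> \<le> C"
  shows "(\<integral>\<^sup>+\<omega>. ennreal ((\<Sum>j\<in>J. Z j \<omega> * (B (v j) \<omega> - B (u j) \<omega>))\<^sup>2) \<partial>M) =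
    (\<integral>\<^sup>+\<omega>. (\<integral>\<^sup>+s. ennreal ((\<Sum>j\<in>J. Z j \<omega> * indicator {u j<..v j} s)\<^sup>2) \<partial>lborel) \<partial>M)"
proof -
  let ?I = "\<lambda>i j. measure lborel ({u i<..v i} \<inter> {u j<..v j})"
  have cm: "integrable M (\<lambda>\<omega>. (Z i \<omega> * (B (v i) \<omega> - B (u i) \<omega>)) * (Z j \<omega> * (B (v j) \<omega> - B (u j) \<omega>))) \<and>
      expectation (\<lambda>\<omega>. (Z i \<omega> * (B (v i) \<omega> - B (u i) \<omega>)) * (Z j \<omega> * (B (v j) \<omega> - B (u j) \<omega>))) =
        expectation (\<lambda>\<omega>. Z i \<omega> * Z j \<omega>) * ?I i j" if ij: "i \<in> J" "j \<in> J" for i j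
  proof -
    obtain C1 C2 where "\<forall>\<omega>\<in>space M. \<bar>Z i \<omega>\<bar> \<le> C1" "\<forall>\<omega>\<in>space M. \<bar>Z j \<omega>\<bar> \<le> C2"
      using C ij by meson
    then show ?thesis
      by (intro cross_moment[OF u(1)[OF ij(1)] u(2)[OF ij(1)] u(1)[OF ij(2)] u(2)[OF ij(2)]
            Z[OF ij(1)] Z[OF ij(2)]]) auto
  qed
  have ZZ: "integrable M (\<lambda>\<omega>. Z i \<omega> * Z j \<omega>)" if ij: "i \<in> J" "j \<in> J" for i j
  proof -
    obtain C1 C2 where C12: "\<forall>\<omega>\<in>space M. \<bar>Z i \<omega>\<bar> \<le> C1" "\<forall>\<omega>\<in>space M. \<bar>Z j \<omega>\<bar> \<le> C2"
      using C ij by blast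
    have [measurable]: "Z i \<in> borel_measurable M" "Z j \<in> borel_measurable M"
      using Z u measurable_from_past ij by blast+
    show ?thesis
    proof (rule integrable_const_bound[of _ "C1 * C2"])
      show "AE \<omega> in M. norm (Z i \<omega> * Z j \<omega>) \<le> C1 * C2"
      proof (rule AE_I2)
        fix \<omega> assume "\<omega> \<in> space M"
        with C12 have "\<bar>Z i \<omega>\<bar> \<le> C1" "\<bar>Z j \<omega>\<bar> \<le> C2" by auto
        then show "norm (Z i \<omega> * Z j \<omega>) \<le> C1 * C2" by (auto simp: abs_mult intro!: mult_mono)
      qed
    qed measurable
  qed
  have sq: "(\<Sum>j\<in>J. X j)\<^sup>2 = (\<Sum>i\<in>J. \<Sum>j\<in>J. X i * X j)" for X :: "'i \<Rightarrow> real"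
    unfolding power2_eq_square by (rule sum_product)
  have inner: "(\<integral>\<^sup>+s. ennreal ((\<Sum>j\<in>J. Z j \<omega> * indicator {u j<..v j} s)\<^sup>2) \<partial>lborel) =
      ennreal (\<Sum>i\<in>J. \<Sum>j\<in>J. Z i \<omega> * Z j \<omega> * ?I i j) \<and> 0 \<le> (\<Sum>i\<in>J. \<Sum>j\<in>J. Z i \<omega> * Z j \<omega> * ?I i j)" for \<omega>
  proof -
    have eq: "(\<Sum>j\<in>J. Z j \<omega> * indicator {u j<..v j} s)\<^sup>2 =
        (\<Sum>i\<in>J. \<Sum>j\<in>J. Z i \<omega> * Z j \<omega> * indicator ({u i<..v i} \<inter> {u j<..v j}) s)" for s
      unfolding sq by (intro sum.cong refl) (simp only: indicator_inter_arith mult_ac)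
    have em: "emeasure lborel ({u i<..v i} \<inter> {u j<..v j}) < \<infinity>" for i j
      by (rule emeasure_bounded_finite, rule bounded_subset[of "{u i..v i}"]) auto
    have int: "integrable lborel (\<lambda>s. Z i \<omega> * Z j \<omega> * indicator ({u i<..v i} \<inter> {u j<..v j}) s)" for i j
      using em by (intro integrable_mult_right integrable_real_indicator) auto
    have val: "(\<integral>s. (\<Sum>j\<in>J. Z j \<omega> * indicator {u j<..v j} s)\<^sup>2 \<partial>lborel) = (\<Sum>i\<in>J. \<Sum>j\<in>J. Z i \<omega> * Z j \<omega> * ?I i j)"
      unfolding eq by (subst integral_double_sum[OF int]) simp
    have "integrable lborel (\<lambda>s. (\<Sum>j\<in>J. Z j \<omega> * indicator {u j<..v j} s)\<^sup>2)"
      unfolding eq by (rule integrable_double_sum[OF int])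
    then have "(\<integral>\<^sup>+s. ennreal ((\<Sum>j\<in>J. Z j \<omega> * indicator {u j<..v j} s)\<^sup>2) \<partial>lborel) =
       ennreal (\<integral>s. (\<Sum>j\<in>J. Z j \<omega> * indicator {u j<..v j} s)\<^sup>2 \<partial>lborel)"
      by (intro nn_integral_eq_integral) auto
    moreover have "0 \<le> (\<integral>s. (\<Sum>j\<in>J. Z j \<omega> * indicator {u j<..v j} s)\<^sup>2 \<partial>lborel)" by simp
    ultimately show ?thesis unfolding val by simp
  qed
  have "(\<integral>\<^sup>+\<omega>. ennreal ((\<Sum>j\<in>J. Z j \<omega> * (B (v j) \<omega> - B (u j) \<omega>))\<^sup>2) \<partial>M) =
      ennreal (expectation (\<lambda>\<omega>. (\<Sum>j\<in>J. Z j \<omega> * (B (v j) \<omega> - B (u j) \<omega>))\<^sup>2))"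
  proof (rule nn_integral_eq_integral)
    show "integrable M (\<lambda>\<omega>. (\<Sum>j\<in>J. Z j \<omega> * (B (v j) \<omega> - B (u j) \<omega>))\<^sup>2)"
      unfolding sq by (rule Bochner_Integration.integrable_sum)+ (rule cm[THEN conjunct1])
  qed simp
  also have "expectation (\<lambda>\<omega>. (\<Sum>j\<in>J. Z j \<omega> * (B (v j) \<omega> - B (u j) \<omega>))\<^sup>2) =
      (\<Sum>i\<in>J. \<Sum>j\<in>J. expectation (\<lambda>\<omega>. Z i \<omega> * Z j \<omega>) * ?I i j)"
    unfolding sq using cm by (subst integral_double_sum) auto
  also have "\<dots> = expectation (\<lambda>\<omega>. \<Sum>i\<in>J. \<Sum>j\<in>J. Z i \<omega> * Z j \<omega> * ?I i j)"
    using ZZ by (subst integral_double_sum) auto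
  also have "ennreal \<dots> = (\<integral>\<^sup>+\<omega>. ennreal (\<Sum>i\<in>J. \<Sum>j\<in>J. Z i \<omega> * Z j \<omega> * ?I i j) \<partial>M)"
  proof (rule nn_integral_eq_integral[symmetric])
    show "integrable M (\<lambda>\<omega>. \<Sum>i\<in>J. \<Sum>j\<in>J. Z i \<omega> * Z j \<omega> * ?I i j)"
      by (rule Bochner_Integration.integrable_sum)+ (rule integrable_mult_left, rule ZZ)
  qed (use inner in auto)
  finally show ?thesis using inner by simp
qed

end

section \<open>Approximation of the Ito integral of a deterministic function\<close>

lemma ennreal_sq_triangle:
  "ennreal ((x - z)\<^sup>2) \<le> 2 * ennreal ((x - y)\<^sup>2) + 2 * ennreal ((y - z)\<^sup>2)"
proof -
  have "0 \<le> ((x - y) - (y - z))\<^sup>2" by simp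
  then have "(x - z)\<^sup>2 \<le> 2 * (x - y)\<^sup>2 + 2 * (y - z)\<^sup>2"
    by (simp add: power2_eq_square algebra_simps)
  then have "ennreal ((x - z)\<^sup>2) \<le> ennreal (2 * (x - y)\<^sup>2 + 2 * (y - z)\<^sup>2)"
    by (rule ennreal_leI)
  then show ?thesis
    by (simp add: ennreal_plus ennreal_mult)
qed

context brownian_motion begin

text \<open>If \<open>S\<^sub>m\<close> are the simple integrals that define \<open>I\<close>, then \<open>I - D = (I - S\<^sub>m) + (S\<^sub>m - D)\<close>, and the
  isometry identifies the second term with the distance of two step processes, which is compared through
  \<open>\<sigma>\<close>. Each of the two triangle inequalities costs a factor \<open>2\<close>, and all terms but one vanish as
  \<open>m\<close> tends to infinity. So every step function close to \<open>\<sigma>\<close> yields a good approximation of \<open>I\<close>.\<close>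

lemma ito_integral_approx:
  fixes u v c :: "'i \<Rightarrow> real" and \<sigma> :: "real \<Rightarrow> real"
  assumes a: "0 \<le> a" and H: "has_ito_integral M F B a b (\<lambda>s \<omega>. \<sigma> s) I"
    and J: "finite J" and uv: "\<And>j. j \<in> J \<Longrightarrow> a \<le> u j \<and> u j \<le> v j \<and> v j \<le> b"
  shows "(\<integral>\<^sup>+\<omega>. ennreal ((I \<omega> - (\<Sum>j\<in>J. c j * (B (v j) \<omega> - B (u j) \<omega>)))\<^sup>2) \<partial>M)
    \<le> 4 * (\<integral>\<^sup>+s. ennreal ((\<sigma> s - (\<Sum>j\<in>J. c j * indicator {u j<..v j} s))\<^sup>2) * indicator {a..b} s \<partial>lborel)"
proof -
  define D where "D \<omega> = (\<Sum>j\<in>J. c j * (B (v j) \<omega> - B (u j) \<omega>))" for \<omega>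
  define st where "st s = (\<Sum>j\<in>J. c j * indicator {u j<..v j} s)" for s :: real
  define e where "e = (\<integral>\<^sup>+s. ennreal ((\<sigma> s - st s)\<^sup>2) * indicator {a..b} s \<partial>lborel)"
  obtain n \<tau> \<xi> where
      simple: "\<And>m. simple_integrand F a b (n m) (\<tau> m) (\<xi> m)" and
      lim1: "(\<lambda>m. \<integral>\<^sup>+\<omega>. (\<integral>\<^sup>+s. ennreal ((\<sigma> s - simple_process (n m) (\<tau> m) (\<xi> m) s \<omega>)\<^sup>2)
               * indicator {a..b} s \<partial>lborel) \<partial>M) \<longlonglongrightarrow> 0" and
      lim2: "(\<lambda>m. \<integral>\<^sup>+\<omega>. ennreal ((I \<omega> - simple_integral B (n m) (\<tau> m) (\<xi> m) \<omega>)\<^sup>2) \<partial>M) \<longlonglongrightarrow> 0" and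
      IM [measurable]: "I \<in> borel_measurable M" and
      \<sigma>2: "(\<lambda>(s, \<omega>). indicator {a..b} s * \<sigma> s) \<in> borel_measurable (lborel \<Otimes>\<^sub>M M)"
    using H unfolding has_ito_integral_def by blast
  define A where "A m = (\<integral>\<^sup>+\<omega>. (\<integral>\<^sup>+s. ennreal ((\<sigma> s - simple_process (n m) (\<tau> m) (\<xi> m) s \<omega>)\<^sup>2)
               * indicator {a..b} s \<partial>lborel) \<partial>M)" for m
  define A' where "A' m = (\<integral>\<^sup>+\<omega>. ennreal ((I \<omega> - simple_integral B (n m) (\<tau> m) (\<xi> m) \<omega>)\<^sup>2) \<partial>M)" for m
  obtain \<omega>0 where "\<omega>0 \<in> space M" using not_empty by blast
  then have \<sigma>M [measurable]: "(\<lambda>s. indicator {a..b} s * \<sigma> s) \<in> borel_measurable borel"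
    using measurable_compose[OF measurable_Pair2' \<sigma>2, of \<omega>0] by simp
  have DM [measurable]: "D \<in> borel_measurable M"
    unfolding D_def using uv a by (intro borel_measurable_sum borel_measurable_times borel_measurable_diff B_measurable) force+
  have stM [measurable]: "st \<in> borel_measurable borel"
    unfolding st_def by measurable
  have bound: "(\<integral>\<^sup>+\<omega>. ennreal ((I \<omega> - D \<omega>)\<^sup>2) \<partial>M) \<le> 2 * A' m + 2 * (2 * A m + 2 * e)" for m
  proof -
    let ?S = "simple_integral B (n m) (\<tau> m) (\<xi> m)" and ?P = "simple_process (n m) (\<tau> m) (\<xi> m)"
    have \<tau>: "\<tau> m 0 = a" "\<tau> m (n m) = b" "\<And>i. i < n m \<Longrightarrow> \<tau> m i \<le> \<tau> m (Suc i)"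
      and \<xi>: "\<And>i. i < n m \<Longrightarrow> \<xi> m i \<in> borel_measurable (F (\<tau> m i))"
        "\<And>i. i < n m \<Longrightarrow> \<exists>C. \<forall>\<omega>\<in>space M. \<bar>\<xi> m i \<omega>\<bar> \<le> C"
      using simple[of m] unfolding simple_integrand_def by (auto simp: space_F)
    have \<tau>a: "i \<le> n m \<Longrightarrow> a \<le> \<tau> m i" for i
    proof (induction i)
      case (Suc i)
      then show ?case using \<tau>(3)[of i] by simp
    qed (simp add: \<tau>)
    have \<tau>b: "i \<le> n m \<Longrightarrow> \<tau> m i \<le> b" for i
    proof (induction i rule: inc_induct)
      case (step i)
      then show ?case using \<tau>(3)[of i] by simp
    qed (simp add: \<tau>)
    have \<xi>M [measurable]: "i < n m \<Longrightarrow> \<xi> m i \<in> borel_measurable M" for i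
      using \<xi>(1)[of i] \<tau>a[of i] a by (intro measurable_from_past[of _ "\<tau> m i"]) auto
    have SM [measurable]: "?S \<in> borel_measurable M"
      unfolding simple_integral_def using order_trans[OF a \<tau>a]
      by (intro borel_measurable_sum borel_measurable_times borel_measurable_diff B_measurable \<xi>M) auto
    have PM [measurable]: "(\<lambda>(\<omega>, s). ?P s \<omega>) \<in> borel_measurable (M \<Otimes>\<^sub>M lborel)"
      unfolding simple_process_def split_def
      by (intro borel_measurable_sum borel_measurable_times measurable_compose[OF measurable_fst \<xi>M]) auto
    have Ps [measurable]: "(\<lambda>s. ?P s \<omega>) \<in> borel_measurable borel" for \<omega>
      unfolding simple_process_def by measurable
    have 1: "(\<integral>\<^sup>+\<omega>. ennreal ((I \<omega> - D \<omega>)\<^sup>2) \<partial>M) \<le> 2 * A' m + 2 * (\<integral>\<^sup>+\<omega>. ennreal ((?S \<omega> - D \<omega>)\<^sup>2) \<partial>M)"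
    proof -
      have "(\<integral>\<^sup>+\<omega>. ennreal ((I \<omega> - D \<omega>)\<^sup>2) \<partial>M)
          \<le> (\<integral>\<^sup>+\<omega>. 2 * ennreal ((I \<omega> - ?S \<omega>)\<^sup>2) + 2 * ennreal ((?S \<omega> - D \<omega>)\<^sup>2) \<partial>M)"
        by (intro nn_integral_mono ennreal_sq_triangle)
      also have "\<dots> = 2 * A' m + 2 * (\<integral>\<^sup>+\<omega>. ennreal ((?S \<omega> - D \<omega>)\<^sup>2) \<partial>M)"
        unfolding A'_def by (subst nn_integral_add) (auto simp: nn_integral_cmult)
      finally show ?thesis .
    qed
    (* The difference of the two sums is one weighted sum of increments, indexed by the disjoint union. *)
    let ?K = "{..<n m} <+> J"
    let ?u = "case_sum (\<tau> m) u" and ?v = "case_sum (\<lambda>i. \<tau> m (Suc i)) v"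
    let ?Z = "case_sum (\<xi> m) (\<lambda>j \<omega>. - c j)"
    have K: "finite ?K" using J by simp
    have "(\<integral>\<^sup>+\<omega>. ennreal ((\<Sum>j\<in>?K. ?Z j \<omega> * (B (?v j) \<omega> - B (?u j) \<omega>))\<^sup>2) \<partial>M) =
        (\<integral>\<^sup>+\<omega>. (\<integral>\<^sup>+s. ennreal ((\<Sum>j\<in>?K. ?Z j \<omega> * indicator {?u j<..?v j} s)\<^sup>2) \<partial>lborel) \<partial>M)"
    proof (rule ito_isometry[OF K])
      fix j assume j: "j \<in> ?K"
      have "0 \<le> ?u j \<and> ?u j \<le> ?v j \<and> ?Z j \<in> borel_measurable (F (?u j)) \<and> (\<exists>C. \<forall>\<omega>\<in>space M. \<bar>?Z j \<omega>\<bar> \<le> C)"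
      proof (cases j)
        case (Inl i)
        then show ?thesis using j \<tau>(3)[of i] \<xi>[of i] \<tau>a[of i] a by auto
      next
        case (Inr i)
        then show ?thesis using j uv[of i] a by auto
      qed
      then show "0 \<le> ?u j" "?u j \<le> ?v j" "?Z j \<in> borel_measurable (F (?u j))" "\<exists>C. \<forall>\<omega>\<in>space M. \<bar>?Z j \<omega>\<bar> \<le> C"
        by blast+
    qed
    moreover have "(\<Sum>j\<in>?K. ?Z j \<omega> * (B (?v j) \<omega> - B (?u j) \<omega>)) = ?S \<omega> - D \<omega>" for \<omega>
      using J by (subst sum.Plus) (simp_all add: simple_integral_def D_def sum_negf)
    moreover have "(\<Sum>j\<in>?K. ?Z j \<omega> * indicator {?u j<..?v j} s) = ?P s \<omega> - st s" for \<omega> s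
      using J by (subst sum.Plus) (simp_all add: simple_process_def st_def sum_negf)
    ultimately have 2: "(\<integral>\<^sup>+\<omega>. ennreal ((?S \<omega> - D \<omega>)\<^sup>2) \<partial>M) =
        (\<integral>\<^sup>+\<omega>. (\<integral>\<^sup>+s. ennreal ((?P s \<omega> - st s)\<^sup>2) \<partial>lborel) \<partial>M)" by simp
    have 3: "(\<integral>\<^sup>+s. ennreal ((?P s \<omega> - st s)\<^sup>2) \<partial>lborel) \<le>
        2 * (\<integral>\<^sup>+s. ennreal ((\<sigma> s - ?P s \<omega>)\<^sup>2) * indicator {a..b} s \<partial>lborel) + 2 * e" for \<omega>
    proof -
      have zero: "?P s \<omega> = 0" "st s = 0" if "s \<notin> {a..b}" for s
      proof -
        show "?P s \<omega> = 0" unfolding simple_process_def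
        proof (intro sum.neutral ballI)
          fix i assume "i \<in> {..<n m}"
          then show "\<xi> m i \<omega> * indicator {\<tau> m i<..\<tau> m (Suc i)} s = 0"
            using \<tau>a[of i] \<tau>b[of "Suc i"] that by (auto split: split_indicator)
        qed
        show "st s = 0" unfolding st_def
          using uv that by (intro sum.neutral ballI) (force split: split_indicator)
      qed
      have M1: "(\<lambda>s. ennreal ((\<sigma> s - X s)\<^sup>2) * indicator {a..b} s) \<in> borel_measurable lborel"
        if [measurable]: "X \<in> borel_measurable borel" for X
      proof -
        have "(\<lambda>s. ennreal ((\<sigma> s - X s)\<^sup>2) * indicator {a..b} s) =
            (\<lambda>s. ennreal ((indicator {a..b} s * \<sigma> s - X s)\<^sup>2) * indicator {a..b} s)"
          by (auto split: split_indicator)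
        then show ?thesis by simp
      qed
      have "(\<integral>\<^sup>+s. ennreal ((?P s \<omega> - st s)\<^sup>2) \<partial>lborel) \<le>
          (\<integral>\<^sup>+s. 2 * (ennreal ((\<sigma> s - ?P s \<omega>)\<^sup>2) * indicator {a..b} s)
            + 2 * (ennreal ((\<sigma> s - st s)\<^sup>2) * indicator {a..b} s) \<partial>lborel)"
      proof (intro nn_integral_mono)
        fix s :: real
        show "ennreal ((?P s \<omega> - st s)\<^sup>2) \<le> 2 * (ennreal ((\<sigma> s - ?P s \<omega>)\<^sup>2) * indicator {a..b} s)
            + 2 * (ennreal ((\<sigma> s - st s)\<^sup>2) * indicator {a..b} s)"
          using zero[of s] ennreal_sq_triangle[of "?P s \<omega>" "st s" "\<sigma> s"]
          by (cases "s \<in> {a..b}") (auto simp: power2_commute)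
      qed
      also have "\<dots> = 2 * (\<integral>\<^sup>+s. ennreal ((\<sigma> s - ?P s \<omega>)\<^sup>2) * indicator {a..b} s \<partial>lborel) + 2 * e"
        unfolding e_def using M1[OF Ps] M1[OF stM]
        by (subst nn_integral_add) (auto simp: nn_integral_cmult)
      finally show ?thesis .
    qed
    have AM: "(\<lambda>\<omega>. \<integral>\<^sup>+s. ennreal ((\<sigma> s - ?P s \<omega>)\<^sup>2) * indicator {a..b} s \<partial>lborel) \<in> borel_measurable M"
    proof -
      have "(\<lambda>\<omega>. \<integral>\<^sup>+s. ennreal ((indicator {a..b} s * \<sigma> s - ?P s \<omega>)\<^sup>2) * indicator {a..b} s \<partial>lborel) \<in> borel_measurable M"
        by measurable
      moreover have "ennreal ((indicator {a..b} s * \<sigma> s - ?P s \<omega>)\<^sup>2) * indicator {a..b} s =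
          ennreal ((\<sigma> s - ?P s \<omega>)\<^sup>2) * indicator {a..b} s" for s \<omega>
        by (auto split: split_indicator)
      ultimately show ?thesis by simp
    qed
    have "(\<integral>\<^sup>+\<omega>. (\<integral>\<^sup>+s. ennreal ((?P s \<omega> - st s)\<^sup>2) \<partial>lborel) \<partial>M) \<le>
        (\<integral>\<^sup>+\<omega>. 2 * (\<integral>\<^sup>+s. ennreal ((\<sigma> s - ?P s \<omega>)\<^sup>2) * indicator {a..b} s \<partial>lborel) + 2 * e \<partial>M)"
      by (intro nn_integral_mono 3)
    also have "\<dots> = 2 * A m + 2 * e"
      unfolding A_def using AM by (subst nn_integral_add) (auto simp: nn_integral_cmult emeasure_space_1)
    finally have "(\<integral>\<^sup>+\<omega>. ennreal ((?S \<omega> - D \<omega>)\<^sup>2) \<partial>M) \<le> 2 * A m + 2 * e"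
      using 2 by simp
    then show ?thesis
      using 1 by (meson add_left_mono mult_left_mono order_trans zero_le)
  qed
  have "(\<lambda>m. 2 * A' m + 2 * (2 * A m + 2 * e)) \<longlonglongrightarrow> 2 * 0 + 2 * (2 * 0 + 2 * e)"
    using lim1 lim2 unfolding A_def[symmetric] A'_def[symmetric]
    by (intro tendsto_add ennreal_tendsto_cmult tendsto_const) auto
  then have "(\<integral>\<^sup>+\<omega>. ennreal ((I \<omega> - D \<omega>)\<^sup>2) \<partial>M) \<le> 2 * 0 + 2 * (2 * 0 + 2 * e)"
    using bound by (intro LIMSEQ_le_const[of "\<lambda>m. 2 * A' m + 2 * (2 * A m + 2 * e)"]) auto
  also have "\<dots> = 4 * e" by (simp flip: mult.assoc)
  finally show ?thesis unfolding D_def e_def st_def .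
qed

end

lemma sum_indicator_partition:
  fixes p :: "nat \<Rightarrow> real"
  assumes "\<And>i. i < n \<Longrightarrow> p i \<le> p (Suc i)" "p 0 < r" "r \<le> p n"
  shows "\<exists>k<n. p k < r \<and> r \<le> p (Suc k) \<and>
    (\<forall>c::nat \<Rightarrow> real. (\<Sum>j<n. c j * indicator {p j<..p (Suc j)} r) = c k)"
  using assms
proof (induction n)
  case (Suc m)
  show ?case
  proof (cases "r \<le> p m")
    case True
    then obtain k where "k < m" "p k < r" "r \<le> p (Suc k)"
        "\<And>c::nat \<Rightarrow> real. (\<Sum>j<m. c j * indicator {p j<..p (Suc j)} r) = c k"
      using Suc by force
    then show ?thesis using True by (intro exI[of _ k]) auto
  next
    case False
    have "p i \<le> p m" if "i \<le> m" for i
      using that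
    proof (induction i rule: inc_induct)
      case (step i)
      then show ?case using Suc.prems(1)[of i] by simp
    qed simp
    then have "p (Suc j) < r" if "j < m" for j
      using False that by (meson Suc_leI le_less_trans not_le)
    then have "(\<Sum>j<m. c j * indicator {p j<..p (Suc j)} r) = 0" for c :: "nat \<Rightarrow> real"
      by (intro sum.neutral) (force split: split_indicator)
    then show ?thesis using False Suc.prems by (intro exI[of _ m]) auto
  qed
qed simp

lemma sum_indicator_outside:
  fixes u v c :: "nat \<Rightarrow> real"
  assumes "\<And>j. j < n \<Longrightarrow> x \<le> u j \<and> v j \<le> y" and "r \<notin> {x<..y}"
  shows "(\<Sum>j<n. c j * indicator {u j<..v j} r) = 0"
  using assms by (intro sum.neutral) (force split: split_indicator)

definition grid_point :: "real \<Rightarrow> real \<Rightarrow> nat \<Rightarrow> nat \<Rightarrow> real" where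
  "grid_point x y n j = x + (y - x) * (real j / real n)"

lemma grid_point_0 [simp]: "grid_point x y n 0 = x"
  by (simp add: grid_point_def)

lemma grid_point_n [simp]: "0 < n \<Longrightarrow> grid_point x y n n = y"
  by (simp add: grid_point_def)

lemma grid_point_mono: "x \<le> y \<Longrightarrow> i \<le> j \<Longrightarrow> grid_point x y n i \<le> grid_point x y n j"
  by (auto simp: grid_point_def intro!: mult_left_mono divide_right_mono)

lemma grid_point_Suc_diff: "grid_point x y n (Suc j) - grid_point x y n j = (y - x) / n"
  by (simp add: grid_point_def field_simps add_divide_distrib)

lemma grid_point_bounds: "x \<le> y \<Longrightarrow> j \<le> n \<Longrightarrow> x \<le> grid_point x y n j \<and> grid_point x y n j \<le> y"
  using grid_point_mono[of x y 0 j n] grid_point_mono[of x y j n n] by (cases "n = 0") auto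

lemma uniform_step_close:
  fixes g :: "real \<Rightarrow> real"
  assumes g: "K-lipschitz_on {x..y} g" and r: "x < r" "r \<le> y" and n: "0 < n"
  shows "\<bar>g r - (\<Sum>j<n. g (grid_point x y n j) * indicator {grid_point x y n j<..grid_point x y n (Suc j)} r)\<bar> \<le> K * (y - x) / n"
proof -
  have xy: "x \<le> y" using r by simp
  obtain k where k: "k < n" "grid_point x y n k < r" "r \<le> grid_point x y n (Suc k)"
    and c: "\<And>c::nat \<Rightarrow> real. (\<Sum>j<n. c j * indicator {grid_point x y n j<..grid_point x y n (Suc j)} r) = c k"
    using sum_indicator_partition[of n "grid_point x y n" r] r n grid_point_mono[OF xy] by auto
  have "\<bar>g r - g (grid_point x y n k)\<bar> \<le> K * \<bar>r - grid_point x y n k\<bar>"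
    using lipschitz_onD[OF g, of r "grid_point x y n k"] r grid_point_bounds[OF xy, of k n] k by (simp add: dist_real_def)
  also have "\<dots> \<le> K * ((y - x) / n)"
    using k grid_point_Suc_diff[of x y n k] lipschitz_on_nonneg[OF g] by (intro mult_left_mono) auto
  finally show ?thesis using c[of "\<lambda>j. g (grid_point x y n j)"] by simp
qed

lemma nn_integral_step_error:
  fixes \<sigma> g :: "real \<Rightarrow> real"
  assumes ab: "a \<le> b" and le: "\<And>r. a < r \<Longrightarrow> r \<le> b \<Longrightarrow> \<bar>\<sigma> r - g r\<bar> \<le> \<eta>"
  shows "(\<integral>\<^sup>+r. ennreal ((\<sigma> r - g r)\<^sup>2) * indicator {a..b} r \<partial>lborel) \<le> ennreal (\<eta>\<^sup>2 * (b - a))"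
proof -
  have "AE r in lborel. r \<noteq> a" by (rule AE_lborel_singleton)
  then have "(\<integral>\<^sup>+r. ennreal ((\<sigma> r - g r)\<^sup>2) * indicator {a..b} r \<partial>lborel)
      \<le> (\<integral>\<^sup>+r. ennreal (\<eta>\<^sup>2) * indicator {a..b} r \<partial>lborel)"
  proof (intro nn_integral_mono_AE, eventually_elim)
    case (elim r)
    show ?case
    proof (cases "r \<in> {a..b}")
      case True
      then have "\<bar>\<sigma> r - g r\<bar> \<le> \<eta>" using le elim by auto
      then have "(\<sigma> r - g r)\<^sup>2 \<le> \<eta>\<^sup>2" by (metis abs_ge_zero power2_abs power_mono)
      then show ?thesis using True by (simp add: ennreal_leI)
    qed simp
  qed
  also have "\<dots> = ennreal (\<eta>\<^sup>2 * (b - a))"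
    using ab by (subst nn_integral_cmult) (auto simp: ennreal_mult)
  finally show ?thesis .
qed

lemma cmod_iexp_diff_le: "cmod (iexp x - iexp y) \<le> \<bar>x - y\<bar>"
proof -
  have "iexp x - iexp y = iexp y * (iexp (x - y) - 1)"
    by (simp add: algebra_simps flip: exp_add)
  then have "cmod (iexp x - iexp y) = cmod (iexp (x - y) - 1)"
    by (simp add: norm_mult)
  also have "\<dots> \<le> \<bar>x - y\<bar>" using iexp_approx1[of "x - y" 0] by simp
  finally show ?thesis .
qed

lemma LINT_uniform_step:
  fixes g :: "real \<Rightarrow> real"
  assumes g: "K-lipschitz_on {x..y} g" and xy: "x \<le> y" and n: "0 < n"
  shows "\<bar>(LINT r:{x..y}|lborel. g r) - (\<Sum>j<n. g (grid_point x y n j) * ((y - x) / n))\<bar> \<le> K * (y - x)\<^sup>2 / n"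
proof -
  let ?st = "\<lambda>r. \<Sum>j<n. g (grid_point x y n j) * indicator {grid_point x y n j<..grid_point x y n (Suc j)} r"
  have "continuous_on {x..y} g" using g by (rule lipschitz_on_continuous_on)
  then have gi: "set_integrable lborel {x..y} g" by (rule borel_integrable_atLeastAtMost')
  have ind: "integrable lborel (\<lambda>r. g (grid_point x y n j) * indicator {grid_point x y n j<..grid_point x y n (Suc j)} r)" for j
    by (intro integrable_mult_right integrable_real_indicator)
       (auto simp: grid_point_mono[OF xy] intro!: emeasure_bounded_finite)
  have si: "integrable lborel ?st" by (intro Bochner_Integration.integrable_sum ind)
  have "(\<integral>r. ?st r \<partial>lborel) = (\<Sum>j<n. g (grid_point x y n j) * ((y - x) / n))"
    using grid_point_Suc_diff[of x y n]
    by (subst Bochner_Integration.integral_sum[OF ind]) (simp add: grid_point_mono[OF xy])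
  then have eq: "(LINT r:{x..y}|lborel. g r) - (\<Sum>j<n. g (grid_point x y n j) * ((y - x) / n)) =
      (\<integral>r. indicator {x..y} r * g r - ?st r \<partial>lborel)"
    using gi si unfolding set_lebesgue_integral_def set_integrable_def by simp
  have "\<bar>\<integral>r. indicator {x..y} r * g r - ?st r \<partial>lborel\<bar> \<le> (\<integral>r. norm (indicator {x..y} r * g r - ?st r) \<partial>lborel)"
    unfolding real_norm_def[symmetric] by (rule integral_norm_bound)
  also have "\<dots> \<le> (\<integral>r. K * (y - x) / n * indicator {x..y} r \<partial>lborel)"
  proof (rule integral_mono_AE)
    show "integrable lborel (\<lambda>r. norm (indicator {x..y} r * g r - ?st r))"
      using gi si unfolding set_integrable_def by (intro integrable_norm) simp
    show "integrable lborel (\<lambda>r. K * (y - x) / n * indicator {x..y} r)"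
      using xy by (intro integrable_mult_right integrable_real_indicator) auto
    have "AE r in lborel. r \<noteq> x" by (rule AE_lborel_singleton)
    then show "AE r in lborel. norm (indicator {x..y} r * g r - ?st r) \<le> K * (y - x) / n * indicator {x..y} r"
    proof eventually_elim
      case (elim r)
      have out: "?st r = 0" if "r \<notin> {x<..y}"
        using that grid_point_bounds[OF xy] by (intro sum_indicator_outside[of n x _ _ y]) force+
      show ?case
        using uniform_step_close[OF g _ _ n, of r] out elim by (cases "r \<in> {x<..y}") (auto split: split_indicator)
    qed
  qed
  also have "\<dots> = K * (y - x)\<^sup>2 / n" using xy by (simp add: power2_eq_square)
  finally show ?thesis unfolding eq .
qed

context brownian_motion begin

text \<open>The integrals up to \<open>s\<close> and up to \<open>t\<close> have unrelated approximations. Approximating both by sums that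
  agree on \<open>[a, s]\<close> makes their difference a sum over \<open>[s, t]\<close> alone, which is independent of the past
  of \<open>s\<close>.\<close>

lemma ito_increment_approx:
  fixes \<sigma> :: "real \<Rightarrow> real"
  assumes a: "0 \<le> a" "a \<le> s" "s < t" and n: "0 < n"
    and I1: "has_ito_integral M F B a s (\<lambda>r \<omega>. \<sigma> r) I1"
    and I2: "has_ito_integral M F B a t (\<lambda>r \<omega>. \<sigma> r) I2"
    and K: "K-lipschitz_on {a..t} \<sigma>"
  shows "(\<integral>\<^sup>+\<omega>. ennreal ((I2 \<omega> - I1 \<omega> -
      (\<Sum>j<n. \<sigma> (grid_point s t n j) * (B (grid_point s t n (Suc j)) \<omega> - B (grid_point s t n j) \<omega>)))\<^sup>2) \<partial>M)
    \<le> ennreal (16 * (K * (t - a) / n)\<^sup>2 * (t - a))"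
proof -
  let ?p = "grid_point a s n" and ?q = "grid_point s t n" and ?\<eta> = "K * (t - a) / n"
  have [measurable]: "I1 \<in> borel_measurable M" "I2 \<in> borel_measurable M"
    using I1 I2 by (auto simp: has_ito_integral_def)
  have K0: "0 \<le> K" using lipschitz_on_nonneg[OF K] .
  have K1: "K-lipschitz_on {a..s} \<sigma>" and K2: "K-lipschitz_on {s..t} \<sigma>"
    using a by (auto intro: lipschitz_on_subset[OF K])
  have le1: "K * (s - a) / n \<le> ?\<eta>" and le2: "K * (t - s) / n \<le> ?\<eta>"
    using K0 a by (auto intro!: divide_right_mono mult_left_mono)
  define D1 where "D1 \<omega> = (\<Sum>j<n. \<sigma> (?p j) * (B (?p (Suc j)) \<omega> - B (?p j) \<omega>))" for \<omega>
  define D where "D \<omega> = (\<Sum>j<n. \<sigma> (?q j) * (B (?q (Suc j)) \<omega> - B (?q j) \<omega>))" for \<omega>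
  have p: "a \<le> ?p j \<and> ?p j \<le> ?p (Suc j) \<and> ?p (Suc j) \<le> s" if "j < n" for j
    using grid_point_bounds[of a s j n] grid_point_bounds[of a s "Suc j" n] grid_point_mono[of a s j "Suc j" n] that a by auto
  have q: "s \<le> ?q j \<and> ?q j \<le> ?q (Suc j) \<and> ?q (Suc j) \<le> t" if "j < n" for j
    using grid_point_bounds[of s t j n] grid_point_bounds[of s t "Suc j" n] grid_point_mono[of s t j "Suc j" n] that a by auto
  have B_p: "?p j \<le> s \<and> 0 \<le> ?p j" "?q j \<le> t \<and> 0 \<le> ?q j" if "j \<le> n" for j
    using grid_point_bounds[of a s j n] grid_point_bounds[of s t j n] that a by auto
  have [measurable]: "D1 \<in> borel_measurable M" "D \<in> borel_measurable M"
    unfolding D1_def D_def using B_p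
    by (intro borel_measurable_sum borel_measurable_times borel_measurable_diff B_measurable; force)+
  have "(\<integral>\<^sup>+\<omega>. ennreal ((I1 \<omega> - D1 \<omega>)\<^sup>2) \<partial>M) \<le> 4 * ennreal (?\<eta>\<^sup>2 * (s - a))"
  proof -
    have "\<bar>\<sigma> r - (\<Sum>j<n. \<sigma> (?p j) * indicator {?p j<..?p (Suc j)} r)\<bar> \<le> ?\<eta>" if "a < r" "r \<le> s" for r
      using order_trans[OF uniform_step_close[OF K1 that n] le1] .
    then show ?thesis
      unfolding D1_def using p a
      by (intro order_trans[OF ito_integral_approx[OF a(1) I1]] mult_left_mono nn_integral_step_error) auto
  qed
  also have "\<dots> \<le> 4 * ennreal (?\<eta>\<^sup>2 * (t - a))"
    using a by (intro mult_left_mono ennreal_leI) auto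
  finally have 1: "(\<integral>\<^sup>+\<omega>. ennreal ((I1 \<omega> - D1 \<omega>)\<^sup>2) \<partial>M) \<le> 4 * ennreal (?\<eta>\<^sup>2 * (t - a))" .
  have 2: "(\<integral>\<^sup>+\<omega>. ennreal ((I2 \<omega> - (D1 \<omega> + D \<omega>))\<^sup>2) \<partial>M) \<le> 4 * ennreal (?\<eta>\<^sup>2 * (t - a))"
  proof -
    let ?J = "{..<n} <+> {..<n}"
    let ?c = "case_sum (\<lambda>j. \<sigma> (?p j)) (\<lambda>j. \<sigma> (?q j))"
    let ?u = "case_sum ?p ?q" and ?v = "case_sum (\<lambda>j. ?p (Suc j)) (\<lambda>j. ?q (Suc j))"
    have D: "D1 \<omega> + D \<omega> = (\<Sum>j\<in>?J. ?c j * (B (?v j) \<omega> - B (?u j) \<omega>))" for \<omega>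
      by (subst sum.Plus) (simp_all add: D1_def D_def)
    have "\<bar>\<sigma> r - (\<Sum>j\<in>?J. ?c j * indicator {?u j<..?v j} r)\<bar> \<le> ?\<eta>" if r: "a < r" "r \<le> t" for r
    proof (cases "r \<le> s")
      case True
      have "(\<Sum>j<n. \<sigma> (?q j) * indicator {?q j<..?q (Suc j)} r) = 0"
        using q True by (intro sum_indicator_outside[of n s _ _ t]) auto
      moreover have "\<bar>\<sigma> r - (\<Sum>j<n. \<sigma> (?p j) * indicator {?p j<..?p (Suc j)} r)\<bar> \<le> ?\<eta>"
        using order_trans[OF uniform_step_close[OF K1 r(1) True n] le1] .
      ultimately show ?thesis by (subst sum.Plus) simp_all
    next
      case False
      have "(\<Sum>j<n. \<sigma> (?p j) * indicator {?p j<..?p (Suc j)} r) = 0"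
        using p False by (intro sum_indicator_outside[of n a _ _ s]) auto
      moreover have "\<bar>\<sigma> r - (\<Sum>j<n. \<sigma> (?q j) * indicator {?q j<..?q (Suc j)} r)\<bar> \<le> ?\<eta>"
        using order_trans[OF uniform_step_close[OF K2 _ r(2) n] le2] False by simp
      ultimately show ?thesis by (subst sum.Plus) simp_all
    qed
    moreover have "a \<le> ?u j \<and> ?u j \<le> ?v j \<and> ?v j \<le> t" if "j \<in> ?J" for j
      using that p q a by fastforce
    ultimately show ?thesis
      unfolding D using a
      by (intro order_trans[OF ito_integral_approx[OF a(1) I2]] mult_left_mono nn_integral_step_error) auto
  qed
  have "(\<integral>\<^sup>+\<omega>. ennreal ((I2 \<omega> - I1 \<omega> - D \<omega>)\<^sup>2) \<partial>M) \<le>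
      (\<integral>\<^sup>+\<omega>. 2 * ennreal ((I2 \<omega> - (D1 \<omega> + D \<omega>))\<^sup>2) + 2 * ennreal ((I1 \<omega> - D1 \<omega>)\<^sup>2) \<partial>M)"
  proof (intro nn_integral_mono)
    fix \<omega>
    have eq: "I2 \<omega> - I1 \<omega> - D \<omega> = (I2 \<omega> - (D1 \<omega> + D \<omega>)) - (I1 \<omega> - D1 \<omega>)" by simp
    show "ennreal ((I2 \<omega> - I1 \<omega> - D \<omega>)\<^sup>2) \<le>
        2 * ennreal ((I2 \<omega> - (D1 \<omega> + D \<omega>))\<^sup>2) + 2 * ennreal ((I1 \<omega> - D1 \<omega>)\<^sup>2)"
      unfolding eq using ennreal_sq_triangle[of "I2 \<omega> - (D1 \<omega> + D \<omega>)" "I1 \<omega> - D1 \<omega>" 0]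
      by (simp only: diff_zero diff_0 power2_minus)
  qed
  also have "\<dots> = 2 * (\<integral>\<^sup>+\<omega>. ennreal ((I2 \<omega> - (D1 \<omega> + D \<omega>))\<^sup>2) \<partial>M) + 2 * (\<integral>\<^sup>+\<omega>. ennreal ((I1 \<omega> - D1 \<omega>)\<^sup>2) \<partial>M)"
    by (subst nn_integral_add) (auto simp: nn_integral_cmult)
  also have "\<dots> \<le> 2 * (4 * ennreal (?\<eta>\<^sup>2 * (t - a))) + 2 * (4 * ennreal (?\<eta>\<^sup>2 * (t - a)))"
    by (intro add_mono mult_left_mono 1 2) auto
  also have "\<dots> = 16 * ennreal (?\<eta>\<^sup>2 * (t - a))"
    by (simp flip: mult.assoc distrib_right)
  also have "\<dots> = ennreal (16 * ?\<eta>\<^sup>2 * (t - a))"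
    using a by (simp add: ennreal_mult mult.assoc)
  finally show ?thesis unfolding D_def .
qed

lemma char_increment:
  assumes "0 \<le> s" "s \<le> t"
  shows "(\<integral>\<omega>. iexp (c * (B t \<omega> - B s \<omega>)) \<partial>M) = complex_of_real (exp (- (c\<^sup>2 * (t - s)) / 2))"
proof (cases "s = t")
  case False
  then have st: "0 \<le> s" "s < t" and sd: "0 < sqrt (t - s)" using assms by auto
  let ?X = "\<lambda>\<omega>. (B t \<omega> - B s \<omega>) / sqrt (t - s)"
  have D: "distributed M lborel ?X std_normal_density"
    using increments_normal[OF st] unfolding normal_standard_normal_convert[OF sd] by simp
  have distr: "distr M lborel ?X = std_normal_distribution"
    using distributed_distr_eq_density[OF D] .
  have [measurable]: "?X \<in> borel_measurable M"
    using distributed_measurable[OF D] by simp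
  have "(\<integral>\<omega>. iexp (c * (B t \<omega> - B s \<omega>)) \<partial>M) = (\<integral>\<omega>. iexp ((c * sqrt (t - s)) * ?X \<omega>) \<partial>M)"
    using sd by simp
  also have "\<dots> = (\<integral>x. iexp ((c * sqrt (t - s)) * x) \<partial>(distr M lborel ?X))"
    by (subst integral_distr) auto
  also have "\<dots> = char std_normal_distribution (c * sqrt (t - s))"
    unfolding distr char_def ..
  also have "\<dots> = complex_of_real (exp (- (c\<^sup>2 * (t - s)) / 2))"
    using st by (simp add: char_std_normal_distribution power_mult_distrib)
  finally show ?thesis .
qed (simp add: prob_space)

text \<open>The last factor is split off by independence. For this the indicator of \<open>A\<close> and the earlier factors
  have to be measurable at the last but one time, which is therefore part of the induction.\<close>

lemma char_sum_increments:
  fixes q c :: "nat \<Rightarrow> real"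
  assumes "0 \<le> q 0" "\<And>j. j < n \<Longrightarrow> q j \<le> q (Suc j)" and A: "A \<in> sets (F (q 0))"
  shows "(\<integral>\<omega>. indicator A \<omega> * iexp (\<Sum>j<n. c j * (B (q (Suc j)) \<omega> - B (q j) \<omega>)) \<partial>M) =
    complex_of_real (prob A * exp (- (\<Sum>j<n. (c j)\<^sup>2 * (q (Suc j) - q j)) / 2))
   \<and> q 0 \<le> q n \<and> (\<lambda>\<omega>. indicator A \<omega> * iexp (\<Sum>j<n. c j * (B (q (Suc j)) \<omega> - B (q j) \<omega>))) \<in> borel_measurable (F (q n))"
  using assms(2)
proof (induction n)
  case 0
  have "A \<in> sets M" using past_event A assms by blast
  moreover have "(\<integral>\<omega>. indicator A \<omega> * iexp 0 \<partial>M) = (\<integral>\<omega>. complex_of_real (indicator A \<omega>) \<partial>M)"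
    by (intro Bochner_Integration.integral_cong) (auto split: split_indicator)
  ultimately have "(\<integral>\<omega>. indicator A \<omega> * iexp 0 \<partial>M) = complex_of_real (prob A)"
    by simp
  then show ?case using A by simp
next
  case (Suc n)
  let ?S = "\<lambda>\<omega>. \<Sum>j<n. c j * (B (q (Suc j)) \<omega> - B (q j) \<omega>)"
  let ?Y = "\<lambda>\<omega>. indicator A \<omega> * iexp (?S \<omega>)"
  have IH: "(\<integral>\<omega>. ?Y \<omega> \<partial>M) = complex_of_real (prob A * exp (- (\<Sum>j<n. (c j)\<^sup>2 * (q (Suc j) - q j)) / 2))"
      "q 0 \<le> q n" "?Y \<in> borel_measurable (F (q n))"
    using Suc by auto
  have qn: "0 \<le> q n" "q n \<le> q (Suc n)" using IH assms Suc.prems by auto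
  have [measurable]: "?Y \<in> borel_measurable M" using measurable_from_past IH(3) qn by blast
  have bn[measurable]: "B (q n) \<in> borel_measurable M" "B (q (Suc n)) \<in> borel_measurable M" using qn by auto
  have Yint: "integrable M ?Y"
  proof (rule integrable_const_bound[of _ 1])
    show "AE \<omega> in M. norm (?Y \<omega>) \<le> 1"
      unfolding norm_mult norm_exp_i_times by (rule AE_I2) (simp split: split_indicator)
    show "?Y \<in> borel_measurable M" by measurable
  qed
  let ?g = "\<lambda>x. iexp (c n * x)"
  have gint: "integrable M (\<lambda>\<omega>. ?g (B (q (Suc n)) \<omega> - B (q n) \<omega>))"
    by (rule integrable_const_bound[of _ 1]) auto
  have split: "indicator A \<omega> * iexp (\<Sum>j<Suc n. c j * (B (q (Suc j)) \<omega> - B (q j) \<omega>)) =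
      ?Y \<omega> * ?g (B (q (Suc n)) \<omega> - B (q n) \<omega>)" for \<omega>
    by (simp add: algebra_simps flip: exp_add)
  have "(\<integral>\<omega>. ?Y \<omega> * ?g (B (q (Suc n)) \<omega> - B (q n) \<omega>) \<partial>M) =
      (\<integral>\<omega>. ?Y \<omega> \<partial>M) * (\<integral>\<omega>. ?g (B (q (Suc n)) \<omega> - B (q n) \<omega>) \<partial>M)"
  proof (cases "q n = q (Suc n)")
    case False
    then show ?thesis
      using qn by (intro expectation_mult_increment[OF qn(1) _ IH(3) Yint _ gint]) auto
  qed (simp add: prob_space)
  also have "\<dots> = complex_of_real (prob A * exp (- (\<Sum>j<Suc n. (c j)\<^sup>2 * (q (Suc j) - q j)) / 2))"
    unfolding IH char_increment[OF qn] of_real_mult[symmetric] mult.assoc exp_add[symmetric]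
    by (simp add: diff_divide_distrib algebra_simps add_divide_distrib)
  finally have 1: "(\<integral>\<omega>. ?Y \<omega> * ?g (B (q (Suc n)) \<omega> - B (q n) \<omega>) \<partial>M) = \<dots>" .
  have [measurable]: "B (q n) \<in> borel_measurable (F (q (Suc n)))" "B (q (Suc n)) \<in> borel_measurable (F (q (Suc n)))"
      "?Y \<in> borel_measurable (F (q (Suc n)))"
    using adapted_later qn measurable_later[OF IH(3) qn(2)] by auto
  have "(\<lambda>\<omega>. ?Y \<omega> * ?g (B (q (Suc n)) \<omega> - B (q n) \<omega>)) \<in> borel_measurable (F (q (Suc n)))"
    by (intro borel_measurable_times \<open>?Y \<in> borel_measurable (F (q (Suc n)))\<close>) measurable
  then show ?case unfolding split using 1 IH qn by auto
qed

end

section \<open>The law of the increments of the Ito integral\<close>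

lemma lipschitz_on_square:
  fixes \<sigma> :: "real \<Rightarrow> real"
  assumes K: "K-lipschitz_on {x..y} \<sigma>"
  obtains K' where "K'-lipschitz_on {x..y} (\<lambda>r. (\<sigma> r)\<^sup>2)"
proof -
  define m where "m = \<bar>\<sigma> x\<bar> + K * (y - x)"
  have K0: "0 \<le> K" using lipschitz_on_nonneg[OF K] .
  have m: "\<bar>\<sigma> r\<bar> \<le> m" if "r \<in> {x..y}" for r
  proof -
    have "\<bar>\<sigma> r - \<sigma> x\<bar> \<le> K * (r - x)" using lipschitz_onD[OF K, of r x] that by (simp add: dist_real_def)
    also have "\<dots> \<le> K * (y - x)" using that K0 by (intro mult_left_mono) auto
    finally show ?thesis by (simp add: m_def)
  qed
  have "(K * (2 * \<bar>m\<bar>))-lipschitz_on {x..y} (\<lambda>r. (\<sigma> r)\<^sup>2)"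
  proof (rule lipschitz_onI)
    fix r r' assume r: "r \<in> {x..y}" "r' \<in> {x..y}"
    have "\<bar>(\<sigma> r)\<^sup>2 - (\<sigma> r')\<^sup>2\<bar> = \<bar>\<sigma> r - \<sigma> r'\<bar> * \<bar>\<sigma> r + \<sigma> r'\<bar>"
      by (simp add: power2_eq_square square_diff_square_factored abs_mult mult.commute)
    also have "\<dots> \<le> (K * \<bar>r - r'\<bar>) * (2 * \<bar>m\<bar>)"
      using lipschitz_onD[OF K r] m[OF r(1)] m[OF r(2)] K0 by (intro mult_mono) (auto simp: dist_real_def)
    finally show "dist ((\<sigma> r)\<^sup>2) ((\<sigma> r')\<^sup>2) \<le> K * (2 * \<bar>m\<bar>) * dist r r'"
      by (simp add: dist_real_def mult_ac)
  qed (use K0 in auto)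
  then show ?thesis by (rule that)
qed

context brownian_motion begin

text \<open>Mean square closeness of random variables gives closeness of characteristic functions: the exponential
  is Lipschitz, and \<open>\<bar>z\<bar> \<le> \<delta> + z\<^sup>2 / \<delta>\<close>.\<close>

lemma cmod_expectation_diff_le:
  fixes X Y :: "'a \<Rightarrow> real" and \<delta> \<theta> :: real
  assumes A: "A \<in> sets M" and [measurable]: "X \<in> borel_measurable M" "Y \<in> borel_measurable M"
    and \<delta>: "0 < \<delta>" and le: "(\<integral>\<^sup>+\<omega>. ennreal ((X \<omega> - Y \<omega>)\<^sup>2) \<partial>M) \<le> ennreal (\<delta>\<^sup>2)"
  shows "cmod ((\<integral>\<omega>. indicator A \<omega> * iexp (\<theta> * X \<omega>) \<partial>M) - (\<integral>\<omega>. indicator A \<omega> * iexp (\<theta> * Y \<omega>) \<partial>M))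
    \<le> 2 * \<bar>\<theta>\<bar> * \<delta>"
proof -
  note [measurable] = A
  have int: "integrable M (\<lambda>\<omega>. indicator A \<omega> * iexp (\<theta> * Z \<omega>))" if [measurable]: "Z \<in> borel_measurable M" for Z
  proof (rule integrable_const_bound[of _ 1])
    show "AE \<omega> in M. norm (indicator A \<omega> * iexp (\<theta> * Z \<omega>)) \<le> 1"
      unfolding norm_mult norm_exp_i_times by (rule AE_I2) (simp split: split_indicator)
  qed measurable
  have sq: "integrable M (\<lambda>\<omega>. (X \<omega> - Y \<omega>)\<^sup>2)"
    using le by (intro integrableI_bounded) (auto simp: le_less_trans)
  have E: "expectation (\<lambda>\<omega>. (X \<omega> - Y \<omega>)\<^sup>2) \<le> \<delta>\<^sup>2"
    using le by (intro integral_real_bounded) auto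
  have pw: "norm (indicator A \<omega> * iexp (\<theta> * X \<omega>) - indicator A \<omega> * iexp (\<theta> * Y \<omega>)) \<le> \<bar>\<theta>\<bar> * (\<delta> + (X \<omega> - Y \<omega>)\<^sup>2 / \<delta>)" for \<omega>
  proof -
    have "norm (indicator A \<omega> * iexp (\<theta> * X \<omega>) - indicator A \<omega> * iexp (\<theta> * Y \<omega>)) \<le> cmod (iexp (\<theta> * X \<omega>) - iexp (\<theta> * Y \<omega>))"
      by (auto split: split_indicator)
    also have "\<dots> \<le> \<bar>\<theta> * X \<omega> - \<theta> * Y \<omega>\<bar>" by (rule cmod_iexp_diff_le)
    also have "\<dots> = \<bar>\<theta>\<bar> * \<bar>X \<omega> - Y \<omega>\<bar>" by (simp add: abs_mult flip: right_diff_distrib)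
    also have "\<bar>X \<omega> - Y \<omega>\<bar> \<le> \<delta> + (X \<omega> - Y \<omega>)\<^sup>2 / \<delta>"
    proof (cases "\<bar>X \<omega> - Y \<omega>\<bar> \<le> \<delta>")
      case True
      have "0 \<le> (X \<omega> - Y \<omega>)\<^sup>2 / \<delta>" using \<delta> by simp
      then show ?thesis using True by linarith
    next
      case False
      then have "\<bar>X \<omega> - Y \<omega>\<bar> * \<delta> \<le> \<bar>X \<omega> - Y \<omega>\<bar> * \<bar>X \<omega> - Y \<omega>\<bar>" by (intro mult_left_mono) auto
      then have "\<bar>X \<omega> - Y \<omega>\<bar> \<le> (X \<omega> - Y \<omega>)\<^sup>2 / \<delta>" using \<delta> by (simp add: field_simps power2_eq_square)
      then show ?thesis using \<delta> by simp
    qed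
    finally show ?thesis by (simp add: mult_left_mono)
  qed
  have "cmod ((\<integral>\<omega>. indicator A \<omega> * iexp (\<theta> * X \<omega>) \<partial>M) - (\<integral>\<omega>. indicator A \<omega> * iexp (\<theta> * Y \<omega>) \<partial>M))
      = cmod (\<integral>\<omega>. indicator A \<omega> * iexp (\<theta> * X \<omega>) - indicator A \<omega> * iexp (\<theta> * Y \<omega>) \<partial>M)"
    using int[of X] int[of Y] by (subst Bochner_Integration.integral_diff) auto
  also have "\<dots> \<le> (\<integral>\<omega>. norm (indicator A \<omega> * iexp (\<theta> * X \<omega>) - indicator A \<omega> * iexp (\<theta> * Y \<omega>)) \<partial>M)"
    by (rule integral_norm_bound)
  also have "\<dots> \<le> (\<integral>\<omega>. \<bar>\<theta>\<bar> * (\<delta> + (X \<omega> - Y \<omega>)\<^sup>2 / \<delta>) \<partial>M)"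
  proof (rule integral_mono[OF _ _ pw])
    show "integrable M (\<lambda>\<omega>. norm (indicator A \<omega> * iexp (\<theta> * X \<omega>) - indicator A \<omega> * iexp (\<theta> * Y \<omega>)))"
      by (intro integrable_norm Bochner_Integration.integrable_diff int) measurable
    show "integrable M (\<lambda>\<omega>. \<bar>\<theta>\<bar> * (\<delta> + (X \<omega> - Y \<omega>)\<^sup>2 / \<delta>))"
      using sq by auto
  qed
  also have "\<dots> = \<bar>\<theta>\<bar> * (\<delta> + expectation (\<lambda>\<omega>. (X \<omega> - Y \<omega>)\<^sup>2) / \<delta>)"
    using sq by (simp add: prob_space)
  also have "\<dots> \<le> \<bar>\<theta>\<bar> * (\<delta> + \<delta>\<^sup>2 / \<delta>)"
    using E \<delta> by (intro mult_left_mono add_left_mono divide_right_mono) auto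
  also have "\<dots> = 2 * \<bar>\<theta>\<bar> * \<delta>" using \<delta> by (simp add: power2_eq_square)
  finally show ?thesis .
qed

lemma char_ito_increment:
  fixes \<sigma> :: "real \<Rightarrow> real" and \<theta> :: real
  assumes a: "0 \<le> a" "a \<le> s" "s < t"
    and I1: "has_ito_integral M F B a s (\<lambda>r \<omega>. \<sigma> r) I1"
    and I2: "has_ito_integral M F B a t (\<lambda>r \<omega>. \<sigma> r) I2"
    and K: "K-lipschitz_on {a..t} \<sigma>" and A: "A \<in> sets (F s)"
  shows "(\<integral>\<omega>. indicator A \<omega> * iexp (\<theta> * (I2 \<omega> - I1 \<omega>)) \<partial>M) =
    complex_of_real (prob A * exp (- (\<theta>\<^sup>2 * (LINT r:{s..t}|lborel. (\<sigma> r)\<^sup>2)) / 2))"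
proof -
  let ?v = "LINT r:{s..t}|lborel. (\<sigma> r)\<^sup>2"
  have [measurable]: "I1 \<in> borel_measurable M" "I2 \<in> borel_measurable M"
    using I1 I2 by (auto simp: has_ito_integral_def)
  have AM: "A \<in> sets M" using past_event A a by auto
  define q where "q n = grid_point s t (Suc n)" for n
  define D where "D n \<omega> = (\<Sum>j<Suc n. \<sigma> (q n j) * (B (q n (Suc j)) \<omega> - B (q n j) \<omega>))" for n \<omega>
  define V where "V n = (\<Sum>j<Suc n. (\<sigma> (q n j))\<^sup>2 * ((t - s) / Suc n))" for n
  let ?\<phi> = "\<lambda>Z. \<integral>\<omega>. indicator A \<omega> * iexp (\<theta> * Z \<omega>) \<partial>M"
  define C where "C = 4 * (K * (t - a) + 1) * (t - a + 1)"
  have K0: "0 \<le> K" using lipschitz_on_nonneg[OF K] .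
  have ta: "0 < t - a" using a by simp
  have qb: "0 \<le> q n j" if "j \<le> Suc n" for n j
    using grid_point_bounds[of s t j "Suc n"] that a by (auto simp: q_def)
  have DM [measurable]: "D n \<in> borel_measurable M" for n
    unfolding D_def using qb
    by (intro borel_measurable_sum borel_measurable_times borel_measurable_diff B_measurable) auto
  have C0: "0 < C" using K0 ta by (auto simp: C_def intro!: mult_pos_pos add_nonneg_pos)
  have err: "cmod (?\<phi> (\<lambda>\<omega>. I2 \<omega> - I1 \<omega>) - ?\<phi> (D n)) \<le> 2 * \<bar>\<theta>\<bar> * (C / Suc n)" for n
  proof (rule cmod_expectation_diff_le[OF AM])
    have "(\<integral>\<^sup>+\<omega>. ennreal ((I2 \<omega> - I1 \<omega> - D n \<omega>)\<^sup>2) \<partial>M) \<le> ennreal (16 * (K * (t - a) / Suc n)\<^sup>2 * (t - a))"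
      using ito_increment_approx[OF a _ I1 I2 K, of "Suc n"] unfolding D_def q_def by simp
    also have "16 * (K * (t - a) / Suc n)\<^sup>2 * (t - a) \<le> (C / Suc n)\<^sup>2"
    proof -
      have "(K * (t - a))\<^sup>2 \<le> (K * (t - a) + 1)\<^sup>2" using K0 ta by (intro power_mono) auto
      moreover have "(t - a) * 1 \<le> (t - a + 1) * (t - a + 1)" using ta by (intro mult_mono) auto
      then have "t - a \<le> (t - a + 1)\<^sup>2" by (simp add: power2_eq_square)
      ultimately have "(K * (t - a))\<^sup>2 * (t - a) \<le> (K * (t - a) + 1)\<^sup>2 * (t - a + 1)\<^sup>2"
        using ta by (intro mult_mono) auto
      then have "16 * ((K * (t - a))\<^sup>2 * (t - a)) \<le> 16 * ((K * (t - a) + 1)\<^sup>2 * (t - a + 1)\<^sup>2)"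
        by (rule mult_left_mono) simp
      moreover have "C\<^sup>2 = 16 * ((K * (t - a) + 1)\<^sup>2 * (t - a + 1)\<^sup>2)"
        unfolding C_def power_mult_distrib by simp
      ultimately have "16 * (K * (t - a))\<^sup>2 * (t - a) \<le> C\<^sup>2"
        by (simp only: mult.assoc)
      then have "16 * (K * (t - a))\<^sup>2 * (t - a) / (Suc n)\<^sup>2 \<le> C\<^sup>2 / (Suc n)\<^sup>2"
        by (intro divide_right_mono) auto
      then show ?thesis by (simp add: power_divide)
    qed
    finally show "(\<integral>\<^sup>+\<omega>. ennreal ((I2 \<omega> - I1 \<omega> - D n \<omega>)\<^sup>2) \<partial>M) \<le> ennreal ((C / Suc n)\<^sup>2)"
      by (simp add: ennreal_leI)
  qed (use C0 in auto)
  have val: "?\<phi> (D n) = complex_of_real (prob A * exp (- (\<theta>\<^sup>2 * V n) / 2))" for n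
  proof -
    have h1: "(\<integral>\<omega>. indicator A \<omega> * iexp (\<Sum>j<Suc n. (\<theta> * \<sigma> (q n j)) * (B (q n (Suc j)) \<omega> - B (q n j) \<omega>)) \<partial>M) =
      complex_of_real (prob A * exp (- (\<Sum>j<Suc n. (\<theta> * \<sigma> (q n j))\<^sup>2 * (q n (Suc j) - q n j)) / 2))"
      using a A grid_point_mono[of s t]
      by (intro char_sum_increments[THEN conjunct1]) (auto simp: q_def)
    have h2: "(\<Sum>j<Suc n. (\<theta> * \<sigma> (q n j)) * (B (q n (Suc j)) \<omega> - B (q n j) \<omega>)) = \<theta> * D n \<omega>" for \<omega>
      unfolding D_def sum_distrib_left by (simp add: mult_ac)
    have h3: "(\<Sum>j<Suc n. (\<theta> * \<sigma> (q n j))\<^sup>2 * (q n (Suc j) - q n j)) = \<theta>\<^sup>2 * V n"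
      unfolding V_def sum_distrib_left q_def grid_point_Suc_diff by (simp add: power_mult_distrib mult_ac)
    show ?thesis using h1 unfolding h2 h3 .
  qed
  have inv: "(\<lambda>n. c / real (Suc n)) \<longlonglongrightarrow> 0" for c :: real
    using tendsto_mult_right_zero[OF LIMSEQ_inverse_real_of_nat, of c] by (simp add: divide_inverse)
  have "V \<longlonglongrightarrow> ?v"
  proof -
    have "K-lipschitz_on {s..t} \<sigma>" using a by (auto intro: lipschitz_on_subset[OF K])
    then obtain K' where K': "K'-lipschitz_on {s..t} (\<lambda>r. (\<sigma> r)\<^sup>2)" by (rule lipschitz_on_square)
    have "\<bar>?v - V n\<bar> \<le> K' * (t - s)\<^sup>2 / Suc n" for n
      using LINT_uniform_step[OF K', of "Suc n"] a unfolding V_def q_def by simp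
    then have "\<bar>V n - ?v\<bar> \<le> K' * (t - s)\<^sup>2 / Suc n" for n
      by (metis abs_minus_commute)
    then have "(\<lambda>n. V n - ?v) \<longlonglongrightarrow> 0"
      by (intro Lim_null_comparison[OF _ inv[of "K' * (t - s)\<^sup>2"]]) auto
    then show ?thesis by (simp add: LIM_zero_iff)
  qed
  then have "(\<lambda>n. ?\<phi> (D n)) \<longlonglongrightarrow> complex_of_real (prob A * exp (- (\<theta>\<^sup>2 * ?v) / 2))"
    unfolding val by (intro tendsto_intros) simp_all
  moreover have err0: "(\<lambda>n. ?\<phi> (\<lambda>\<omega>. I2 \<omega> - I1 \<omega>) - ?\<phi> (D n)) \<longlonglongrightarrow> 0"
    using err by (intro Lim_null_comparison[OF _ inv[of "2 * \<bar>\<theta>\<bar> * C"]]) auto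
  have "(\<lambda>n. ?\<phi> (D n)) \<longlonglongrightarrow> ?\<phi> (\<lambda>\<omega>. I2 \<omega> - I1 \<omega>)"
    using tendsto_diff[OF tendsto_const[of "?\<phi> (\<lambda>\<omega>. I2 \<omega> - I1 \<omega>)"] err0] by (simp only: diff_diff_eq2 diff_zero add_diff_cancel_left')
  ultimately show ?thesis by (rule LIMSEQ_unique[rotated])
qed

end

text \<open>Levy's uniqueness theorem, applied to the law of \<open>X\<close> under the probability conditioned on \<open>A\<close>.\<close>

lemma (in prob_space) std_normal_indep_eventI:
  assumes A: "A \<in> sets M" and [measurable]: "X \<in> borel_measurable M"
    and char: "\<And>\<theta>. (\<integral>\<omega>. indicator A \<omega> * iexp (\<theta> * X \<omega>) \<partial>M) = complex_of_real (prob A * exp (- \<theta>\<^sup>2 / 2))"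
    and C: "C \<in> sets borel"
  shows "prob (A \<inter> {\<omega> \<in> space M. X \<omega> \<in> C}) = prob A * measure std_normal_distribution C"
proof (cases "prob A = 0")
  case True
  then show ?thesis
    using A measure_mono_fmeasurable[of "A \<inter> {\<omega> \<in> space M. X \<omega> \<in> C}" A M] C
    by (simp add: fmeasurable_eq_sets measure_le_0_iff)
next
  case False
  note [measurable] = A C
  have pA: "0 < prob A" using False by (simp add: zero_less_measure_iff)
  let ?U = "uniform_measure M A"
  have U: "?U = density M (\<lambda>\<omega>. ennreal (indicator A \<omega> / prob A))"
    unfolding uniform_measure_def
    using pA by (intro density_cong AE_I2) (auto simp: emeasure_eq_measure divide_ennreal ennreal_indicator[symmetric] split: split_indicator)
  interpret U: prob_space ?U
    using pA by (intro prob_space_uniform_measure) (auto simp: emeasure_eq_measure)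
  have XU [measurable]: "X \<in> borel_measurable ?U" by simp
  have rd: "real_distribution (distr ?U borel X)"
    by (intro U.real_distribution_distr) simp
  have "char (distr ?U borel X) \<theta> = char std_normal_distribution \<theta>" for \<theta>
  proof -
    have "char (distr ?U borel X) \<theta> = (\<integral>\<omega>. iexp (\<theta> * X \<omega>) \<partial>?U)"
      unfolding char_def by (subst integral_distr) auto
    also have "\<dots> = (\<integral>\<omega>. (indicator A \<omega> / prob A) *\<^sub>R iexp (\<theta> * X \<omega>) \<partial>M)"
      unfolding U by (subst integral_density) auto
    also have "\<dots> = (\<integral>\<omega>. complex_of_real (1 / prob A) * (indicator A \<omega> * iexp (\<theta> * X \<omega>)) \<partial>M)"
      by (intro Bochner_Integration.integral_cong) (auto simp: scaleR_conv_of_real split: split_indicator)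
    also have "\<dots> = complex_of_real (exp (- \<theta>\<^sup>2 / 2))"
      unfolding integral_mult_right_zero char using pA by simp
    finally show ?thesis by (simp add: char_std_normal_distribution)
  qed
  then have eq: "distr ?U borel X = std_normal_distribution"
    by (intro Levy_uniqueness rd real_dist_normal_dist) auto
  have "measure std_normal_distribution C = measure ?U {\<omega> \<in> space M. X \<omega> \<in> C}"
    unfolding eq[symmetric] by (subst measure_distr) (auto simp: vimage_def Int_def conj_commute)
  also have "\<dots> = prob (A \<inter> {\<omega> \<in> space M. X \<omega> \<in> C}) / prob A"
    using pA by (intro measure_uniform_measure) (auto simp: emeasure_eq_measure)
  finally show ?thesis using pA by simp
qed

context brownian_motion begin

text \<open>Independence of the past of \<open>s\<close> and the Gaussian law are stated together, as a product formula for
  probabilities.\<close>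

theorem ito_increment_law:
  fixes \<sigma> :: "real \<Rightarrow> real"
  assumes a: "0 \<le> a" "a \<le> s" "s < t"
    and I1: "has_ito_integral M F B a s (\<lambda>r \<omega>. \<sigma> r) I1"
    and I2: "has_ito_integral M F B a t (\<lambda>r \<omega>. \<sigma> r) I2"
    and K: "K-lipschitz_on {a..t} \<sigma>" and A: "A \<in> sets (F s)" and C: "C \<in> sets borel"
    and v: "v = (LINT r:{s..t}|lborel. (\<sigma> r)\<^sup>2)" "0 < v"
  shows "prob (A \<inter> {\<omega> \<in> space M. (I2 \<omega> - I1 \<omega>) / sqrt v \<in> C}) = prob A * measure std_normal_distribution C"
proof (rule std_normal_indep_eventI[OF _ _ _ C])
  show "A \<in> sets M" using past_event A a by auto
  have [measurable]: "I1 \<in> borel_measurable M" "I2 \<in> borel_measurable M"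
    using I1 I2 by (auto simp: has_ito_integral_def)
  show "(\<lambda>\<omega>. (I2 \<omega> - I1 \<omega>) / sqrt v) \<in> borel_measurable M" by measurable
  fix \<theta>
  show "(\<integral>\<omega>. indicator A \<omega> * iexp (\<theta> * ((I2 \<omega> - I1 \<omega>) / sqrt v)) \<partial>M) = complex_of_real (prob A * exp (- \<theta>\<^sup>2 / 2))"
    using char_ito_increment[OF a I1 I2 K A, of "\<theta> / sqrt v"] v by (simp add: power_divide)
qed

end

section \<open>A maximal inequality and the size of the remaining noise\<close>

text \<open>What the rest of the proof needs to know about the noise \<open>W t = \<integral> s powr - \<gamma> dB s\<close>. The number
  \<open>v s t\<close> is the variance of \<open>W t - W s\<close>, known through the bounds by its integrand at the
  two end points.\<close>

locale gaussian_noise = prob_space M + filtration "space M" F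
  for M :: "'a measure" and F :: "real \<Rightarrow> 'a measure" +
  fixes W :: "real \<Rightarrow> 'a \<Rightarrow> real" and v :: "real \<Rightarrow> real \<Rightarrow> real" and \<gamma> :: real
  assumes subalgebra_F: "1 \<le> t \<Longrightarrow> subalgebra M (F t)"
    and W_adapted: "1 \<le> t \<Longrightarrow> W t \<in> borel_measurable (F t)"
    and W_continuous: "\<omega> \<in> space M \<Longrightarrow> continuous_on {1..} (\<lambda>t. W t \<omega>)"
    and v_lower: "1 \<le> s \<Longrightarrow> s < t \<Longrightarrow> (t - s) * t powr (- 2 * \<gamma>) \<le> v s t"
    and v_upper: "1 \<le> s \<Longrightarrow> s < t \<Longrightarrow> v s t \<le> (t - s) * s powr (- 2 * \<gamma>)"
    and v_antimono: "1 \<le> s \<Longrightarrow> s \<le> s' \<Longrightarrow> s' < t \<Longrightarrow> v s' t \<le> v s t"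
    and increment_law: "1 \<le> s \<Longrightarrow> s < t \<Longrightarrow> A \<in> sets (F s) \<Longrightarrow> C \<in> sets borel \<Longrightarrow>
      prob (A \<inter> {\<omega> \<in> space M. (W t \<omega> - W s \<omega>) / sqrt (v s t) \<in> C}) = prob A * measure std_normal_distribution C"

lemma std_normal_tail:
  assumes "0 < x"
  shows "measure std_normal_distribution {y. x \<le> \<bar>y\<bar>} \<le> 1 / x\<^sup>2"
proof -
  interpret N: real_distribution std_normal_distribution by (rule real_dist_normal_dist)
  have E: "(LINT y|std_normal_distribution. y) = 0"
    using integral_std_normal_distribution_moment_odd[of 1] by simp
  have E2: "(LINT y|std_normal_distribution. y\<^sup>2) = 1"
    using std_normal_distribution_even_moments(1)[of 1] by (simp add: fact_numeral)
  have "N.prob {y \<in> space std_normal_distribution. x \<le> \<bar>y - N.expectation (\<lambda>y. y)\<bar>} \<le> N.variance (\<lambda>y. y) / x\<^sup>2"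
    using assms integrable_std_normal_distribution_moment[of 2]
    by (intro N.Chebyshev_inequality) auto
  then show ?thesis unfolding E using E2 by simp
qed

context gaussian_noise begin

lemma v_pos: "1 \<le> s \<Longrightarrow> s < t \<Longrightarrow> 0 < v s t"
  using v_lower[of s t] by (auto elim!: less_le_trans[rotated] intro!: mult_pos_pos)

lemma past_event: "A \<in> sets (F s) \<Longrightarrow> 1 \<le> s \<Longrightarrow> A \<in> sets M"
  using subalgebra_F[of s] by (auto simp: subalgebra_def)

lemma past_event_later: "A \<in> sets (F s) \<Longrightarrow> s \<le> t \<Longrightarrow> A \<in> sets (F t)"
  using sets_F_mono by blast

lemma W_measurable [measurable]: "1 \<le> t \<Longrightarrow> W t \<in> borel_measurable M"
  using measurable_from_subalg[OF subalgebra_F W_adapted] by blast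

lemma W_adapted_later: "1 \<le> s \<Longrightarrow> s \<le> t \<Longrightarrow> W s \<in> borel_measurable (F t)"
  by (rule measurable_from_subalg[OF _ W_adapted]) (auto simp: subalgebra_def space_F sets_F_mono)

lemma increment_tail:
  assumes st: "1 \<le> s" "s < t" and A: "A \<in> sets (F s)" and c: "0 < c"
  shows "prob (A \<inter> {\<omega> \<in> space M. c < \<bar>W t \<omega> - W s \<omega>\<bar>}) \<le> prob A * (v s t / c\<^sup>2)"
    and "prob A * (1 - v s t / c\<^sup>2) \<le> prob (A \<inter> {\<omega> \<in> space M. \<bar>W t \<omega> - W s \<omega>\<bar> \<le> c})"
proof -
  interpret N: real_distribution std_normal_distribution by (rule real_dist_normal_dist)
  let ?x = "c / sqrt (v s t)"
  have v: "0 < v s t" using v_pos[OF st] .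
  have x: "0 < ?x" using c v by simp
  have AM: "A \<in> sets M" using past_event A st by auto
  have [measurable]: "W t \<in> borel_measurable M" "W s \<in> borel_measurable M" using st by auto
  have tail: "measure std_normal_distribution {y. ?x \<le> \<bar>y\<bar>} \<le> v s t / c\<^sup>2"
    using std_normal_tail[OF x] v by (simp add: power_divide)
  have "prob (A \<inter> {\<omega> \<in> space M. c < \<bar>W t \<omega> - W s \<omega>\<bar>}) \<le>
      prob (A \<inter> {\<omega> \<in> space M. (W t \<omega> - W s \<omega>) / sqrt (v s t) \<in> {y. ?x \<le> \<bar>y\<bar>}})"
    using AM v by (intro finite_measure_mono) (auto simp: divide_right_mono less_imp_le)
  also have "\<dots> = prob A * measure std_normal_distribution {y. ?x \<le> \<bar>y\<bar>}"
    using st A by (intro increment_law) auto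
  also have "\<dots> \<le> prob A * (v s t / c\<^sup>2)" using tail by (intro mult_left_mono) auto
  finally show 1: "prob (A \<inter> {\<omega> \<in> space M. c < \<bar>W t \<omega> - W s \<omega>\<bar>}) \<le> prob A * (v s t / c\<^sup>2)" .
  have "prob A = prob ((A \<inter> {\<omega> \<in> space M. c < \<bar>W t \<omega> - W s \<omega>\<bar>}) \<union> (A \<inter> {\<omega> \<in> space M. \<bar>W t \<omega> - W s \<omega>\<bar> \<le> c}))"
    using sets.sets_into_space[OF AM] by (intro arg_cong[where f=prob]) auto
  also have "\<dots> = prob (A \<inter> {\<omega> \<in> space M. c < \<bar>W t \<omega> - W s \<omega>\<bar>}) + prob (A \<inter> {\<omega> \<in> space M. \<bar>W t \<omega> - W s \<omega>\<bar> \<le> c})"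
    using AM by (intro finite_measure_Union) auto
  finally show "prob A * (1 - v s t / c\<^sup>2) \<le> prob (A \<inter> {\<omega> \<in> space M. \<bar>W t \<omega> - W s \<omega>\<bar> \<le> c})"
    using 1 by (simp add: algebra_simps)
qed

text \<open>Ottaviani's inequality. When the walk first exceeds \<open>2 c\<close>, the remaining increment is at most \<open>c\<close>
  with conditional probability at least \<open>1/2\<close>, and then the final value still exceeds \<open>c\<close>. Thus the
  maximum is controlled by the final value. Intersecting with an event \<open>A\<close> of the past leaves every
  step intact, because the increments are independent of the past.\<close>

lemma maximal_inequality_discrete:
  fixes p :: "nat \<Rightarrow> real"
  assumes p: "1 \<le> p 0" "\<And>i. i < n \<Longrightarrow> p i < p (Suc i)" and n: "0 < n"
    and A: "A \<in> sets (F (p 0))" and c: "0 < c" and half: "v (p 0) (p n) / c\<^sup>2 \<le> 1 / 2"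
  shows "prob (A \<inter> {\<omega> \<in> space M. \<exists>i\<le>n. 2 * c < \<bar>W (p i) \<omega> - W (p 0) \<omega>\<bar>}) \<le> 2 * prob A * (v (p 0) (p n) / c\<^sup>2)"
proof -
  have pp: "p j \<le> p i" if "j \<le> i" "i \<le> n" for i j
    using that
  proof (induction i rule: dec_induct)
    case (step k)
    then show ?case using p(2)[of k] by simp
  qed simp
  have p_le_n: "p i < p n" if "i < n" for i
    using p(2)[OF that] pp[of "Suc i" n] that by simp
  have p0: "p 0 \<le> p i" if "i \<le> n" for i
    using pp[of 0 i] that by simp
  have p1: "1 \<le> p i" if "i \<le> n" for i using p0[OF that] p(1) by simp
  define D where "D i \<omega> = \<bar>W (p i) \<omega> - W (p 0) \<omega>\<bar>" for i \<omega>
  have AM: "A \<in> sets M" using past_event A p by auto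
  (* On E i the threshold is exceeded for the first time at the i-th point. *)
  define E where "E i = A \<inter> {\<omega> \<in> space M. 2 * c < D i \<omega> \<and> (\<forall>j<i. D j \<omega> \<le> 2 * c)}" for i
  define G where "G = A \<inter> {\<omega> \<in> space M. c < \<bar>W (p n) \<omega> - W (p 0) \<omega>\<bar>}"
  have DM: "D j \<in> borel_measurable (F (p i))" if "j \<le> i" "i \<le> n" for i j
  proof -
    have [measurable]: "W (p j) \<in> borel_measurable (F (p i))" "W (p 0) \<in> borel_measurable (F (p i))"
      using pp[OF that] p0[OF that(2)] p1[of j] p(1) that by (auto intro!: W_adapted_later)
    show ?thesis unfolding D_def by measurable
  qed
  have EF: "E i \<in> sets (F (p i))" if "i \<le> n" for i
  proof -
    have [measurable]: "D j \<in> borel_measurable (F (p i))" if "j \<le> i" for j using DM that \<open>i \<le> n\<close> by auto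
    have 1: "{\<omega> \<in> space (F (p i)). 2 * c < D i \<omega> \<and> (\<forall>j\<in>{..<i}. D j \<omega> \<le> 2 * c)} \<in> sets (F (p i))"
      by measurable
    have 2: "A \<in> sets (F (p i))" by (rule past_event_later[OF A p0[OF that]])
    have "E i = A \<inter> {\<omega> \<in> space (F (p i)). 2 * c < D i \<omega> \<and> (\<forall>j\<in>{..<i}. D j \<omega> \<le> 2 * c)}"
      unfolding E_def space_F Ball_def lessThan_iff ..
    then show ?thesis using sets.Int[OF 2 1] by metis
  qed
  have EM: "E i \<in> sets M" if "i \<le> n" for i using past_event[OF EF] p1 that by auto
  have [measurable]: "W (p n) \<in> borel_measurable M" "W (p 0) \<in> borel_measurable M" using p1 by auto
  have GM: "G \<in> sets M" unfolding G_def using AM by measurable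
  have halfE: "prob (E i) \<le> 2 * prob (G \<inter> E i)" if "i \<le> n" for i
  proof (cases "i = n")
    case True
    then have "G \<inter> E i = E i" using c by (auto simp: G_def E_def D_def)
    then show ?thesis by simp
  next
    case False
    then have i: "i < n" using that by simp
    have "v (p i) (p n) / c\<^sup>2 \<le> v (p 0) (p n) / c\<^sup>2"
      using v_antimono[of "p 0" "p i" "p n"] p0[OF that] p_le_n[OF i] p(1) by (intro divide_right_mono) auto
    then have "1 / 2 \<le> 1 - v (p i) (p n) / c\<^sup>2"
      using half by linarith
    then have "prob (E i) * (1 / 2) \<le> prob (E i) * (1 - v (p i) (p n) / c\<^sup>2)"
      by (rule mult_left_mono) simp
    also have "\<dots> \<le> prob (E i \<inter> {\<omega> \<in> space M. \<bar>W (p n) \<omega> - W (p i) \<omega>\<bar> \<le> c})"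
      by (intro increment_tail(2) p1 p_le_n EF that i c)
    also have "\<dots> \<le> prob (G \<inter> E i)"
      using GM EM[OF that] by (intro finite_measure_mono) (auto simp: G_def E_def D_def)
    finally show ?thesis by simp
  qed
  have disj: "disjoint_family_on E {..n}"
    unfolding disjoint_family_on_def
  proof (intro ballI impI)
    fix i j :: nat assume "i \<noteq> j"
    then consider "i < j" | "j < i" by linarith
    then show "E i \<inter> E j = {}" by cases (auto simp: E_def)
  qed
  have "A \<inter> {\<omega> \<in> space M. \<exists>i\<le>n. 2 * c < \<bar>W (p i) \<omega> - W (p 0) \<omega>\<bar>} \<subseteq> (\<Union>i\<in>{..n}. E i)"
  proof
    fix \<omega> assume \<omega>: "\<omega> \<in> A \<inter> {\<omega> \<in> space M. \<exists>i\<le>n. 2 * c < \<bar>W (p i) \<omega> - W (p 0) \<omega>\<bar>}"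
    define i where "i = (LEAST i. 2 * c < D i \<omega>)"
    obtain k where k: "k \<le> n" "2 * c < D k \<omega>" using \<omega> by (auto simp: D_def)
    have "2 * c < D i \<omega>" unfolding i_def using k(2) by (rule LeastI)
    moreover have "i \<le> k" unfolding i_def using k(2) by (rule Least_le)
    moreover have "D j \<omega> \<le> 2 * c" if "j < i" for j
      using not_less_Least[of j "\<lambda>i. 2 * c < D i \<omega>"] that by (auto simp: i_def)
    ultimately show "\<omega> \<in> (\<Union>i\<in>{..n}. E i)" using \<omega> k by (auto simp: E_def)
  qed
  then have "prob (A \<inter> {\<omega> \<in> space M. \<exists>i\<le>n. 2 * c < \<bar>W (p i) \<omega> - W (p 0) \<omega>\<bar>}) \<le> prob (\<Union>i\<in>{..n}. E i)"
    using EM by (intro finite_measure_mono) auto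
  also have "\<dots> = (\<Sum>i\<le>n. prob (E i))"
    using EM disj by (intro finite_measure_finite_Union) auto
  also have "\<dots> \<le> (\<Sum>i\<le>n. 2 * prob (G \<inter> E i))" using halfE by (intro sum_mono) auto
  also have "\<dots> = 2 * prob (\<Union>i\<in>{..n}. G \<inter> E i)"
    using EM GM disj unfolding sum_distrib_left[symmetric]
    by (subst finite_measure_finite_Union) (auto simp: disjoint_family_on_def)
  also have "\<dots> \<le> 2 * prob G" using GM by (intro mult_left_mono finite_measure_mono) auto
  also have "\<dots> \<le> 2 * (prob A * (v (p 0) (p n) / c\<^sup>2))"
    unfolding G_def using p_le_n[of 0] n by (intro mult_left_mono increment_tail(1) p(1) A c) auto
  finally show ?thesis by simp
qed

definition osc :: "real \<Rightarrow> real \<Rightarrow> real \<Rightarrow> 'a set" where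
  "osc s t c = {\<omega> \<in> space M. \<exists>r\<in>{s..t}. c < \<bar>W r \<omega> - W s \<omega>\<bar>}"

definition dyadic_point :: "real \<Rightarrow> real \<Rightarrow> nat \<Rightarrow> nat \<Rightarrow> real" where
  "dyadic_point s t n i = s + (t - s) * (real i / 2 ^ n)"

text \<open>By continuity the oscillation is visible on dyadic points. The dyadic grids are nested, so the events on the
  right increase, which transfers the discrete maximal inequality to continuous time.\<close>

lemma osc_eq_dyadic:
  assumes st: "1 \<le> s" "s < t"
  shows "osc s t c = (\<Union>n. {\<omega> \<in> space M. \<exists>i\<le>2 ^ n. c < \<bar>W (dyadic_point s t n i) \<omega> - W s \<omega>\<bar>})"
proof (intro equalityI subsetI)
  fix \<omega> assume "\<omega> \<in> osc s t c"
  then obtain r where \<omega>: "\<omega> \<in> space M" and r: "r \<in> {s..t}" "c < \<bar>W r \<omega> - W s \<omega>\<bar>" by (auto simp: osc_def)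
  let ?e = "\<bar>W r \<omega> - W s \<omega>\<bar> - c"
  obtain d where d: "0 < d" "\<And>r'. r' \<in> {1..} \<Longrightarrow> dist r' r < d \<Longrightarrow> dist (W r' \<omega>) (W r \<omega>) < ?e"
    using W_continuous[OF \<omega>, unfolded continuous_on_iff, rule_format, of r ?e] r st by auto
  obtain n :: nat where n: "(t - s) / d < 2 ^ n" using real_arch_pow[of 2 "(t - s) / d"] by auto
  define x where "x = (r - s) / (t - s) * 2 ^ n"
  define i where "i = nat \<lfloor>x\<rfloor>"
  have x: "0 \<le> x" "x \<le> 2 ^ n" using r st by (auto simp: x_def field_simps)
  have i: "real i \<le> x" "x < real i + 1" using x(1) by (auto simp: i_def)
  have "real i \<le> 2 ^ n" using i x by linarith
  then have i_le: "i \<le> 2 ^ n" by (metis of_nat_le_iff of_nat_numeral of_nat_power)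
  let ?r = "dyadic_point s t n i"
  have r_eq: "r = s + (t - s) * (x / 2 ^ n)" using st by (simp add: x_def)
  have "r - ?r = (t - s) * (x - real i) / 2 ^ n"
    unfolding r_eq dyadic_point_def by (simp add: field_simps)
  moreover have "0 \<le> (t - s) * (x - real i) / 2 ^ n" using i st by auto
  moreover have "(t - s) * (x - real i) / 2 ^ n \<le> (t - s) * 1 / 2 ^ n"
    using i st by (intro divide_right_mono mult_left_mono) auto
  moreover have "(t - s) / 2 ^ n < d" using n d(1) by (simp add: field_simps)
  ultimately have "dist ?r r < d" by (auto simp: dist_real_def)
  moreover have "1 \<le> ?r" using st by (auto simp: dyadic_point_def intro!: add_increasing2)
  ultimately have "dist (W ?r \<omega>) (W r \<omega>) < ?e" using d(2) by auto
  then have "c < \<bar>W ?r \<omega> - W s \<omega>\<bar>" by (auto simp: dist_real_def)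
  then show "\<omega> \<in> (\<Union>n. {\<omega> \<in> space M. \<exists>i\<le>2 ^ n. c < \<bar>W (dyadic_point s t n i) \<omega> - W s \<omega>\<bar>})"
    using \<omega> i_le by blast
next
  fix \<omega> assume "\<omega> \<in> (\<Union>n. {\<omega> \<in> space M. \<exists>i\<le>2 ^ n. c < \<bar>W (dyadic_point s t n i) \<omega> - W s \<omega>\<bar>})"
  then obtain n i :: nat where \<omega>: "\<omega> \<in> space M" and i: "i \<le> 2 ^ n" and c: "c < \<bar>W (dyadic_point s t n i) \<omega> - W s \<omega>\<bar>"
    by blast
  have "real i \<le> 2 ^ n" using i by (metis of_nat_le_iff of_nat_numeral of_nat_power)
  then have "(t - s) * (real i / 2 ^ n) \<le> (t - s) * 1" using st by (intro mult_left_mono) auto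
  moreover have "0 \<le> (t - s) * (real i / 2 ^ n)" using st by simp
  ultimately have "dyadic_point s t n i \<in> {s..t}" unfolding dyadic_point_def atLeastAtMost_iff by simp
  then show "\<omega> \<in> osc s t c" unfolding osc_def using \<omega> c by blast
qed

lemma
  assumes st: "1 \<le> s" "s < t"
  shows osc_measurable: "osc s t c \<in> sets M"
    and maximal_inequality: "A \<in> sets (F s) \<Longrightarrow> 0 < c' \<Longrightarrow> v s t / c'\<^sup>2 \<le> 1 / 2 \<Longrightarrow>
      prob (A \<inter> osc s t (2 * c')) \<le> 2 * prob A * (v s t / c'\<^sup>2)"
proof -
  let ?O = "\<lambda>c n. {\<omega> \<in> space M. \<exists>i\<le>2 ^ n. c < \<bar>W (dyadic_point s t n i) \<omega> - W s \<omega>\<bar>}"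
  have d1: "1 \<le> dyadic_point s t n i" for n i
    using st by (auto simp: dyadic_point_def intro!: add_increasing2)
  have OM: "?O c n \<in> sets M" for c n
  proof -
    have [measurable]: "W (dyadic_point s t n i) \<in> borel_measurable M" "W s \<in> borel_measurable M" for i
      using d1 st by auto
    have eq: "?O c n = (\<Union>i\<in>{..2 ^ n}. {\<omega> \<in> space M. c < \<bar>W (dyadic_point s t n i) \<omega> - W s \<omega>\<bar>})" by auto
    show ?thesis unfolding eq by (intro sets.finite_UN) measurable
  qed
  then show "osc s t c \<in> sets M" unfolding osc_eq_dyadic[OF st]
    by (intro sets.countable_nat_UN image_subsetI OM)
  assume A: "A \<in> sets (F s)" and c': "0 < c'" and half: "v s t / c'\<^sup>2 \<le> 1 / 2"
  have AM: "A \<in> sets M" using past_event A st by auto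
  have lim: "(\<lambda>n. prob (A \<inter> ?O (2 * c') n)) \<longlonglongrightarrow> prob (\<Union>n. A \<inter> ?O (2 * c') n)"
  proof (rule finite_Lim_measure_incseq)
    show "range (\<lambda>n. A \<inter> ?O (2 * c') n) \<subseteq> sets M" using sets.Int[OF AM OM] by blast
    show "incseq (\<lambda>n. A \<inter> ?O (2 * c') n)"
    proof (rule incseq_SucI, rule subsetI)
      fix n \<omega> assume "\<omega> \<in> A \<inter> ?O (2 * c') n"
      then obtain i where i: "i \<le> 2 ^ n" "2 * c' < \<bar>W (dyadic_point s t n i) \<omega> - W s \<omega>\<bar>" "\<omega> \<in> A" "\<omega> \<in> space M" by blast
      moreover have "dyadic_point s t (Suc n) (2 * i) = dyadic_point s t n i" by (simp add: dyadic_point_def)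
      moreover have "2 * i \<le> 2 ^ Suc n" using i by simp
      ultimately have "\<exists>i\<le>2 ^ Suc n. 2 * c' < \<bar>W (dyadic_point s t (Suc n) i) \<omega> - W s \<omega>\<bar>"
        by (intro exI[of _ "2 * i"]) simp
      then show "\<omega> \<in> A \<inter> ?O (2 * c') (Suc n)" using i(3,4) by simp
    qed
  qed
  have le: "prob (A \<inter> ?O (2 * c') n) \<le> 2 * prob A * (v s t / c'\<^sup>2)" for n
  proof -
    have e: "dyadic_point s t n 0 = s" "dyadic_point s t n (2 ^ n) = t" by (auto simp: dyadic_point_def)
    have "prob (A \<inter> {\<omega> \<in> space M. \<exists>i\<le>2 ^ n. 2 * c' < \<bar>W (dyadic_point s t n i) \<omega> - W (dyadic_point s t n 0) \<omega>\<bar>}) \<le>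
        2 * prob A * (v (dyadic_point s t n 0) (dyadic_point s t n (2 ^ n)) / c'\<^sup>2)"
    proof (rule maximal_inequality_discrete)
      show "dyadic_point s t n i < dyadic_point s t n (Suc i)" for i
      proof -
        have "real i / 2 ^ n < real (Suc i) / 2 ^ n" by (intro divide_strict_right_mono) auto
        then have "(t - s) * (real i / 2 ^ n) < (t - s) * (real (Suc i) / 2 ^ n)"
          using st by (intro mult_strict_left_mono) auto
        then show ?thesis unfolding dyadic_point_def by simp
      qed
    qed (use half in \<open>simp_all add: e st A c'\<close>)
    then show ?thesis unfolding e .
  qed
  have "prob (\<Union>n. A \<inter> ?O (2 * c') n) \<le> 2 * prob A * (v s t / c'\<^sup>2)"
    by (rule LIMSEQ_le_const2[OF lim]) (use le in blast)
  then show "prob (A \<inter> osc s t (2 * c')) \<le> 2 * prob A * (v s t / c'\<^sup>2)"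
    unfolding osc_eq_dyadic[OF st] by simp
qed

text \<open>On the \<open>j\<close>-th dyadic block the variance is at most \<open>s powr (1 - 2 \<gamma>)\<close> with \<open>s = T * 2 ^ j\<close>, while
  the squared threshold is of order \<open>s powr (- 2 q)\<close>. As \<open>q < \<gamma> - 1/2\<close>, the bounds of the maximal
  inequality form a geometric series whose sum is small when \<open>T\<close> is large. An event of the past of
  \<open>T\<close> belongs to the past of every block, so the inequality applies to each block on that event and a
  union bound concludes.\<close>

lemma dyadic_oscillations_small:
  assumes q: "0 < q" "q < \<gamma> - 1 / 2" and \<eta>: "0 < \<eta>"
  obtains T0 where "1 \<le> T0" "\<And>T A. T0 \<le> T \<Longrightarrow> A \<in> sets (F T) \<Longrightarrow>
    prob (A \<inter> (\<Union>j. osc (T * 2 ^ j) (T * 2 ^ Suc j) (\<eta> * (T * 2 ^ j) powr - q))) \<le> prob A / 2"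
proof -
  define \<rho> where "\<rho> = 2 * \<gamma> - 1 - 2 * q"
  have \<rho>: "0 < \<rho>" using q by (simp add: \<rho>_def)
  define b where "b = 2 powr - \<rho>"
  have b: "0 < b" "b < 1" using \<rho> by (auto simp: b_def powr_less_one)
  (* Chosen so that the geometric series with ratio b sums to at most one half. *)
  define \<epsilon> where "\<epsilon> = (1 - b) * \<eta>\<^sup>2 / 16"
  have \<epsilon>: "0 < \<epsilon>" using b \<eta> by (simp add: \<epsilon>_def)
  have "((\<lambda>T::real. T powr - \<rho>) \<longlongrightarrow> 0) at_top"
    using \<rho> by (intro tendsto_neg_powr filterlim_ident) auto
  then have "\<forall>\<^sub>F T in at_top. T powr - \<rho> < \<epsilon>" using \<epsilon> by (rule order_tendstoD)
  then obtain T1 where T1: "\<And>T. T1 \<le> T \<Longrightarrow> T powr - \<rho> < \<epsilon>" by (auto simp: eventually_at_top_linorder)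
  show ?thesis
  proof (rule that[of "max 1 T1"])
    fix T A assume T: "max 1 T1 \<le> T" and A: "A \<in> sets (F T)"
    let ?t = "\<lambda>j::nat. T * 2 ^ j"
    let ?c = "\<lambda>j. \<eta> * ?t j powr - q / 2"
    let ?O = "\<lambda>j. osc (?t j) (?t (Suc j)) (\<eta> * ?t j powr - q)"
    have t1: "1 \<le> ?t j" "T \<le> ?t j" "?t j < ?t (Suc j)" for j
    proof -
      have "T * 1 \<le> ?t j" using T by (intro mult_left_mono) auto
      then show "1 \<le> ?t j" "T \<le> ?t j" using T by linarith+
      show "?t j < ?t (Suc j)" using T by simp
    qed
    have AM: "A \<in> sets M" using past_event[OF A] T by simp
    have OM: "?O j \<in> sets M" for j using osc_measurable t1 by blast
    have pw: "?t j powr - \<rho> = T powr - \<rho> * b ^ j" for j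
      using T by (simp add: powr_mult b_def powr_powr powr_realpow[symmetric] mult.commute)
    have ratio: "v (?t j) (?t (Suc j)) / (?c j)\<^sup>2 \<le> 4 / \<eta>\<^sup>2 * (T powr - \<rho> * b ^ j)" for j
    proof -
      have c2: "(?c j)\<^sup>2 = \<eta>\<^sup>2 * ?t j powr (- 2 * q) / 4"
      proof -
        have "(?t j powr - q)\<^sup>2 = ?t j powr (- 2 * q)"
          unfolding power2_eq_square powr_add[symmetric] by simp
        then show ?thesis by (simp only: power_divide power_mult_distrib) simp
      qed
      have "v (?t j) (?t (Suc j)) \<le> (?t (Suc j) - ?t j) * ?t j powr (- 2 * \<gamma>)"
        by (rule v_upper) (use t1 in auto)
      also have "\<dots> = ?t j powr 1 * ?t j powr (- 2 * \<gamma>)" using t1(1)[of j] by simp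
      also have "\<dots> = ?t j powr - \<rho> * ?t j powr (- 2 * q)"
        unfolding powr_add[symmetric] by (simp add: \<rho>_def)
      finally have "v (?t j) (?t (Suc j)) / (?c j)\<^sup>2 \<le> ?t j powr - \<rho> * ?t j powr (- 2 * q) / (?c j)\<^sup>2"
        by (rule divide_right_mono) simp
      also have "\<dots> = 4 / \<eta>\<^sup>2 * ?t j powr - \<rho>"
        unfolding c2 using t1(1)[of j] \<eta> by (simp add: field_simps)
      finally show ?thesis unfolding pw .
    qed
    have bj: "b ^ j \<le> 1" for j using b by (simp add: power_le_one)
    have small: "4 / \<eta>\<^sup>2 * T powr - \<rho> \<le> (1 - b) / 4"
      using T1[of T] T \<eta> by (simp add: \<epsilon>_def field_simps)
    have half: "v (?t j) (?t (Suc j)) / (?c j)\<^sup>2 \<le> 1 / 2" for j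
    proof -
      have "v (?t j) (?t (Suc j)) / (?c j)\<^sup>2 \<le> 4 / \<eta>\<^sup>2 * (T powr - \<rho> * 1)"
        using bj[of j] \<eta> by (intro order_trans[OF ratio] mult_left_mono) auto
      then show ?thesis using small b by simp
    qed
    have each: "prob (A \<inter> ?O j) \<le> prob A * ((1 - b) / 2) * b ^ j" for j
    proof -
      have "prob (A \<inter> osc (?t j) (?t (Suc j)) (2 * ?c j)) \<le> 2 * prob A * (v (?t j) (?t (Suc j)) / (?c j)\<^sup>2)"
        using t1[of j] \<eta> half past_event_later[OF A t1(2)] by (intro maximal_inequality) (auto intro!: mult_pos_pos)
      also have "\<dots> \<le> 2 * prob A * (4 / \<eta>\<^sup>2 * (T powr - \<rho> * b ^ j))"
        by (intro mult_left_mono ratio) auto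
      also have "\<dots> = 2 * prob A * b ^ j * (4 / \<eta>\<^sup>2 * T powr - \<rho>)" by simp
      also have "\<dots> \<le> 2 * prob A * b ^ j * ((1 - b) / 4)"
        using b by (intro mult_left_mono small) auto
      finally show ?thesis by (simp add: mult_ac)
    qed
    have sum: "summable (\<lambda>j. prob A * ((1 - b) / 2) * b ^ j)"
      using b by (intro summable_mult summable_geometric) auto
    have sumO: "summable (\<lambda>j. prob (A \<inter> ?O j))"
      by (rule summable_comparison_test'[OF sum, of 0]) (use each in auto)
    have "prob (A \<inter> (\<Union>j. ?O j)) = prob (\<Union>j. A \<inter> ?O j)" by simp
    also have "\<dots> \<le> (\<Sum>j. prob (A \<inter> ?O j))"
      using AM OM sumO by (intro finite_measure_subadditive_countably) auto
    also have "\<dots> \<le> (\<Sum>j. prob A * ((1 - b) / 2) * b ^ j)"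
      by (intro suminf_le each sumO sum)
    also have "\<dots> = prob A * ((1 - b) / 2) * (1 / (1 - b))"
      using b by (subst suminf_mult) (auto simp: suminf_geometric intro: summable_geometric)
    also have "\<dots> = prob A / 2"
    proof -
      have "k / 2 * (1 / k) = 1 / 2" if "k \<noteq> 0" for k :: real using that by simp
      from this[of "1 - b"] b have h: "(1 - b) / 2 * (1 / (1 - b)) = 1 / 2" by simp
      show ?thesis unfolding mult.assoc h by simp
    qed
    finally show "prob (A \<inter> (\<Union>j. ?O j)) \<le> prob A / 2" .
  qed simp
qed

end

section \<open>A single path with small noise\<close>

lemma dyadic_bracket:
  fixes t T :: real
  assumes "0 < T" "T \<le> t"
  obtains j :: nat where "T * 2 ^ j \<le> t" "t \<le> T * 2 ^ Suc j"
proof -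
  obtain n :: nat where n: "t / T < 2 ^ n" using real_arch_pow[of 2 "t / T"] by auto
  define m where "m = (LEAST n. t / T < (2::real) ^ n)"
  have m: "t / T < 2 ^ m" unfolding m_def using n by (rule LeastI)
  have "m \<noteq> 0"
  proof
    assume "m = 0"
    then have "t / T < 1" using m by simp
    then show False using assms by simp
  qed
  then obtain j where j: "m = Suc j" using not0_implies_Suc by blast
  have "\<not> t / T < 2 ^ j" using not_less_Least[of j "\<lambda>n. t / T < (2::real) ^ n"] j m_def by auto
  then show ?thesis using m assms unfolding j by (intro that[of j]) (auto simp: field_simps)
qed

text \<open>The oscillation bounds on the dyadic blocks after \<open>t\<close> form a geometric series of ratio
  \<open>2 powr - q\<close>; the factor \<open>2 powr q\<close> accounts for passing from the left end point of a block to \<open>t\<close>.\<close>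

lemma limit_of_dyadic_oscillation:
  fixes w :: "real \<Rightarrow> real"
  assumes T: "0 < T" and q: "0 < q" and \<eta>: "0 \<le> \<eta>"
    and osc: "\<And>j t. T * 2 ^ j \<le> t \<Longrightarrow> t \<le> T * 2 ^ Suc j \<Longrightarrow> \<bar>w t - w (T * 2 ^ j)\<bar> \<le> \<eta> * (T * 2 ^ j) powr - q"
  obtains wl where "\<And>t. T \<le> t \<Longrightarrow> \<bar>wl - w t\<bar> \<le> 2 powr q * (1 + 1 / (1 - 2 powr - q)) * \<eta> * t powr - q"
proof -
  define u where "u j = w (T * 2 ^ j)" for j :: nat
  define \<rho> :: real where "\<rho> = 2 powr - q"
  have \<rho>: "0 < \<rho>" "\<rho> < 1" using q by (auto simp: \<rho>_def powr_less_one)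
  have pw: "(T * 2 ^ j) powr - q = T powr - q * \<rho> ^ j" for j :: nat
    using T by (simp add: powr_mult \<rho>_def powr_powr powr_realpow[symmetric] mult.commute)
  have du: "\<bar>u (Suc j) - u j\<bar> \<le> \<eta> * T powr - q * \<rho> ^ j" for j
    using osc[of j "T * 2 ^ Suc j"] T unfolding u_def pw by (simp add: mult.assoc)
  have sg: "summable (\<lambda>i. \<eta> * T powr - q * \<rho> ^ (i + j))" for j
    using \<rho> by (intro summable_mult summable_ignore_initial_segment summable_geometric) auto
  have sd: "summable (\<lambda>i. \<bar>u (Suc (i + j)) - u (i + j)\<bar>)" for j
    using du by (intro summable_comparison_test'[OF sg[of j], of 0]) auto
  define l where "l = u 0 + (\<Sum>i. u (Suc i) - u i)"
  have "(\<lambda>n. u 0 + (\<Sum>i<n. u (Suc i) - u i)) \<longlonglongrightarrow> l"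
    unfolding l_def using summable_rabs_cancel[of "\<lambda>i. u (Suc i) - u i"] sd[of 0]
    by (intro tendsto_intros summable_LIMSEQ) auto
  then have ul: "u \<longlonglongrightarrow> l" by (simp add: sum_lessThan_telescope)
  have ubound: "\<bar>l - u j\<bar> \<le> \<eta> * (T * 2 ^ j) powr - q * (1 / (1 - \<rho>))" for j
  proof (rule LIMSEQ_le_const2)
    show "(\<lambda>n. \<bar>u (n + j) - u j\<bar>) \<longlonglongrightarrow> \<bar>l - u j\<bar>"
      by (intro tendsto_intros LIMSEQ_ignore_initial_segment ul)
    have "\<bar>u (n + j) - u j\<bar> \<le> \<eta> * (T * 2 ^ j) powr - q * (1 / (1 - \<rho>))" for n
    proof -
      have "u (n + j) - u j = (\<Sum>i<n. u (Suc i + j) - u (i + j))"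
        using sum_lessThan_telescope[of "\<lambda>i. u (i + j)" n] by simp
      also have "\<bar>\<dots>\<bar> \<le> (\<Sum>i<n. \<bar>u (Suc i + j) - u (i + j)\<bar>)" by (rule sum_abs)
      also have "\<dots> \<le> (\<Sum>i<n. \<eta> * T powr - q * \<rho> ^ (i + j))"
        using du by (intro sum_mono) simp
      also have "\<dots> = \<eta> * (T * 2 ^ j) powr - q * (\<Sum>i<n. \<rho> ^ i)"
        unfolding pw by (simp add: sum_distrib_left power_add mult_ac)
      also have "\<dots> \<le> \<eta> * (T * 2 ^ j) powr - q * (1 / (1 - \<rho>))"
      proof (rule mult_left_mono)
        have "(\<Sum>i<n. \<rho> ^ i) \<le> (\<Sum>i. \<rho> ^ i)" using \<rho> by (intro sum_le_suminf summable_geometric) auto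
        then show "(\<Sum>i<n. \<rho> ^ i) \<le> 1 / (1 - \<rho>)" using \<rho> by (simp add: suminf_geometric)
      qed (use \<eta> in auto)
      finally show ?thesis .
    qed
    then show "\<exists>N. \<forall>n\<ge>N. \<bar>u (n + j) - u j\<bar> \<le> \<eta> * (T * 2 ^ j) powr - q * (1 / (1 - \<rho>))" by blast
  qed
  show ?thesis
  proof (rule that[of l])
    fix t assume "T \<le> t"
    then obtain j :: nat where j: "T * 2 ^ j \<le> t" "t \<le> T * 2 ^ Suc j" using dyadic_bracket[OF T] by blast
    have "\<bar>l - w t\<bar> \<le> \<bar>l - u j\<bar> + \<bar>w t - u j\<bar>" by simp
    also have "\<dots> \<le> \<eta> * (T * 2 ^ j) powr - q * (1 / (1 - \<rho>)) + \<eta> * (T * 2 ^ j) powr - q"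
      using osc[OF j] unfolding u_def[symmetric] by (intro add_mono ubound) auto
    also have "\<dots> = \<eta> * (1 + 1 / (1 - \<rho>)) * (T * 2 ^ j) powr - q" by (simp add: algebra_simps)
    also have "\<dots> \<le> \<eta> * (1 + 1 / (1 - \<rho>)) * (2 powr q * t powr - q)"
    proof (rule mult_left_mono)
      have "(T * 2 ^ j) powr - q \<le> (t / 2) powr - q"
        using j T q \<open>T \<le> t\<close> by (intro powr_mono2') auto
      also have "\<dots> = 2 powr q * t powr - q"
        using \<open>T \<le> t\<close> T by (simp add: powr_divide powr_minus field_simps)
      finally show "(T * 2 ^ j) powr - q \<le> 2 powr q * t powr - q" .
    qed (use \<eta> \<rho> in auto)
    finally show "\<bar>l - w t\<bar> \<le> 2 powr q * (1 + 1 / (1 - 2 powr - q)) * \<eta> * t powr - q"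
      unfolding \<rho>_def by (simp add: mult_ac)
  qed
qed

text \<open>Subtracting the noise still to come from \<open>- x\<close> gives a differentiable function \<open>Y\<close> with
  \<open>Y' = - f (x) / t powr \<gamma>\<close>. The barrier \<open>\<phi> t = \<kappa> * t powr - q\<close> dominates the noise, and by the
  assumption \<open>barrier\<close> it decreases faster than \<open>Y\<close> wherever the two meet, so \<open>Y\<close> cannot cross it.
  As long as \<open>Y > \<phi>\<close> the path is negative, the drift is nonnegative and \<open>Y\<close> decreases, which also keeps
  \<open>- x\<close> below \<open>r\<close>. A path confined to \<open>[- r, 0]\<close> has a bounded increasing accumulated drift and therefore
  converges.\<close>

lemma path_converges_to_zero:
  fixes f x w :: "real \<Rightarrow> real"
  assumes T: "1 \<le> T" and \<gamma>: "0 < \<gamma>" "\<gamma> \<le> 1" and q: "0 < q" and \<kappa>: "0 < \<kappa>" and \<theta>: "0 < \<theta>" "\<theta> < 1"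
    and f: "continuous_on UNIV f" and fpos: "\<And>y. - r \<le> y \<Longrightarrow> y < 0 \<Longrightarrow> 0 < f y"
    and x: "continuous_on {T..} x" and w: "continuous_on {T..} w"
    and eq: "\<And>t. T \<le> t \<Longrightarrow> x t = x T + integral {T..t} (\<lambda>u. f (x u) / u powr \<gamma>) + (w t - w T)"
    and noise: "\<And>t. T \<le> t \<Longrightarrow> \<bar>wl - w t\<bar> \<le> \<theta> * (\<kappa> * t powr - q)"
    and barrier: "\<And>t y. T \<le> t \<Longrightarrow> 0 < y \<Longrightarrow> y \<le> (1 + \<theta>) * (\<kappa> * t powr - q) \<Longrightarrow>
      f (- y) < q * \<kappa> * t powr (\<gamma> - 1 - q)"
    and start: "(1 + \<theta>) * (\<kappa> * T powr - q) < - x T" "- x T + 2 * \<theta> * (\<kappa> * T powr - q) < r"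
  shows "(x \<longlongrightarrow> 0) at_top"
proof -
  define \<phi> where "\<phi> t = \<kappa> * t powr - q" for t
  define g where "g u = f (x u) / u powr \<gamma>" for u
  define J where "J t = integral {T..t} g" for t
  define Y where "Y t = - x t - (wl - w t)" for t
  have g: "continuous_on {T..} g"
    unfolding g_def using T by (intro continuous_intros continuous_on_compose2[OF f x]) auto
  have gint: "g integrable_on {s..t}" if "T \<le> s" for s t
    by (rule integrable_continuous_interval) (use that in \<open>auto intro: continuous_on_subset[OF g]\<close>)
  have Jadd: "J t = J s + integral {s..t} g" if "T \<le> s" "s \<le> t" for s t
    using Henstock_Kurzweil_Integration.integral_combine[of T s t g] that gint unfolding J_def by auto
  have xJ: "x t = x T + J t + (w t - w T)" if "T \<le> t" for t
    using eq[OF that] unfolding J_def g_def .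
  have YJ: "Y t = Y T - J t" if "T \<le> t" for t
    using xJ[OF that] by (simp add: Y_def)
  have \<phi>pos: "0 < \<phi> t" if "T \<le> t" for t using that T \<kappa> by (simp add: \<phi>_def)
  have \<phi>mono: "\<phi> t \<le> \<phi> T" if "T \<le> t" for t
    using that T \<kappa> q by (auto simp: \<phi>_def intro!: mult_left_mono powr_mono2')
  have R: "\<bar>wl - w t\<bar> \<le> \<theta> * \<phi> t" if "T \<le> t" for t using noise[OF that] by (simp add: \<phi>_def)
  have Jder: "(J has_real_derivative g t) (at t)" if "T < t" for t
  proof -
    have "(J has_real_derivative g t) (at t within {T..t + 1})"
      unfolding J_def using that continuous_on_subset[OF g]
      by (intro integral_has_real_derivative) auto
    moreover have "at t within {T..t + 1} = at t"
      using that by (intro at_within_interior) auto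
    ultimately show ?thesis by simp
  qed
  have stay: "\<phi> t < Y t \<and> - x t < r" if "T \<le> t" for t
  proof (rule ccontr)
    assume fail: "\<not> (\<phi> t < Y t \<and> - x t < r)"
    (* The times at which one of the two bounds fails; its infimum t' is the first of them. *)
    define S where "S = ({T..} \<inter> (\<lambda>t. Y t - \<phi> t) -` {..0}) \<union> ({T..} \<inter> x -` {..- r})"
    have contY: "continuous_on {T..} (\<lambda>t. Y t - \<phi> t)"
      unfolding Y_def \<phi>_def using T by (intro continuous_intros x w) auto
    have "closed S"
      unfolding S_def by (intro closed_Un continuous_closed_preimage contY x) auto
    moreover have "S \<noteq> {}" using fail that by (auto simp: S_def not_less)
    moreover have bdd: "bdd_below S" by (rule bdd_belowI[of _ T]) (auto simp: S_def)
    ultimately have "Inf S \<in> S" by (intro closed_contains_Inf)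
    define t' where "t' = Inf S"
    have t'S: "t' \<in> S" using \<open>Inf S \<in> S\<close> by (simp add: t'_def)
    then have Tt': "T \<le> t'" by (auto simp: S_def)
    have before: "\<phi> s < Y s \<and> - x s < r" if "T \<le> s" "s < t'" for s
    proof -
      have "s \<notin> S" using that cInf_lower[OF _ bdd, of s] by (auto simp: t'_def)
      then show ?thesis using that by (auto simp: S_def not_le)
    qed
    have Y_x: "- x s = Y s + (wl - w s)" for s by (simp add: Y_def)
    have YT: "\<phi> T < Y T" "Y T + \<theta> * \<phi> T < r"
      using R[of T] start Y_x[of T] unfolding \<phi>_def[symmetric] by (auto simp: algebra_simps)
    have gpos: "0 \<le> g s" if "T \<le> s" "s < t'" for s
    proof -
      have "\<theta> * \<phi> s < 1 * \<phi> s" using \<phi>pos[of s] \<theta> that by (intro mult_strict_right_mono) auto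
      then have "0 < - x s" using before[OF that] R[of s] Y_x[of s] that by auto
      then have "0 < f (x s)" using before[OF that] fpos[of "x s"] by auto
      then show ?thesis using T that by (simp add: g_def)
    qed
    (* The sign of g is known before t' only, hence the modification at that one point. *)
    have "0 \<le> J t'"
    proof -
      have "integral {T..t'} (\<lambda>_. 0) \<le> integral {T..t'} (\<lambda>s. if s = t' then 0 else g s)"
      proof (rule integral_le)
        show "(\<lambda>s. if s = t' then 0 else g s) integrable_on {T..t'}"
          by (rule integrable_spike[OF gint[of T t'], of "{t'}"]) auto
      qed (use gpos in auto)
      also have "\<dots> = J t'" unfolding J_def by (rule integral_spike[of "{t'}"]) auto
      finally show ?thesis by simp
    qed
    then have "Y t' \<le> Y T" using YJ[OF Tt'] by simp
    then have "- x t' < r"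
      using Y_x[of t'] R[OF Tt'] YT(2) mult_left_mono[OF \<phi>mono[OF Tt'], of \<theta>] \<theta> by linarith
    then have le: "Y t' \<le> \<phi> t'" using t'S by (auto simp: S_def)
    have lt: "T < t'" using le YT(1) Tt' by (cases "t' = T") auto
    (* Y lies above the barrier before t', so by continuity it has not jumped below it. *)
    have ge: "\<phi> t' \<le> Y t'"
    proof (rule ccontr)
      assume neg: "\<not> \<phi> t' \<le> Y t'"
      then obtain d where "0 < d" and d: "\<And>s. s \<in> {T..} \<Longrightarrow> dist s t' < d \<Longrightarrow>
          dist (Y s - \<phi> s) (Y t' - \<phi> t') < - (Y t' - \<phi> t')"
        using contY Tt' unfolding continuous_on_iff by (metis atLeast_iff diff_gt_0_iff_gt minus_diff_eq not_le)
      define s where "s = max T (t' - d / 2)"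
      have "T \<le> s" "s < t'" "dist s t' < d" using \<open>0 < d\<close> lt by (auto simp: s_def dist_real_def)
      then show False using d[of s] before[of s] by (auto simp: dist_real_def)
    qed
    have Yeq: "Y t' = \<phi> t'" using le ge by simp
    let ?U = "- x t'"
    have U: "0 < ?U" "?U \<le> (1 + \<theta>) * \<phi> t'"
    proof -
      have "\<theta> * \<phi> t' < 1 * \<phi> t'" using \<phi>pos[OF Tt'] \<theta> by (intro mult_strict_right_mono) auto
      then show "0 < ?U" using R[OF Tt'] Y_x[of t'] Yeq by auto
      show "?U \<le> (1 + \<theta>) * \<phi> t'" using R[OF Tt'] Y_x[of t'] Yeq by (auto simp: algebra_simps)
    qed
    have "f (x t') < q * \<kappa> * t' powr (\<gamma> - 1 - q)"
      using barrier[OF Tt' U(1)] U(2) by (simp add: \<phi>_def)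
    then have "g t' < q * \<kappa> * t' powr (\<gamma> - 1 - q) / t' powr \<gamma>"
      unfolding g_def using T Tt' by (intro divide_strict_right_mono) auto
    also have "\<dots> = q * \<kappa> * t' powr (- q - 1)"
      using T Tt' by (simp add: powr_diff powr_minus field_simps powr_add)
    finally have g_lt: "g t' < q * \<kappa> * t' powr (- q - 1)" .
    (* At the contact point Y - \<phi> has positive derivative, so it was negative just before. *)
    have "((\<lambda>t. (Y T - J t) - \<phi> t) has_real_derivative (- g t' - \<kappa> * (- q * t' powr (- q - 1)))) (at t')"
      unfolding \<phi>_def using lt T by (auto intro!: derivative_eq_intros Jder)
    moreover have "0 < - g t' - \<kappa> * (- q * t' powr (- q - 1))"
      using g_lt by (simp add: mult_ac)
    ultimately obtain d where d: "0 < d" "\<And>h. 0 < h \<Longrightarrow> h < d \<Longrightarrow>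
        (Y T - J (t' - h)) - \<phi> (t' - h) < (Y T - J t') - \<phi> t'"
      by (blast dest: DERIV_pos_inc_left)
    define h where "h = min (d / 2) ((t' - T) / 2)"
    have "h \<le> (t' - T) / 2" unfolding h_def by (rule min.cobounded2)
    moreover have "0 < h" "h < d" using d(1) lt by (simp_all add: h_def min_less_iff_disj)
    ultimately have h: "0 < h" "h < d" "T \<le> t' - h" using lt by auto
    have "Y (t' - h) - \<phi> (t' - h) < 0"
      using d(2)[OF h(1,2)] YJ[OF h(3)] YJ[OF Tt'] Yeq by simp
    then show False using before[OF h(3)] h by auto
  qed
  have xrange: "- r < x t \<and> x t < 0" if "T \<le> t" for t
  proof -
    have "\<theta> * \<phi> t < 1 * \<phi> t" using \<phi>pos[OF that] \<theta> by (intro mult_strict_right_mono) auto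
    then show ?thesis using stay[OF that] R[OF that] by (auto simp: Y_def)
  qed
  have g0: "0 \<le> g t" if "T \<le> t" for t
    using xrange[OF that] fpos[of "x t"] that T by (auto simp: g_def intro!: divide_nonneg_nonneg less_imp_le)
  have Jmono: "J s \<le> J t" if "T \<le> s" "s \<le> t" for s t
    using Jadd[OF that] that g0 integral_nonneg[OF gint[of s t]] by auto
  have \<phi>0: "(\<phi> \<longlongrightarrow> 0) at_top"
    unfolding \<phi>_def using q by (intro tendsto_mult_right_zero tendsto_neg_powr filterlim_ident) auto
  have wlim: "(w \<longlongrightarrow> wl) at_top"
  proof -
    have "((\<lambda>t. wl - w t) \<longlongrightarrow> 0) at_top"
    proof (rule Lim_null_comparison)
      show "\<forall>\<^sub>F t in at_top. norm (wl - w t) \<le> \<theta> * \<phi> t"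
        using eventually_ge_at_top[of T] by eventually_elim (use R in auto)
      show "((\<lambda>t. \<theta> * \<phi> t) \<longlongrightarrow> 0) at_top" by (rule tendsto_mult_right_zero[OF \<phi>0])
    qed
    from tendsto_diff[OF tendsto_const[of wl] this] show ?thesis by simp
  qed
  have Jbound: "J t \<le> Y T" if "T \<le> t" for t
    using YJ[OF that] stay[OF that] \<phi>pos[OF that] by simp
  define l where "l = (SUP t\<in>{T..}. J t)"
  have bddJ: "bdd_above (J ` {T..})" using Jbound by (intro bdd_aboveI[of _ "Y T"]) auto
  have Jlim: "(J \<longlongrightarrow> l) at_top"
  proof (rule increasing_tendsto)
    show "\<forall>\<^sub>F t in at_top. J t \<le> l"
      using eventually_ge_at_top[of T] by eventually_elim (auto simp: l_def intro!: cSUP_upper bddJ)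
    fix y assume "y < l"
    then obtain s where s: "T \<le> s" "y < J s"
      unfolding l_def using less_cSUP_iff[OF _ bddJ] by auto
    show "\<forall>\<^sub>F t in at_top. y < J t"
      using eventually_ge_at_top[of s] by eventually_elim (use s Jmono[of s] in force)
  qed
  define X where "X = x T + l + (wl - w T)"
  have "((\<lambda>t. x T + J t + (w t - w T)) \<longlongrightarrow> X) at_top"
    unfolding X_def by (intro tendsto_intros Jlim wlim)
  moreover have "\<forall>\<^sub>F t in at_top. x T + J t + (w t - w T) = x t"
    using eventually_ge_at_top[of T] by eventually_elim (rule xJ[symmetric])
  ultimately have xlim: "(x \<longlongrightarrow> X) at_top"
    by (rule Lim_transform_eventually)
  have "X \<le> 0"
  proof (rule tendsto_upperbound[OF xlim])
    show "\<forall>\<^sub>F t in at_top. x t \<le> 0"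
      using eventually_ge_at_top[of T] by eventually_elim (use xrange in \<open>simp add: less_imp_le\<close>)
  qed simp
  have "- r \<le> X"
  proof (rule tendsto_lowerbound[OF xlim])
    show "\<forall>\<^sub>F t in at_top. - r \<le> x t"
      using eventually_ge_at_top[of T] by eventually_elim (use xrange in \<open>simp add: less_imp_le\<close>)
  qed simp
  have "X = 0"
  proof (rule ccontr)
    assume "X \<noteq> 0"
    then have fX: "0 < f X" using \<open>X \<le> 0\<close> \<open>- r \<le> X\<close> fpos by auto
    have "((\<lambda>t. f (x t)) \<longlongrightarrow> f X) at_top"
      using f by (intro isCont_tendsto_compose[OF _ xlim]) (auto simp: continuous_on_eq_continuous_at)
    then have "\<forall>\<^sub>F t in at_top. f X / 2 < f (x t)"
      by (rule order_tendstoD) (use fX in auto)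
    then obtain t0 where t0: "\<And>t. t0 \<le> t \<Longrightarrow> f X / 2 < f (x t)"
      by (auto simp: eventually_at_top_linorder)
    (* On the interval from t to 2 t the drift is at least f X / (4 t), because u powr \<gamma> \<le> u \<le> 2 t. *)
    have inc: "J t + f X / 4 \<le> J (2 * t)" if t: "t0 \<le> t" "T \<le> t" for t
    proof -
      have "integral {t..2 * t} (\<lambda>_. f X / (4 * t)) \<le> integral {t..2 * t} g"
      proof (rule integral_le[OF _ gint[OF t(2)]])
        fix u assume u: "u \<in> {t..2 * t}"
        have "f X / (4 * t) = (f X / 2) / (2 * t)" by simp
        also have "\<dots> \<le> (f X / 2) / (u powr \<gamma>)"
        proof (rule divide_left_mono)
          have "u powr \<gamma> \<le> u powr 1" using u t T \<gamma> by (intro powr_mono) auto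
          then show "u powr \<gamma> \<le> 2 * t" using u t T by simp
        qed (use fX u t T in auto)
        also have "\<dots> \<le> g u"
          unfolding g_def using t0[of u] u t T by (intro divide_right_mono) auto
        finally show "f X / (4 * t) \<le> g u" .
      qed auto
      then show ?thesis using Jadd[of t "2 * t"] t T by simp
    qed
    have "\<forall>\<^sub>F t in at_top. l - f X / 8 < J t"
      by (rule order_tendstoD[OF Jlim]) (use fX in auto)
    then obtain t1 where t1: "\<And>t. t1 \<le> t \<Longrightarrow> l - f X / 8 < J t"
      by (auto simp: eventually_at_top_linorder)
    define t where "t = max t1 (max t0 T)"
    have "J (2 * t) \<le> l" unfolding l_def using T by (intro cSUP_upper bddJ) (auto simp: t_def)
    moreover have "t1 \<le> t" "t0 \<le> t" "T \<le> t" by (simp_all add: t_def)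
    ultimately show False using inc[of t] t1[of t] fX by linarith
  qed
  then show ?thesis using xlim by simp
qed

section \<open>Every interval is reached with positive probability\<close>

lemma std_normal_positive_near:
  fixes sg :: real
  assumes sg: "sg = 1 \<or> sg = - 1"
  shows "std_normal_density 2 \<le> measure std_normal_distribution {y. 1 < sg * y \<and> sg * y < 2}"
proof -
  interpret N: real_distribution std_normal_distribution by (rule real_dist_normal_dist)
  let ?C = "{y. 1 < sg * y \<and> sg * y < 2}"
  have C: "?C = {1<..<2} \<or> ?C = {- 2<..< - 1}" using sg by auto
  then have C1: "emeasure lborel ?C = 1" by auto
  have [measurable]: "?C \<in> sets borel" using C by auto
  have "ennreal (std_normal_density 2) = (\<integral>\<^sup>+y. ennreal (std_normal_density 2) * indicator ?C y \<partial>lborel)"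
    using C1 by (subst nn_integral_cmult) auto
  also have "\<dots> \<le> (\<integral>\<^sup>+y. ennreal (std_normal_density y) * indicator ?C y \<partial>lborel)"
  proof (intro nn_integral_mono)
    fix y :: real
    have "std_normal_density 2 \<le> std_normal_density y" if "y \<in> ?C"
    proof -
      have "\<bar>y\<bar> \<le> 2" using that sg by auto
      then have "y\<^sup>2 \<le> 2\<^sup>2" by (metis abs_ge_zero power2_abs power_mono)
      then show ?thesis unfolding std_normal_density_def by (intro mult_left_mono) auto
    qed
    then show "ennreal (std_normal_density 2) * indicator ?C y \<le> ennreal (std_normal_density y) * indicator ?C y"
      by (auto split: split_indicator intro: ennreal_leI)
  qed
  also have "\<dots> = emeasure std_normal_distribution ?C"
    by (subst emeasure_density) auto
  finally show ?thesis by (simp add: N.emeasure_eq_measure)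
qed

text \<open>A solution of the equation, with the stochastic integral replaced by a continuous process \<open>W\<close> such that
  the integral equation holds on every path and at all times simultaneously.\<close>

locale noisy_flow = gaussian_noise M F W v \<gamma>
  for M :: "'a measure" and F and W and v and \<gamma> :: real +
  fixes L :: "real \<Rightarrow> 'a \<Rightarrow> real" and f :: "real \<Rightarrow> real" and K :: real
  assumes gamma: "1 / 2 < \<gamma>" "\<gamma> \<le> 1"
    and f_lipschitz: "K-lipschitz_on UNIV f"
    and f_zero: "f 0 = 0"
    and L_adapted: "1 \<le> t \<Longrightarrow> L t \<in> borel_measurable (F t)"
    and L_continuous: "\<omega> \<in> space M \<Longrightarrow> continuous_on {1..} (\<lambda>t. L t \<omega>)"
    and L_eq: "\<omega> \<in> space M \<Longrightarrow> 1 \<le> s \<Longrightarrow> s \<le> t \<Longrightarrow>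
      L t \<omega> = L s \<omega> + integral {s..t} (\<lambda>r. f (L r \<omega>) / r powr \<gamma>) + (W t \<omega> - W s \<omega>)"
begin

lemma K_nonneg: "0 \<le> K"
  using lipschitz_on_nonneg[OF f_lipschitz] .

lemma L_measurable [measurable]: "1 \<le> t \<Longrightarrow> L t \<in> borel_measurable M"
  using measurable_from_subalg[OF subalgebra_F L_adapted] by blast

lemma f_linear_growth: "\<bar>f y\<bar> \<le> K * \<bar>y\<bar>"
  using lipschitz_onD[OF f_lipschitz, of y 0] by (simp add: f_zero dist_real_def)

lemma drift_continuous: "\<omega> \<in> space M \<Longrightarrow> continuous_on {1..} (\<lambda>r. f (L r \<omega>) / r powr \<gamma>)"
  using continuous_on_compose2[OF lipschitz_on_continuous_on[OF f_lipschitz] L_continuous]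
  by (intro continuous_intros) auto

lemma drift_bound:
  assumes \<omega>: "\<omega> \<in> space M" and st: "1 \<le> s" "s \<le> t" and S: "\<And>r. s \<le> r \<Longrightarrow> r \<le> t \<Longrightarrow> \<bar>L r \<omega>\<bar> \<le> S"
  shows "\<bar>integral {s..t} (\<lambda>r. f (L r \<omega>) / r powr \<gamma>)\<bar> \<le> K * S * (t - s)"
proof -
  have "norm (integral {s..t} (\<lambda>r. f (L r \<omega>) / r powr \<gamma>)) \<le> K * S * (t - s)"
  proof (rule integral_bound)
    show "continuous_on {s..t} (\<lambda>r. f (L r \<omega>) / r powr \<gamma>)"
      using st by (intro continuous_on_subset[OF drift_continuous[OF \<omega>]]) auto
    fix r assume r: "r \<in> {s..t}"
    have "1 \<le> r powr \<gamma>" using r st gamma by (intro ge_one_powr_ge_zero) auto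
    then have "\<bar>f (L r \<omega>)\<bar> / r powr \<gamma> \<le> \<bar>f (L r \<omega>)\<bar> / 1" by (intro divide_left_mono) auto
    also have "\<dots> \<le> K * S"
      using f_linear_growth[of "L r \<omega>"] mult_left_mono[OF S[of r] K_nonneg] r by auto
    finally show "norm (f (L r \<omega>) / r powr \<gamma>) \<le> K * S" by simp
  qed (use st in auto)
  then show ?thesis by simp
qed

text \<open>If \<open>S\<close> is the maximum of \<open>\<bar>L\<bar>\<close> on the interval, then linear growth of \<open>f\<close> gives
  \<open>S \<le> R + 1 + K * (t - s) * S\<close>, and \<open>K * (t - s) \<le> 1/2\<close> allows \<open>S\<close> to be absorbed.\<close>

lemma short_time_drift:
  assumes \<omega>: "\<omega> \<in> space M" and st: "1 \<le> s" "s \<le> t" and h: "K * (t - s) \<le> 1 / 2"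
    and W: "\<And>r. s \<le> r \<Longrightarrow> r \<le> t \<Longrightarrow> \<bar>W r \<omega> - W s \<omega>\<bar> \<le> 1" and R: "\<bar>L s \<omega>\<bar> \<le> R"
  shows "\<bar>integral {s..t} (\<lambda>r. f (L r \<omega>) / r powr \<gamma>)\<bar> \<le> 2 * K * (R + 1) * (t - s)"
proof -
  have "continuous_on {s..t} (\<lambda>r. \<bar>L r \<omega>\<bar>)"
    using st by (intro continuous_intros continuous_on_subset[OF L_continuous[OF \<omega>]]) auto
  then obtain r0 where r0: "r0 \<in> {s..t}" "\<And>r. r \<in> {s..t} \<Longrightarrow> \<bar>L r \<omega>\<bar> \<le> \<bar>L r0 \<omega>\<bar>"
    using continuous_attains_sup[of "{s..t}" "\<lambda>r. \<bar>L r \<omega>\<bar>"] st by auto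
  let ?S = "\<bar>L r0 \<omega>\<bar>"
  have "\<bar>integral {s..r0} (\<lambda>r. f (L r \<omega>) / r powr \<gamma>)\<bar> \<le> K * ?S * (r0 - s)"
    using r0 st by (intro drift_bound[OF \<omega>]) auto
  also have "\<dots> \<le> K * ?S * (t - s)" using r0 K_nonneg by (intro mult_left_mono) auto
  also have "\<dots> = (K * (t - s)) * ?S" by simp
  also have "\<dots> \<le> 1 / 2 * ?S" using h by (intro mult_right_mono) auto
  finally have I: "\<bar>integral {s..r0} (\<lambda>r. f (L r \<omega>) / r powr \<gamma>)\<bar> \<le> 1 / 2 * ?S" .
  have "L r0 \<omega> = L s \<omega> + integral {s..r0} (\<lambda>r. f (L r \<omega>) / r powr \<gamma>) + (W r0 \<omega> - W s \<omega>)"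
    using r0 st by (intro L_eq[OF \<omega>]) auto
  moreover have "\<bar>W r0 \<omega> - W s \<omega>\<bar> \<le> 1" using r0 by (intro W) auto
  ultimately have "?S \<le> R + ?S / 2 + 1" using I R by linarith
  then have S: "?S \<le> 2 * (R + 1)" by simp
  have "\<bar>integral {s..t} (\<lambda>r. f (L r \<omega>) / r powr \<gamma>)\<bar> \<le> K * (2 * (R + 1)) * (t - s)"
    using r0 S by (intro drift_bound[OF \<omega> st]) force
  then show ?thesis by (simp add: mult_ac)
qed

text \<open>Over a short time \<open>h\<close> the noise has size of order \<open>sqrt h\<close>, while the drift and the displacement of the
  target are of order \<open>h\<close>. Starting in one half of the interval around \<open>a\<close>, an increment of the noise
  between one and two standard deviations towards the other half beats the drift without leaving the
  interval around \<open>a'\<close>. Its probability does not depend on \<open>h\<close>, whereas the probability that the noise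
  oscillates by more than \<open>\<epsilon>\<close> in the meantime, which would spoil the bound on the drift, tends to \<open>0\<close>
  with \<open>h\<close>.\<close>

lemma steering_step:
  assumes T: "1 \<le> T" and \<epsilon>: "0 < \<epsilon>" "\<epsilon> \<le> 1" and R: "0 \<le> R" and m: "0 \<le> m"
  obtains h0 where "0 < h0" "\<And>s h a a'. 1 \<le> s \<Longrightarrow> 0 < h \<Longrightarrow> h \<le> h0 \<Longrightarrow> s + h \<le> T \<Longrightarrow> \<bar>a\<bar> \<le> R \<Longrightarrow>
    \<bar>a - a'\<bar> \<le> m * h \<Longrightarrow> 0 < prob {\<omega> \<in> space M. \<bar>L s \<omega> - a\<bar> < \<epsilon>} \<Longrightarrow>
    0 < prob {\<omega> \<in> space M. \<bar>L (s + h) \<omega> - a'\<bar> < \<epsilon>}"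
proof -
  define p0 where "p0 = std_normal_density 2"
  have p0: "0 < p0" unfolding p0_def by (rule normal_density_pos) simp
  interpret N: real_distribution std_normal_distribution by (rule real_dist_normal_dist)
  have p0_1: "p0 \<le> 1" using order_trans[OF std_normal_positive_near[of 1] N.prob_le_1] by (simp add: p0_def)
  define D where "D = m + 2 * K * (R + 2)"
  have D: "0 \<le> D" using m K_nonneg R by (simp add: D_def)
  (* The four bounds give, in this order: the a priori bound on the drift, a drift below one standard
     deviation, three standard deviations below \<epsilon>, and an oscillation less likely than the increment. *)
  define h0 where "h0 = min (min (1 / (2 * (K + 1))) (1 / (T\<^sup>2 * (D + 1)\<^sup>2))) (min (\<epsilon>\<^sup>2 / 9) (p0 * \<epsilon>\<^sup>2 / 16))"
  show ?thesis
  proof (rule that[of h0])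
    show "0 < h0" unfolding h0_def using K_nonneg D T \<epsilon> p0 by auto
    fix s h a a' :: real
    assume s: "1 \<le> s" and h: "0 < h" "h \<le> h0" and sT: "s + h \<le> T" and aR: "\<bar>a\<bar> \<le> R" and aa: "\<bar>a - a'\<bar> \<le> m * h"
      and pos: "0 < prob {\<omega> \<in> space M. \<bar>L s \<omega> - a\<bar> < \<epsilon>}"
    have h1: "h \<le> 1 / (2 * (K + 1))" and h2: "h \<le> 1 / (T\<^sup>2 * (D + 1)\<^sup>2)" and h3: "h \<le> \<epsilon>\<^sup>2 / 9" and h4: "h \<le> p0 * \<epsilon>\<^sup>2 / 16"
      using h(2) by (auto simp: h0_def)
    have Kh: "K * h \<le> 1 / 2"
    proof -
      have "K * h \<le> (K + 1) * (1 / (2 * (K + 1)))" using h1 h(1) K_nonneg by (intro mult_mono) auto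
      also have "\<dots> = 1 / 2"
      proof -
        have "k * (1 / (2 * k)) = 1 / 2" if "k \<noteq> 0" for k :: real using that by simp
        from this[of "K + 1"] show ?thesis using K_nonneg by linarith
      qed
      finally show ?thesis .
    qed
    have st: "s < s + h" using h by simp
    let ?v = "v s (s + h)" and ?W = "\<lambda>\<omega>. W (s + h) \<omega> - W s \<omega>"
    have v0: "0 < ?v" using v_pos[OF s st] .
    have vh: "?v \<le> h"
    proof -
      have "s powr (- 2 * \<gamma>) \<le> s powr 0" using s gamma by (intro powr_mono) auto
      then have "h * s powr (- 2 * \<gamma>) \<le> h * 1" using h s by (intro mult_left_mono) auto
      then show ?thesis using v_upper[OF s st] by simp
    qed
    have dv: "D * h \<le> sqrt ?v"
    proof (rule real_le_rsqrt)
      have "D\<^sup>2 * h \<le> (D + 1)\<^sup>2 * (1 / (T\<^sup>2 * (D + 1)\<^sup>2))"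
        using D h2 h(1) by (intro mult_mono power_mono) auto
      also have "\<dots> = 1 / T\<^sup>2" using D by simp
      finally have "(D * h)\<^sup>2 \<le> h * (1 / T\<^sup>2)"
        using h(1) mult_left_mono[of "D\<^sup>2 * h" "1 / T\<^sup>2" h] by (simp add: power2_eq_square mult_ac)
      also have "1 / T\<^sup>2 = T powr (- 2)" using T by (simp add: powr_minus divide_inverse)
      also have "T powr (- 2) \<le> (s + h) powr (- 2)" using sT s h by (intro powr_mono2') auto
      also have "(s + h) powr (- 2) \<le> (s + h) powr (- 2 * \<gamma>)" using s h gamma by (intro powr_mono) auto
      also have "h * (s + h) powr (- 2 * \<gamma>) \<le> ?v" using v_lower[OF s st] by simp
      finally show "(D * h)\<^sup>2 \<le> ?v" using h by (simp add: mult_left_mono)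
    qed
    have v3: "3 * sqrt ?v \<le> \<epsilon>"
    proof -
      have "?v \<le> (\<epsilon> / 3)\<^sup>2" using vh h3 by (simp add: power_divide)
      then have "sqrt ?v \<le> \<epsilon> / 3" using \<epsilon> by (intro real_le_lsqrt) auto
      then show ?thesis by simp
    qed
    (* The sign sg selects the half of the interval around a that is charged. *)
    define E where "E sg = {\<omega> \<in> space M. 0 \<le> sg * (L s \<omega> - a) \<and> sg * (L s \<omega> - a) < \<epsilon>}" for sg :: real
    have [measurable]: "L s \<in> borel_measurable M" "L (s + h) \<in> borel_measurable M" using s h by auto
    have EM: "E sg \<in> sets M" for sg unfolding E_def by measurable
    have "prob {\<omega> \<in> space M. \<bar>L s \<omega> - a\<bar> < \<epsilon>} \<le> prob (E 1 \<union> E (- 1))"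
      using EM by (intro finite_measure_mono) (auto simp: E_def)
    also have "\<dots> \<le> prob (E 1) + prob (E (- 1))" using EM by (intro measure_Un_le) auto
    finally have "0 < prob (E 1) \<or> 0 < prob (E (- 1))" using pos by linarith
    then obtain sg :: real where sg: "sg = 1 \<or> sg = - 1" and Epos: "0 < prob (E sg)" by blast
    have EF: "E sg \<in> sets (F s)"
    proof -
      have [measurable]: "L s \<in> borel_measurable (F s)" using L_adapted s by auto
      have "{\<omega> \<in> space (F s). 0 \<le> sg * (L s \<omega> - a) \<and> sg * (L s \<omega> - a) < \<epsilon>} \<in> sets (F s)" by measurable
      then show ?thesis by (simp add: E_def space_F)
    qed
    let ?C = "{y. 1 < (- sg) * y \<and> (- sg) * y < 2}"
    let ?G = "E sg \<inter> {\<omega> \<in> space M. ?W \<omega> / sqrt ?v \<in> ?C}"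
    let ?O = "osc s (s + h) (2 * (\<epsilon> / 2))"
    have GM: "?G \<in> sets M"
    proof -
      have [measurable]: "W s \<in> borel_measurable M" "W (s + h) \<in> borel_measurable M" using s h by auto
      show ?thesis using EM[of sg] by measurable
    qed
    have OM: "?O \<in> sets M" by (rule osc_measurable[OF s st])
    have "p0 \<le> measure std_normal_distribution ?C"
      unfolding p0_def using sg by (intro std_normal_positive_near) auto
    then have "prob (E sg) * p0 \<le> prob (E sg) * measure std_normal_distribution ?C"
      by (intro mult_left_mono) auto
    also have "\<dots> = prob ?G" by (rule increment_law[OF s st EF, symmetric]) simp
    finally have pG: "prob (E sg) * p0 \<le> prob ?G" .
    have "?v / (\<epsilon> / 2)\<^sup>2 \<le> (p0 * \<epsilon>\<^sup>2 / 16) / (\<epsilon> / 2)\<^sup>2"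
      using vh h4 by (intro divide_right_mono) auto
    also have "\<dots> = p0 / 4" using \<epsilon> by (simp add: power_divide)
    finally have ratio: "?v / (\<epsilon> / 2)\<^sup>2 \<le> p0 / 4" .
    have "prob (E sg \<inter> ?O) \<le> 2 * prob (E sg) * (?v / (\<epsilon> / 2)\<^sup>2)"
    proof (rule maximal_inequality[OF s st EF])
      show "?v / (\<epsilon> / 2)\<^sup>2 \<le> 1 / 2" using ratio p0_1 by linarith
    qed (use \<epsilon> in simp)
    also have "\<dots> \<le> 2 * prob (E sg) * (p0 / 4)" by (intro mult_left_mono ratio) auto
    also have "\<dots> = prob (E sg) * p0 / 2" by simp
    finally have pO: "prob (E sg \<inter> ?O) \<le> prob (E sg) * p0 / 2" .
    have "?G \<subseteq> {\<omega> \<in> space M. \<bar>L (s + h) \<omega> - a'\<bar> < \<epsilon>} \<union> (E sg \<inter> ?O)"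
    proof
      fix \<omega> assume G: "\<omega> \<in> ?G"
      then have \<omega>: "\<omega> \<in> space M" and E: "0 \<le> sg * (L s \<omega> - a)" "sg * (L s \<omega> - a) < \<epsilon>"
        and inc: "1 < (- sg) * (?W \<omega> / sqrt ?v)" "(- sg) * (?W \<omega> / sqrt ?v) < 2" by (auto simp: E_def)
      show "\<omega> \<in> {\<omega> \<in> space M. \<bar>L (s + h) \<omega> - a'\<bar> < \<epsilon>} \<union> (E sg \<inter> ?O)"
      proof (cases "\<omega> \<in> ?O")
        case False
        then have osc1: "\<bar>W r \<omega> - W s \<omega>\<bar> \<le> 1" if "s \<le> r" "r \<le> s + h" for r
          using that \<omega> \<epsilon> by (force simp: osc_def)
        have Ls: "\<bar>L s \<omega>\<bar> \<le> R + 1" using E sg aR \<epsilon> by auto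
        have "\<bar>integral {s..s + h} (\<lambda>r. f (L r \<omega>) / r powr \<gamma>)\<bar> \<le> 2 * K * (R + 1 + 1) * (s + h - s)"
          by (rule short_time_drift[OF \<omega> s _ _ osc1 Ls]) (use h Kh in auto)
        then have dr: "\<bar>integral {s..s + h} (\<lambda>r. f (L r \<omega>) / r powr \<gamma>)\<bar> \<le> 2 * K * (R + 2) * h"
          by (simp add: add.assoc)
        have dr2: "\<bar>(a - a') + integral {s..s + h} (\<lambda>r. f (L r \<omega>) / r powr \<gamma>)\<bar> \<le> sqrt ?v"
        proof -
          have "\<bar>(a - a') + integral {s..s + h} (\<lambda>r. f (L r \<omega>) / r powr \<gamma>)\<bar> \<le> m * h + 2 * K * (R + 2) * h"
            using aa dr by linarith
          also have "\<dots> = D * h" by (simp add: D_def algebra_simps)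
          finally show ?thesis using dv by simp
        qed
        have inc2: "sqrt ?v < - (sg * ?W \<omega>)" "- (sg * ?W \<omega>) < 2 * sqrt ?v"
          using inc v0 by (auto simp: field_simps)
        have "L (s + h) \<omega> - a' = (L s \<omega> - a) + ((a - a') + integral {s..s + h} (\<lambda>r. f (L r \<omega>) / r powr \<gamma>)) + ?W \<omega>"
          using L_eq[OF \<omega> s, of "s + h"] h by simp
        then have "\<bar>L (s + h) \<omega> - a'\<bar> < \<epsilon>"
          using dr2 inc2 v3 E sg by auto
        then show ?thesis using \<omega> by simp
      qed (use G in auto)
    qed
    then have "prob ?G \<le> prob ({\<omega> \<in> space M. \<bar>L (s + h) \<omega> - a'\<bar> < \<epsilon>} \<union> (E sg \<inter> ?O))"
      using EM OM by (intro finite_measure_mono) auto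
    also have "\<dots> \<le> prob {\<omega> \<in> space M. \<bar>L (s + h) \<omega> - a'\<bar> < \<epsilon>} + prob (E sg \<inter> ?O)"
      using EM OM by (intro measure_Un_le) auto
    finally have "prob (E sg) * p0 / 2 \<le> prob {\<omega> \<in> space M. \<bar>L (s + h) \<omega> - a'\<bar> < \<epsilon>}"
      using pG pO by linarith
    moreover have "0 < prob (E sg) * p0 / 2" using Epos p0 by simp
    ultimately show "0 < prob {\<omega> \<in> space M. \<bar>L (s + h) \<omega> - a'\<bar> < \<epsilon>}" by linarith
  qed
qed

text \<open>Countably many intervals of length \<open>2 \<epsilon>\<close> cover the line.\<close>

lemma charges_some_interval:
  assumes X [measurable]: "X \<in> borel_measurable M" and \<epsilon>: "0 < \<epsilon>"
  obtains a :: real where "0 < prob {\<omega> \<in> space M. \<bar>X \<omega> - a\<bar> < \<epsilon>}"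
proof (rule ccontr)
  assume "\<not> thesis"
  then have "prob {\<omega> \<in> space M. \<bar>X \<omega> - a\<bar> < \<epsilon>} = 0" for a
    using that[of a] measure_nonneg[of M "{\<omega> \<in> space M. \<bar>X \<omega> - a\<bar> < \<epsilon>}"] by linarith
  then have "{\<omega> \<in> space M. \<bar>X \<omega> - a\<bar> < \<epsilon>} \<in> null_sets M" for a
    by (intro null_setsI) (auto simp: emeasure_eq_measure)
  then have "(\<Union>i::int. {\<omega> \<in> space M. \<bar>X \<omega> - \<epsilon> * i\<bar> < \<epsilon>}) \<in> null_sets M"
    by (intro null_sets_UN)
  moreover have "(\<Union>i::int. {\<omega> \<in> space M. \<bar>X \<omega> - \<epsilon> * i\<bar> < \<epsilon>}) = space M"
  proof -
    have "\<bar>X \<omega> - \<epsilon> * \<lfloor>X \<omega> / \<epsilon>\<rfloor>\<bar> < \<epsilon>" for \<omega>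
    proof -
      have "X \<omega> - \<epsilon> * \<lfloor>X \<omega> / \<epsilon>\<rfloor> = \<epsilon> * (X \<omega> / \<epsilon> - \<lfloor>X \<omega> / \<epsilon>\<rfloor>)" using \<epsilon> by (simp add: algebra_simps)
      moreover have "0 \<le> X \<omega> / \<epsilon> - \<lfloor>X \<omega> / \<epsilon>\<rfloor>" "X \<omega> / \<epsilon> - \<lfloor>X \<omega> / \<epsilon>\<rfloor> < 1" by linarith+
      ultimately show ?thesis using \<epsilon> by (simp add: abs_mult)
    qed
    then show ?thesis by blast
  qed
  ultimately show False using emeasure_space_1 by (auto simp: null_sets_def)
qed

text \<open>Some interval is charged at time \<open>1\<close>. From its centre \<open>x0\<close> the target moves to \<open>x\<close> along a straight line,
  in steps so short that \<open>steering_step\<close> applies to each.\<close>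

theorem reaches_every_interval:
  assumes T: "1 < T" and \<epsilon>: "0 < \<epsilon>" "\<epsilon> \<le> 1"
  shows "0 < prob {\<omega> \<in> space M. \<bar>L T \<omega> - x\<bar> < \<epsilon>}"
proof -
  have "L 1 \<in> borel_measurable M" by simp
  then obtain x0 where x0: "0 < prob {\<omega> \<in> space M. \<bar>L 1 \<omega> - x0\<bar> < \<epsilon>}"
    using charges_some_interval[OF _ \<epsilon>(1)] by blast
  define m where "m = \<bar>x - x0\<bar> / (T - 1)"
  have T1: "1 \<le> T" using T by simp
  have m0: "0 \<le> m" using T by (simp add: m_def)
  have R0: "0 \<le> \<bar>x0\<bar> + \<bar>x\<bar>" by simp
  obtain h0 where h0: "0 < h0" and step: "\<And>s h a a'. 1 \<le> s \<Longrightarrow> 0 < h \<Longrightarrow> h \<le> h0 \<Longrightarrow> s + h \<le> T \<Longrightarrow> \<bar>a\<bar> \<le> \<bar>x0\<bar> + \<bar>x\<bar> \<Longrightarrow>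
    \<bar>a - a'\<bar> \<le> m * h \<Longrightarrow> 0 < prob {\<omega> \<in> space M. \<bar>L s \<omega> - a\<bar> < \<epsilon>} \<Longrightarrow>
    0 < prob {\<omega> \<in> space M. \<bar>L (s + h) \<omega> - a'\<bar> < \<epsilon>}"
    using steering_step[OF T1 \<epsilon> R0 m0] by blast
  obtain n :: nat where n: "(T - 1) / h0 < n" using reals_Archimedean2 by blast
  then have n0: "0 < real n" using T h0 by (smt (verit) divide_pos_pos)
  define h where "h = (T - 1) / n"
  have h: "0 < h" "h \<le> h0" using n n0 T h0 by (auto simp: h_def field_simps)
  define a where "a i = x0 + (x - x0) * (real i / n)" for i :: nat
  have "0 < prob {\<omega> \<in> space M. \<bar>L (1 + real i * h) \<omega> - a i\<bar> < \<epsilon>}" if "i \<le> n" for i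
    using that
  proof (induction i)
    case 0
    then show ?case using x0 by (simp add: a_def)
  next
    case (Suc i)
    have i: "real i / n \<le> 1" "0 \<le> real i / n" using Suc.prems n0 by auto
    have ai: "a i = (1 - real i / n) * x0 + (real i / n) * x" by (simp add: a_def algebra_simps diff_divide_distrib)
    have "\<bar>a i\<bar> \<le> (1 - real i / n) * \<bar>x0\<bar> + (real i / n) * \<bar>x\<bar>"
      unfolding ai using i by (intro order_trans[OF abs_triangle_ineq]) (simp add: abs_mult)
    also have "\<dots> \<le> 1 * \<bar>x0\<bar> + 1 * \<bar>x\<bar>" using i by (intro add_mono mult_right_mono) auto
    finally have aR: "\<bar>a i\<bar> \<le> \<bar>x0\<bar> + \<bar>x\<bar>" by simp
    have "a (Suc i) - a i = (x - x0) / n" using n0 by (simp add: a_def field_simps)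
    then have am: "\<bar>a i - a (Suc i)\<bar> \<le> m * h"
      using T n0 by (simp add: m_def h_def abs_minus_commute[of "a i"])
    have "real (Suc i) * h \<le> real n * h" using Suc.prems h by (intro mult_right_mono) auto
    moreover have "real n * h = T - 1" using n0 by (simp add: h_def)
    moreover have "real (Suc i) * h = real i * h + h" by (simp add: algebra_simps)
    ultimately have end_T: "1 + real i * h + h \<le> T" by linarith
    have "0 < prob {\<omega> \<in> space M. \<bar>L (1 + real i * h + h) \<omega> - a (Suc i)\<bar> < \<epsilon>}"
      using Suc h by (intro step[OF _ h end_T aR am]) auto
    then show ?case by (simp add: algebra_simps)
  qed
  from this[of n] show ?thesis using n0 by (simp add: h_def a_def)
qed

end

section \<open>Convergence with positive probability\<close>

context noisy_flow begin

text \<open>Convergence is a condition on an uncountable family of random variables. For continuous paths it can be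
  tested at rational times; \<open>max 1\<close> keeps the times in the domain of the process.\<close>

lemma limit_event_measurable: "{\<omega> \<in> space M. ((\<lambda>t. L t \<omega>) \<longlongrightarrow> 0) at_top} \<in> sets M"
proof -
  define L' where "L' k = L (max 1 (real_of_rat k))" for k
  have [measurable]: "L' k \<in> borel_measurable M" for k unfolding L'_def by simp
  have "((\<lambda>t. L t \<omega>) \<longlongrightarrow> 0) at_top \<longleftrightarrow>
      (\<forall>n. \<exists>m::nat. \<forall>k. 1 + real m \<le> real_of_rat k \<longrightarrow> \<bar>L' k \<omega>\<bar> \<le> 1 / Suc n)" (is "?lim \<longleftrightarrow> ?rat")
    if \<omega>: "\<omega> \<in> space M" for \<omega>
  proof
    assume lim: ?lim
    show ?rat
    proof
      fix n
      have "\<forall>\<^sub>F t in at_top. dist (L t \<omega>) 0 < 1 / Suc n" using lim by (rule tendstoD) simp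
      then obtain b where b: "\<And>t. b \<le> t \<Longrightarrow> \<bar>L t \<omega>\<bar> < 1 / Suc n"
        by (auto simp: eventually_at_top_linorder)
      obtain m :: nat where m: "b \<le> real m" using real_arch_simple by blast
      have "\<bar>L' k \<omega>\<bar> \<le> 1 / Suc n" if "1 + real m \<le> real_of_rat k" for k
        using b[of "max 1 (real_of_rat k)"] that m unfolding L'_def by (simp add: less_imp_le)
      then show "\<exists>m::nat. \<forall>k. 1 + real m \<le> real_of_rat k \<longrightarrow> \<bar>L' k \<omega>\<bar> \<le> 1 / Suc n" by blast
    qed
  next
    assume rat: ?rat
    show ?lim
    proof (rule tendstoI)
      fix e :: real assume "0 < e"
      then obtain n where n: "1 / Suc n < e" using nat_approx_posE by blast
      obtain m :: nat where m: "\<And>k. 1 + real m \<le> real_of_rat k \<Longrightarrow> \<bar>L' k \<omega>\<bar> \<le> 1 / Suc n" using rat by blast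
      have "\<bar>L t \<omega>\<bar> < e" if t: "1 + real m \<le> t" for t
      proof (rule ccontr)
        assume "\<not> \<bar>L t \<omega>\<bar> < e"
        then have gap: "0 < \<bar>L t \<omega>\<bar> - 1 / Suc n" using n by simp
        obtain d where d: "0 < d" "\<And>t'. t' \<in> {1..} \<Longrightarrow> dist t' t < d \<Longrightarrow> dist (L t' \<omega>) (L t \<omega>) < \<bar>L t \<omega>\<bar> - 1 / Suc n"
          using L_continuous[OF \<omega>, unfolded continuous_on_iff, rule_format, OF _ gap, of t] t by auto
        obtain k where k: "t < real_of_rat k" "real_of_rat k < t + d"
          using of_rat_dense[of t "t + d"] d(1) by auto
        have k1: "1 \<le> real_of_rat k" using k t by linarith
        have "dist (L (real_of_rat k) \<omega>) (L t \<omega>) < \<bar>L t \<omega>\<bar> - 1 / Suc n"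
        proof (rule d(2))
          show "real_of_rat k \<in> {1..}" using k1 by (simp only: atLeast_iff)
          show "dist (real_of_rat k) t < d" unfolding dist_real_def using k by linarith
        qed
        moreover have "\<bar>L (real_of_rat k) \<omega>\<bar> \<le> 1 / Suc n"
        proof -
          have "1 + real m \<le> real_of_rat k" using k t by linarith
          from m[OF this] show ?thesis unfolding L'_def max_absorb2[OF k1] .
        qed
        ultimately show False by (simp add: dist_real_def)
      qed
      then show "\<forall>\<^sub>F t in at_top. dist (L t \<omega>) 0 < e"
        unfolding eventually_at_top_linorder by (intro exI[of _ "1 + real m"]) simp
    qed
  qed
  then have eq: "{\<omega> \<in> space M. ((\<lambda>t. L t \<omega>) \<longlongrightarrow> 0) at_top} =
      {\<omega> \<in> space M. \<forall>n. \<exists>m::nat. \<forall>k. 1 + real m \<le> real_of_rat k \<longrightarrow> \<bar>L' k \<omega>\<bar> \<le> 1 / Suc n}" by blast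
  show ?thesis unfolding eq by measurable
qed

text \<open>The process is near \<open>- 3 r / 8\<close> at a late time \<open>T\<close> with positive probability, and on at least half of
  this event the noise after \<open>T\<close> satisfies the bounds that \<open>path_converges_to_zero\<close> asks for.\<close>

theorem converges_with_positive_probability:
  assumes r: "0 < r" and fpos: "\<And>y. - r \<le> y \<Longrightarrow> y < 0 \<Longrightarrow> 0 < f y"
    and q: "0 < q" "q < \<gamma> - 1 / 2" and \<kappa>: "0 < \<kappa>" and \<theta>: "0 < \<theta>" "\<theta> < 1"
    and barrier: "\<And>t y. 1 \<le> t \<Longrightarrow> 0 < y \<Longrightarrow> y \<le> r \<Longrightarrow> y \<le> (1 + \<theta>) * (\<kappa> * t powr - q) \<Longrightarrow>
      f (- y) < q * \<kappa> * t powr (\<gamma> - 1 - q)"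
  shows "0 < prob {\<omega> \<in> space M. ((\<lambda>t. L t \<omega>) \<longlongrightarrow> 0) at_top}"
proof -
  define k where "k = 2 powr q * (1 + 1 / (1 - 2 powr - q))"
  have "2 powr - q < (1::real)" using q by (simp add: powr_less_one)
  then have k: "0 < k" by (auto simp: k_def intro!: mult_pos_pos add_pos_pos)
  (* With this amplitude on the dyadic blocks, the remaining noise at time t is at most \<theta> * \<kappa> * t powr - q. *)
  define \<eta> where "\<eta> = \<theta> * \<kappa> / k"
  have \<eta>: "0 < \<eta>" using \<theta> \<kappa> k by (simp add: \<eta>_def)
  obtain T0 where T0: "1 \<le> T0" and tail: "\<And>T A. T0 \<le> T \<Longrightarrow> A \<in> sets (F T) \<Longrightarrow>
    prob (A \<inter> (\<Union>j. osc (T * 2 ^ j) (T * 2 ^ Suc j) (\<eta> * (T * 2 ^ j) powr - q))) \<le> prob A / 2"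
    using dyadic_oscillations_small[OF q \<eta>] by blast
  have "((\<lambda>T::real. \<kappa> * T powr - q) \<longlongrightarrow> 0) at_top"
    using q by (intro tendsto_mult_right_zero tendsto_neg_powr filterlim_ident) auto
  then have "\<forall>\<^sub>F T in at_top. \<kappa> * T powr - q < r / 8" by (rule order_tendstoD) (use r in simp)
  then obtain T1 where T1: "\<And>T. T1 \<le> T \<Longrightarrow> \<kappa> * T powr - q < r / 8"
    by (auto simp: eventually_at_top_linorder)
  define T where "T = max (T0 + 1) T1"
  have T: "T0 \<le> T" "1 < T" "T1 \<le> T" using T0 by (auto simp: T_def)
  let ?\<phi> = "\<lambda>t. \<kappa> * t powr - q"
  have \<phi>T: "?\<phi> T < r / 8" using T1[OF T(3)] .
  have \<phi>small: "(1 + \<theta>) * ?\<phi> t < r / 4" if "T \<le> t" for t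
  proof -
    have "?\<phi> t < r / 8" using T1[of t] that T by simp
    moreover have "(1 + \<theta>) * ?\<phi> t \<le> 2 * ?\<phi> t" using \<theta> \<kappa> by (intro mult_right_mono) auto
    ultimately show ?thesis by simp
  qed
  (* The target interval lies between - r / 2 and - r / 4: beyond the barrier and well inside [- r, 0]. *)
  define \<epsilon> where "\<epsilon> = min 1 (r / 8)"
  define A where "A = {\<omega> \<in> space M. \<bar>L T \<omega> - (- 3 * r / 8)\<bar> < \<epsilon>}"
  let ?O = "\<lambda>j. osc (T * 2 ^ j) (T * 2 ^ Suc j) (\<eta> * (T * 2 ^ j) powr - q)"
  have Apos: "0 < prob A"
    unfolding A_def using T r by (intro reaches_every_interval) (auto simp: \<epsilon>_def)
  have AF: "A \<in> sets (F T)"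
  proof -
    have [measurable]: "L T \<in> borel_measurable (F T)" using T by (intro L_adapted) simp
    have "{\<omega> \<in> space (F T). \<bar>L T \<omega> - (- 3 * r / 8)\<bar> < \<epsilon>} \<in> sets (F T)" by measurable
    then show ?thesis by (simp only: A_def space_F)
  qed
  have AM: "A \<in> sets M" using past_event[OF AF] T by simp
  have t1: "1 \<le> T * 2 ^ j" "T * 2 ^ j < T * 2 ^ Suc j" for j :: nat
  proof -
    have "1 * 1 \<le> T * 2 ^ j" using T by (intro mult_mono) auto
    then show "1 \<le> T * 2 ^ j" by simp
    show "T * 2 ^ j < T * 2 ^ Suc j" using T by simp
  qed
  have OM: "?O j \<in> sets M" for j by (rule osc_measurable[OF t1])
  have UM: "(\<Union>j. ?O j) \<in> sets M" using OM by (intro sets.countable_nat_UN image_subsetI)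
  let ?lim = "{\<omega> \<in> space M. ((\<lambda>t. L t \<omega>) \<longlongrightarrow> 0) at_top}"
  have "A - (\<Union>j. ?O j) \<subseteq> ?lim"
  proof
    fix \<omega> assume \<omega>A: "\<omega> \<in> A - (\<Union>j. ?O j)"
    then have \<omega>: "\<omega> \<in> space M" and LT: "\<bar>L T \<omega> - (- 3 * r / 8)\<bar> < r / 8" by (auto simp: A_def \<epsilon>_def)
    have osc: "\<bar>W t \<omega> - W (T * 2 ^ j) \<omega>\<bar> \<le> \<eta> * (T * 2 ^ j) powr - q"
      if "T * 2 ^ j \<le> t" "t \<le> T * 2 ^ Suc j" for j t
    proof (rule ccontr)
      assume "\<not> ?thesis"
      then have "\<omega> \<in> ?O j" unfolding osc_def using \<omega> that by (auto simp: not_le intro!: bexI[of _ t])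
      then show False using \<omega>A by blast
    qed
    have T0': "0 < T" "0 \<le> \<eta>" using T \<eta> by auto
    obtain w where w: "\<And>t. T \<le> t \<Longrightarrow> \<bar>w - W t \<omega>\<bar> \<le> 2 powr q * (1 + 1 / (1 - 2 powr - q)) * \<eta> * t powr - q"
      using limit_of_dyadic_oscillation[OF T0'(1) q(1) T0'(2) osc] by blast
    have "((\<lambda>t. L t \<omega>) \<longlongrightarrow> 0) at_top"
    proof (rule path_converges_to_zero[where T = T and \<gamma> = \<gamma> and q = q and \<kappa> = \<kappa> and \<theta> = \<theta> and f = f
          and w = "\<lambda>t. W t \<omega>" and wl = w and r = r])
      show "continuous_on UNIV f" using f_lipschitz by (rule lipschitz_on_continuous_on)
      show "continuous_on {T..} (\<lambda>t. L t \<omega>)" "continuous_on {T..} (\<lambda>t. W t \<omega>)"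
        using T by (auto intro: continuous_on_subset[OF L_continuous[OF \<omega>]] continuous_on_subset[OF W_continuous[OF \<omega>]])
      show "L t \<omega> = L T \<omega> + integral {T..t} (\<lambda>u. f (L u \<omega>) / u powr \<gamma>) + (W t \<omega> - W T \<omega>)" if "T \<le> t" for t
        using that T by (intro L_eq[OF \<omega>]) auto
      have "k * \<eta> = \<theta> * \<kappa>" using k by (simp add: \<eta>_def)
      then show "\<bar>w - W t \<omega>\<bar> \<le> \<theta> * (\<kappa> * t powr - q)" if "T \<le> t" for t
        using w[OF that] unfolding k_def[symmetric] by (simp add: mult.assoc)
      show "f (- y) < q * \<kappa> * t powr (\<gamma> - 1 - q)" if "T \<le> t" "0 < y" "y \<le> (1 + \<theta>) * (\<kappa> * t powr - q)" for t y
        using that \<phi>small[OF that(1)] T r by (intro barrier) auto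
      have "r / 4 < - L T \<omega>" "- L T \<omega> < r / 2" using LT by linarith+
      then show "(1 + \<theta>) * (\<kappa> * T powr - q) < - L T \<omega>" using \<phi>small[of T] by simp
      have "2 * \<theta> * (\<kappa> * T powr - q) \<le> 2 * 1 * (\<kappa> * T powr - q)" using \<theta> \<kappa> by (intro mult_right_mono mult_left_mono) auto
      then show "- L T \<omega> + 2 * \<theta> * (\<kappa> * T powr - q) < r" 
        using \<phi>T \<open>- L T \<omega> < r / 2\<close> r by linarith
    qed (use T gamma q \<kappa> \<theta> fpos in auto)
    then show "\<omega> \<in> ?lim" using \<omega> by simp
  qed
  then have "prob (A - (\<Union>j. ?O j)) \<le> prob ?lim"
    using limit_event_measurable by (intro finite_measure_mono) auto
  moreover have "prob (A - (\<Union>j. ?O j)) = prob A - prob (A \<inter> (\<Union>j. ?O j))"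
    using finite_measure_Diff'[OF AM UM] by simp
  ultimately show ?thesis using tail[OF T(1) AF] Apos by linarith
qed

end

section \<open>From the stochastic differential equation to the theorem\<close>

lemma continuous_on_atLeastI:
  fixes h :: "real \<Rightarrow> 'b::metric_space"
  assumes "\<And>b. a \<le> b \<Longrightarrow> continuous_on {a..b} h"
  shows "continuous_on {a..} h"
  unfolding continuous_on_iff
proof (intro ballI allI impI)
  fix x e :: real assume x: "x \<in> {a..}" and e: "0 < e"
  obtain d where d: "0 < d" "\<And>y. y \<in> {a..x + 1} \<Longrightarrow> dist y x < d \<Longrightarrow> dist (h y) (h x) < e"
    using assms[of "x + 1", unfolded continuous_on_iff, rule_format, OF _ _ e, of x] x by auto
  show "\<exists>d>0. \<forall>y\<in>{a..}. dist y x < d \<longrightarrow> dist (h y) (h x) < e"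
    using d by (intro exI[of _ "min d 1"]) (auto simp: dist_real_def)
qed

text \<open>An adapted continuous process is jointly measurable in time and chance up to time \<open>t\<close> with respect to the
  information at \<open>t\<close>: it is the limit of its values at the times \<open>\<lceil>n s\<rceil> / n\<close>. These may exceed
  \<open>t\<close>, so time is clamped to \<open>[a, t]\<close>.\<close>

lemma adapted_integral_measurable:
  fixes X :: "real \<Rightarrow> 'a \<Rightarrow> real" and g :: "real \<Rightarrow> real \<Rightarrow> real"
  assumes X: "\<And>s. a \<le> s \<Longrightarrow> s \<le> t \<Longrightarrow> X s \<in> borel_measurable N"
    and cont: "\<And>\<omega>. \<omega> \<in> space N \<Longrightarrow> continuous_on {a..t} (\<lambda>s. X s \<omega>)"
    and g: "(\<lambda>(s, x). g s x) \<in> borel_measurable (borel \<Otimes>\<^sub>M borel)" and at: "a \<le> t"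
  shows "(\<lambda>\<omega>. LINT s:{a..t}|lborel. g s (X s \<omega>)) \<in> borel_measurable N"
proof -
  define cl where "cl s = max a (min t s)" for s
  have cl: "a \<le> cl s" "cl s \<le> t" for s using at by (auto simp: cl_def)
  have clcont: "isCont cl s" for s unfolding cl_def by (intro continuous_intros)
  have XM: "(\<lambda>(\<omega>, s). X (cl s) \<omega>) \<in> borel_measurable (N \<Otimes>\<^sub>M lborel)"
  proof (rule borel_measurable_LIMSEQ_real)
    fix n :: nat
    have "(\<lambda>p. X (cl (real_of_int \<lceil>real (Suc n) * snd p\<rceil> / Suc n)) (fst p)) \<in> borel_measurable (N \<Otimes>\<^sub>M lborel)"
    proof (rule measurable_compose_countable[where g = "\<lambda>p. \<lceil>real (Suc n) * snd p\<rceil>"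
          and f = "\<lambda>i p. X (cl (real_of_int i / Suc n)) (fst p)"])
      show "(\<lambda>p. X (cl (real_of_int i / Suc n)) (fst p)) \<in> borel_measurable (N \<Otimes>\<^sub>M lborel)" for i
        by (rule measurable_compose[OF measurable_fst X[OF cl]])
      show "(\<lambda>p. \<lceil>real (Suc n) * snd p\<rceil>) \<in> N \<Otimes>\<^sub>M lborel \<rightarrow>\<^sub>M count_space UNIV"
        by measurable
    qed
    then show "(\<lambda>p. case p of (\<omega>, s) \<Rightarrow> X (cl (real_of_int \<lceil>real (Suc n) * s\<rceil> / Suc n)) \<omega>) \<in> borel_measurable (N \<Otimes>\<^sub>M lborel)"
      by (simp add: split_def)
  next
    fix p assume "p \<in> space (N \<Otimes>\<^sub>M (lborel :: real measure))"
    then obtain \<omega> s where p: "p = (\<omega>, s)" and \<omega>: "\<omega> \<in> space N" by (auto simp: space_pair_measure)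
    have "(\<lambda>n. real_of_int \<lceil>real (Suc n) * s\<rceil> / Suc n - s) \<longlonglongrightarrow> 0"
    proof (rule Lim_null_comparison)
      show "(\<lambda>n. inverse (real (Suc n))) \<longlonglongrightarrow> 0" by (rule LIMSEQ_inverse_real_of_nat)
      show "\<forall>\<^sub>F n in sequentially. norm (real_of_int \<lceil>real (Suc n) * s\<rceil> / Suc n - s) \<le> inverse (real (Suc n))"
      proof (rule always_eventually, rule allI)
        fix n
        have "real_of_int \<lceil>real (Suc n) * s\<rceil> / Suc n - s = (real_of_int \<lceil>real (Suc n) * s\<rceil> - real (Suc n) * s) / Suc n"
          by (simp add: diff_divide_distrib)
        moreover have "\<bar>real_of_int \<lceil>real (Suc n) * s\<rceil> - real (Suc n) * s\<bar> \<le> 1" by linarith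
        then have "\<bar>real_of_int \<lceil>real (Suc n) * s\<rceil> - real (Suc n) * s\<bar> / Suc n \<le> 1 / Suc n"
          by (rule divide_right_mono) simp
        ultimately show "norm (real_of_int \<lceil>real (Suc n) * s\<rceil> / Suc n - s) \<le> inverse (real (Suc n))"
          by (simp add: abs_divide inverse_eq_divide)
      qed
    qed
    then have "(\<lambda>n. real_of_int \<lceil>real (Suc n) * s\<rceil> / Suc n) \<longlonglongrightarrow> s" by (simp only: LIM_zero_iff)
    then have "(\<lambda>n. cl (real_of_int \<lceil>real (Suc n) * s\<rceil> / Suc n)) \<longlonglongrightarrow> cl s"
      by (rule isCont_tendsto_compose[OF clcont])
    then have "(\<lambda>n. X (cl (real_of_int \<lceil>real (Suc n) * s\<rceil> / Suc n)) \<omega>) \<longlonglongrightarrow> X (cl s) \<omega>"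
      by (rule continuous_on_tendsto_compose[OF cont[OF \<omega>]]) (auto simp: cl)
    then show "(\<lambda>n. case p of (\<omega>, s) \<Rightarrow> X (cl (real_of_int \<lceil>real (Suc n) * s\<rceil> / Suc n)) \<omega>) \<longlonglongrightarrow>
        (case p of (\<omega>, s) \<Rightarrow> X (cl s) \<omega>)" by (simp add: p)
  qed
  have X2: "(\<lambda>p. X (cl (snd p)) (fst p)) \<in> borel_measurable (N \<Otimes>\<^sub>M lborel)"
    using XM by (simp add: split_def)
  have "(\<lambda>p. (snd p, X (cl (snd p)) (fst p))) \<in> N \<Otimes>\<^sub>M lborel \<rightarrow>\<^sub>M borel \<Otimes>\<^sub>M borel"
    by (intro measurable_Pair X2) simp
  from measurable_compose[OF this g]
  have gM: "(\<lambda>p. g (snd p) (X (cl (snd p)) (fst p))) \<in> borel_measurable (N \<Otimes>\<^sub>M lborel)"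
    by simp
  have "(\<lambda>\<omega>. \<integral>s. indicator {a..t} s *\<^sub>R g s (X (cl s) \<omega>) \<partial>lborel) \<in> borel_measurable N"
  proof (rule lborel.borel_measurable_lebesgue_integral)
    have "(\<lambda>p. indicator {a..t} (snd p) *\<^sub>R g (snd p) (X (cl (snd p)) (fst p))) \<in> borel_measurable (N \<Otimes>\<^sub>M lborel)"
      using gM by (intro borel_measurable_scaleR) auto
    then show "(\<lambda>(\<omega>, s). indicator {a..t} s *\<^sub>R g s (X (cl s) \<omega>)) \<in> borel_measurable (N \<Otimes>\<^sub>M lborel)"
      by (simp add: split_def)
  qed
  moreover have eq: "indicator {a..t} s *\<^sub>R g s (X (cl s) \<omega>) = indicator {a..t} s *\<^sub>R g s (X s \<omega>)" for s \<omega>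
    by (auto simp: cl_def max_def min_def split: split_indicator)
  ultimately show ?thesis unfolding set_lebesgue_integral_def eq by blast
qed

lemma lipschitz_on_inverse_powr:
  fixes \<gamma> :: real
  assumes "0 \<le> \<gamma>" "\<gamma> \<le> 1"
  shows "1-lipschitz_on {1..t} (\<lambda>r. 1 / r powr \<gamma>)"
proof (rule lipschitz_onI)
  fix x y :: real assume xy: "x \<in> {1..t}" "y \<in> {1..t}"
  have "norm ((1 / x powr \<gamma>) - (1 / y powr \<gamma>)) \<le> 1 * norm (x - y)"
  proof (rule field_differentiable_bound[of "{1..t}" "\<lambda>r. 1 / r powr \<gamma>" "\<lambda>r. - \<gamma> * r powr (- \<gamma> - 1)"])
    fix z assume z: "z \<in> {1..t}"
    have "((\<lambda>r. r powr - \<gamma>) has_real_derivative - \<gamma> * z powr (- \<gamma> - 1)) (at z within {1..t})"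
      using z by (intro has_real_derivative_powr[THEN has_field_derivative_at_within]) simp
    then show "((\<lambda>r. 1 / r powr \<gamma>) has_real_derivative - \<gamma> * z powr (- \<gamma> - 1)) (at z within {1..t})"
      by (simp add: powr_minus_divide)
    have "z powr (- \<gamma> - 1) \<le> z powr 0" using z assms by (intro powr_mono) auto
    then have "\<gamma> * z powr (- \<gamma> - 1) \<le> 1 * 1" using z assms by (intro mult_mono) auto
    then show "norm (- \<gamma> * z powr (- \<gamma> - 1)) \<le> 1" using assms by (simp add: abs_mult)
  qed (use xy in auto)
  then show "dist (1 / x powr \<gamma>) (1 / y powr \<gamma>) \<le> 1 * dist x y" by (simp add: dist_norm)
qed simp

text \<open>Solving the integral equation for the noise defines \<open>W\<close> on every path, continuous and adapted, whereas
  the Ito integrals exist for each time separately and up to null sets. At each fixed time \<open>W\<close> agrees almost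
  surely with the Ito integral, so its increments obey the same product formula.\<close>

lemma sde_noisy_flow:
  fixes M :: "'a measure" and f :: "real \<Rightarrow> real"
  assumes bm: "brownian_motion M F B" and \<gamma>: "1/2 < \<gamma>" "\<gamma> \<le> 1"
    and f: "K-lipschitz_on UNIV f" "f 0 = 0"
    and sde: "additive_sde_solution M F B 1 (\<lambda>t x. f x / t powr \<gamma>) (\<lambda>t. 1 / t powr \<gamma>) L"
  shows "noisy_flow M F (\<lambda>t \<omega>. L t \<omega> - L 1 \<omega> - integral {1..t} (\<lambda>r. f (L r \<omega>) / r powr \<gamma>))
    (\<lambda>s t. integral {s..t} (\<lambda>r. (1 / r powr \<gamma>)\<^sup>2)) \<gamma> L f K"
proof -
  interpret brownian_motion M F B by (rule bm)
  define W where "W t \<omega> = L t \<omega> - L 1 \<omega> - integral {1..t} (\<lambda>r. f (L r \<omega>) / r powr \<gamma>)" for t \<omega>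
  define v where "v s t = integral {s..t} (\<lambda>r. (1 / r powr \<gamma>)\<^sup>2)" for s t
  have LF: "L t \<in> borel_measurable (F t)" if "1 \<le> t" for t
    using sde that by (simp add: additive_sde_solution_def)
  have Lc: "continuous_on {1..} (\<lambda>t. L t \<omega>)" if "\<omega> \<in> space M" for \<omega>
    using sde that by (simp add: additive_sde_solution_def)
  have fc: "continuous_on UNIV f" using f(1) by (rule lipschitz_on_continuous_on)
  have gc: "continuous_on {1..} (\<lambda>r. f (L r \<omega>) / r powr \<gamma>)" if "\<omega> \<in> space M" for \<omega>
    using continuous_on_compose2[OF fc Lc[OF that]] by (intro continuous_intros) auto
  have gc2: "continuous_on {s..t} (\<lambda>r. f (L r \<omega>) / r powr \<gamma>)" if "\<omega> \<in> space M" "1 \<le> s" for \<omega> s t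
    using that by (intro continuous_on_subset[OF gc[OF that(1)]]) auto
  have LINT: "(LINT r:{1..t}|lborel. f (L r \<omega>) / r powr \<gamma>) = integral {1..t} (\<lambda>r. f (L r \<omega>) / r powr \<gamma>)"
    if "\<omega> \<in> space M" for t \<omega>
    using borel_integrable_atLeastAtMost'[OF gc2[OF that, of 1 t]] by (intro set_borel_integral_eq_integral(2)) auto
  have WF: "W t \<in> borel_measurable (F t)" if t: "1 \<le> t" for t
  proof -
    have "(\<lambda>\<omega>. LINT r:{1..t}|lborel. f (L r \<omega>) / r powr \<gamma>) \<in> borel_measurable (F t)"
    proof (rule adapted_integral_measurable[where g = "\<lambda>r x. f x / r powr \<gamma>"])
      show "L s \<in> borel_measurable (F t)" if "1 \<le> s" "s \<le> t" for s
        using measurable_later[OF LF] that by auto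
      show "continuous_on {1..t} (\<lambda>s. L s \<omega>)" if "\<omega> \<in> space (F t)" for \<omega>
        using continuous_on_subset[OF Lc[of \<omega>], of "{1..t}"] that by (auto simp: space_F)
      have [measurable]: "f \<in> borel_measurable borel" by (rule borel_measurable_continuous_onI[OF fc])
      show "(\<lambda>(s, x). f x / s powr \<gamma>) \<in> borel_measurable (borel \<Otimes>\<^sub>M borel)" by measurable
    qed (use t in auto)
    moreover have "L t \<in> borel_measurable (F t)" "L 1 \<in> borel_measurable (F t)"
      using LF t measurable_later[OF LF, of 1 t] by auto
    ultimately have "(\<lambda>\<omega>. L t \<omega> - L 1 \<omega> - (LINT r:{1..t}|lborel. f (L r \<omega>) / r powr \<gamma>)) \<in> borel_measurable (F t)"
      by measurable
    moreover have "L t \<omega> - L 1 \<omega> - (LINT r:{1..t}|lborel. f (L r \<omega>) / r powr \<gamma>) = W t \<omega>" if "\<omega> \<in> space (F t)" for \<omega>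
      unfolding W_def using LINT[of \<omega> t] that by (simp add: space_F)
    ultimately show ?thesis by (simp cong: measurable_cong)
  qed
  have Wc: "continuous_on {1..} (\<lambda>t. W t \<omega>)" if "\<omega> \<in> space M" for \<omega>
  proof (rule continuous_on_atLeastI)
    fix b :: real
    show "continuous_on {1..b} (\<lambda>t. W t \<omega>)"
      unfolding W_def
      by (intro continuous_intros continuous_on_subset[OF Lc[OF that]] indefinite_integral_continuous_1
          integrable_continuous_interval gc2[OF that]) auto
  qed
  have L_eq: "L t \<omega> = L s \<omega> + integral {s..t} (\<lambda>r. f (L r \<omega>) / r powr \<gamma>) + (W t \<omega> - W s \<omega>)"
    if "\<omega> \<in> space M" "1 \<le> s" "s \<le> t" for s t \<omega>
    using Henstock_Kurzweil_Integration.integral_combine[of 1 s t "\<lambda>r. f (L r \<omega>) / r powr \<gamma>"]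
      integrable_continuous_interval[OF gc2[OF that(1)], of 1 t] that
    by (simp add: W_def)
  have sq: "(1 / r powr \<gamma>)\<^sup>2 = r powr (- 2 * \<gamma>)" if "1 \<le> r" for r
    unfolding powr_minus_divide[symmetric] power2_eq_square powr_add[symmetric] by simp
  have sc: "continuous_on {s..t} (\<lambda>r. (1 / r powr \<gamma>)\<^sup>2)" if "1 \<le> s" for s t
    using that by (intro continuous_intros) auto
  note si = integrable_continuous_interval[OF sc]
  have v_bounds: "(t - s) * t powr (- 2 * \<gamma>) \<le> v s t \<and> v s t \<le> (t - s) * s powr (- 2 * \<gamma>)"
    if st: "1 \<le> s" "s < t" for s t
  proof -
    have "integral {s..t} (\<lambda>r. t powr (- 2 * \<gamma>)) \<le> v s t"
      unfolding v_def
    proof (rule integral_le)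
      fix r assume r: "r \<in> {s..t}"
      show "t powr (- 2 * \<gamma>) \<le> (1 / r powr \<gamma>)\<^sup>2"
        using r st \<gamma> by (subst sq) (auto intro!: powr_mono2')
    qed (use si st in auto)
    moreover have "v s t \<le> integral {s..t} (\<lambda>r. s powr (- 2 * \<gamma>))"
      unfolding v_def
    proof (rule integral_le)
      fix r assume r: "r \<in> {s..t}"
      show "(1 / r powr \<gamma>)\<^sup>2 \<le> s powr (- 2 * \<gamma>)"
        using r st \<gamma> by (subst sq) (auto intro!: powr_mono2')
    qed (use si st in auto)
    ultimately show ?thesis using st by simp
  qed
  have v_mono: "v s' t \<le> v s t" if "1 \<le> s" "s \<le> s'" "s' < t" for s s' t
  proof -
    have "v s t = v s s' + v s' t"
      unfolding v_def using that si[of s t] by (intro Henstock_Kurzweil_Integration.integral_combine[symmetric]) auto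
    moreover have "0 \<le> v s s'" unfolding v_def using si that by (intro integral_nonneg) auto
    ultimately show ?thesis by simp
  qed
  have "\<forall>t. \<exists>I. 1 \<le> t \<longrightarrow> has_ito_integral M F B 1 t (\<lambda>r \<omega>. 1 / r powr \<gamma>) I \<and> (AE \<omega> in M. I \<omega> = W t \<omega>)"
  proof
    fix t
    show "\<exists>I. 1 \<le> t \<longrightarrow> has_ito_integral M F B 1 t (\<lambda>r \<omega>. 1 / r powr \<gamma>) I \<and> (AE \<omega> in M. I \<omega> = W t \<omega>)"
    proof (cases "1 \<le> t")
      case True
      then obtain I where I: "has_ito_integral M F B 1 t (\<lambda>r \<omega>. 1 / r powr \<gamma>) I"
        and ae: "AE \<omega> in M. set_integrable lborel {1..t} (\<lambda>s. f (L s \<omega>) / s powr \<gamma>) \<and>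
          L t \<omega> = L 1 \<omega> + (LINT s:{1..t}|lborel. f (L s \<omega>) / s powr \<gamma>) + I \<omega>"
        using sde unfolding additive_sde_solution_def by blast
      have "AE \<omega> in M. I \<omega> = W t \<omega>"
        using ae AE_space by eventually_elim (use LINT in \<open>auto simp: W_def\<close>)
      then show ?thesis using I by blast
    qed simp
  qed
  then obtain I where I: "\<And>t. 1 \<le> t \<Longrightarrow> has_ito_integral M F B 1 t (\<lambda>r \<omega>. 1 / r powr \<gamma>) (I t)"
    and IW: "\<And>t. 1 \<le> t \<Longrightarrow> AE \<omega> in M. I t \<omega> = W t \<omega>" by metis
  have law: "prob (A \<inter> {\<omega> \<in> space M. (W t \<omega> - W s \<omega>) / sqrt (v s t) \<in> C}) = prob A * measure std_normal_distribution C"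
    if st: "1 \<le> s" "s < t" and A: "A \<in> sets (F s)" and C: "C \<in> sets borel" for s t A C
  proof -
    have t: "1 \<le> t" using st by simp
    have vL: "v s t = (LINT r:{s..t}|lborel. (1 / r powr \<gamma>)\<^sup>2)"
      unfolding v_def using borel_integrable_atLeastAtMost'[OF sc[OF st(1)]]
      by (intro set_borel_integral_eq_integral(2)[symmetric]) auto
    have "0 < (t - s) * t powr (- 2 * \<gamma>)" using st by simp
    then have v0: "0 < v s t" using v_bounds[OF st] by linarith
    have [measurable]: "A \<in> sets M" using past_event[OF A] st by simp
    have [measurable]: "W s \<in> borel_measurable M" "W t \<in> borel_measurable M"
      using measurable_from_past[OF WF] st by auto
    have [measurable]: "I s \<in> borel_measurable M" "I t \<in> borel_measurable M"
      using I[OF st(1)] I[OF t] by (auto simp: has_ito_integral_def)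
    note [measurable] = C
    have "prob (A \<inter> {\<omega> \<in> space M. (W t \<omega> - W s \<omega>) / sqrt (v s t) \<in> C}) =
        prob (A \<inter> {\<omega> \<in> space M. (I t \<omega> - I s \<omega>) / sqrt (v s t) \<in> C})"
    proof (rule measure_eq_AE)
      show "AE \<omega> in M. (\<omega> \<in> A \<inter> {\<omega> \<in> space M. (W t \<omega> - W s \<omega>) / sqrt (v s t) \<in> C}) =
          (\<omega> \<in> A \<inter> {\<omega> \<in> space M. (I t \<omega> - I s \<omega>) / sqrt (v s t) \<in> C})"
        using IW[OF st(1)] IW[OF t] by eventually_elim simp
    qed measurable
    also have "\<dots> = prob A * measure std_normal_distribution C"
      by (rule ito_increment_law[OF _ st I[OF st(1)] I[OF t] lipschitz_on_inverse_powr A C vL v0])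
         (use \<gamma> in auto)
    finally show ?thesis .
  qed
  show ?thesis
    unfolding W_def[symmetric] v_def[symmetric]
  proof unfold_locales
    show "subalgebra M (F t)" if "1 \<le> t" for t using subalgebra_F that by simp
    show "(t - s) * t powr (- 2 * \<gamma>) \<le> v s t" "v s t \<le> (t - s) * s powr (- 2 * \<gamma>)" if "1 \<le> s" "s < t" for s t
      using v_bounds[OF that] by blast+
  qed (fact WF Wc v_mono law \<gamma> f LF Lc L_eq)+
qed

text \<open>Any exponent \<open>q\<close> strictly between \<open>k\<close> and \<open>1/2\<close> serves; the margin \<open>q - k\<close> pays for the
  factor \<open>1 + \<theta>\<close>.\<close>

lemma barrier_linear:
  fixes f :: "real \<Rightarrow> real"
  assumes k: "0 < k" "k < 1 / 2" and f: "\<And>y. 0 < y \<Longrightarrow> y \<le> r \<Longrightarrow> f (- y) \<le> k * y"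
  obtains q \<kappa> \<theta> where "0 < q" "q < 1 / 2" "0 < \<kappa>" "0 < \<theta>" "\<theta> < 1"
    "\<And>t y. 1 \<le> t \<Longrightarrow> 0 < y \<Longrightarrow> y \<le> r \<Longrightarrow> y \<le> (1 + \<theta>) * (\<kappa> * t powr - q) \<Longrightarrow> f (- y) < q * \<kappa> * t powr (1 - 1 - q)"
proof -
  define q where "q = (k + 1 / 2) / 2"
  define \<theta> where "\<theta> = min (1 / 2) ((q / k - 1) / 2)"
  have q: "k < q" "q < 1 / 2" using k by (auto simp: q_def)
  have "1 < q / k" using q k by simp
  then have \<theta>: "0 < \<theta>" "\<theta> < 1" by (auto simp: \<theta>_def)
  have "\<theta> \<le> (q / k - 1) / 2" unfolding \<theta>_def by (rule min.cobounded2)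
  then have "k * (1 + \<theta>) \<le> k * (1 + (q / k - 1) / 2)" using k by (intro mult_left_mono add_left_mono) auto
  also have "\<dots> = (k + q) / 2" using k by (simp add: field_simps)
  also have "\<dots> < q" using q by simp
  finally have k\<theta>: "k * (1 + \<theta>) < q" .
  have "f (- y) < q * 1 * t powr (1 - 1 - q)" if "1 \<le> t" "0 < y" "y \<le> r" "y \<le> (1 + \<theta>) * (1 * t powr - q)" for t y
  proof -
    have "f (- y) \<le> k * y" using f that by blast
    also have "\<dots> \<le> k * ((1 + \<theta>) * (1 * t powr - q))" using that k by (intro mult_left_mono) auto
    also have "\<dots> = (k * (1 + \<theta>)) * t powr - q" by simp
    also have "\<dots> < q * t powr - q" using k\<theta> that by (intro mult_strict_right_mono) auto
    finally show ?thesis by simp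
  qed
  then show ?thesis using q k \<theta> by (intro that[of q 1 \<theta>]) auto
qed

text \<open>The exponent has to satisfy \<open>q * k \<ge> q + 1 - \<gamma>\<close>, that is \<open>q \<ge> (1 - \<gamma>) / (k - 1)\<close>, and the
  hypothesis on \<open>k\<close> says that this number is below \<open>\<gamma> - 1/2\<close>. When \<open>\<gamma> = 1\<close> it is \<open>0\<close>, so the
  maximum with a positive number is taken. A small amplitude \<open>\<kappa>\<close> absorbs the constant, since
  \<open>\<kappa> powr k\<close> is then much smaller than \<open>\<kappa>\<close>.\<close>

lemma barrier_superlinear:
  fixes f :: "real \<Rightarrow> real"
  assumes \<gamma>: "1 / 2 < \<gamma>" "\<gamma> \<le> 1" and k: "1 < k" "1 / 2 + 1 / (2 * k) < \<gamma>"
    and f: "\<And>y. 0 < y \<Longrightarrow> y \<le> r \<Longrightarrow> f (- y) \<le> y powr k"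
  obtains q \<kappa> \<theta> where "0 < q" "q < \<gamma> - 1 / 2" "0 < \<kappa>" "0 < \<theta>" "\<theta> < 1"
    "\<And>t y. 1 \<le> t \<Longrightarrow> 0 < y \<Longrightarrow> y \<le> r \<Longrightarrow> y \<le> (1 + \<theta>) * (\<kappa> * t powr - q) \<Longrightarrow> f (- y) < q * \<kappa> * t powr (\<gamma> - 1 - q)"
proof -
  define q where "q = max ((1 - \<gamma>) / (k - 1)) ((\<gamma> - 1 / 2) / 2)"
  have "(1 - \<gamma>) / (k - 1) < \<gamma> - 1 / 2"
  proof -
    have "1 / 2 * (2 * k) + 1 / (2 * k) * (2 * k) < \<gamma> * (2 * k)"
      unfolding distrib_right[symmetric] using k by (intro mult_strict_right_mono) auto
    then have "k + 1 < 2 * \<gamma> * k" using k by simp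
    moreover have "(\<gamma> - 1 / 2) * (k - 1) = \<gamma> * k - \<gamma> - k / 2 + 1 / 2" by (simp add: field_simps)
    ultimately have "1 - \<gamma> < (\<gamma> - 1 / 2) * (k - 1)" by linarith
    then show ?thesis using k by (simp add: pos_divide_less_eq)
  qed
  then have q: "0 < q" "q < \<gamma> - 1 / 2" using \<gamma> by (simp_all add: q_def less_max_iff_disj)
  have qk: "1 - \<gamma> \<le> q * (k - 1)"
  proof -
    have "(1 - \<gamma>) / (k - 1) \<le> q" by (simp add: q_def)
    then show ?thesis using k by (simp add: pos_divide_le_eq)
  qed
  define b where "b = q * 2 powr - k / 2"
  have b: "0 < b" using q by (simp add: b_def)
  define \<kappa> where "\<kappa> = b powr (1 / (k - 1))"
  have \<kappa>: "0 < \<kappa>" using b by (simp add: \<kappa>_def)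
  have \<kappa>k: "2 powr k * \<kappa> powr k < q * \<kappa>"
  proof -
    have "\<kappa> powr (k - 1) = b" using b k by (simp add: \<kappa>_def powr_powr)
    then have "\<kappa> powr k = \<kappa> * b" using \<kappa> by (simp add: powr_diff field_simps)
    then have "2 powr k * \<kappa> powr k = q * \<kappa> / 2" by (simp add: b_def powr_minus field_simps)
    also have "\<dots> < q * \<kappa>" using q \<kappa> by simp
    finally show ?thesis .
  qed
  have "f (- y) < q * \<kappa> * t powr (\<gamma> - 1 - q)"
    if t: "1 \<le> t" and y: "0 < y" "y \<le> r" "y \<le> (1 + 1 / 2) * (\<kappa> * t powr - q)" for t y
  proof -
    have "f (- y) \<le> y powr k" using f y by blast
    also have "(1 + 1 / 2) * (\<kappa> * t powr - q) \<le> 2 * (\<kappa> * t powr - q)" using \<kappa> by (intro mult_right_mono) auto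
    then have "y powr k \<le> (2 * (\<kappa> * t powr - q)) powr k" using y k by (intro powr_mono2) auto
    also have "\<dots> = (2 powr k * \<kappa> powr k) * t powr (- q * k)"
      using \<kappa> t by (simp add: powr_mult powr_powr)
    also have "\<dots> < (q * \<kappa>) * t powr (- q * k)" using \<kappa>k t by (intro mult_strict_right_mono) auto
    also have "\<dots> \<le> (q * \<kappa>) * t powr (\<gamma> - 1 - q)"
      using qk q \<kappa> t by (intro mult_left_mono powr_mono) (auto simp: algebra_simps)
    finally show ?thesis .
  qed
  then show ?thesis using q \<kappa> by (intro that[of q \<kappa> "1 / 2"]) auto
qed

theorem theorem1p2:
  fixes M :: "'a measure" and F :: "real \<Rightarrow> 'a measure"
    and B L :: "real \<Rightarrow> 'a \<Rightarrow> real"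
    and N :: "real set" and \<gamma> :: real and f :: "real \<Rightarrow> real"
  assumes "brownian_motion M F B"
    and "0 \<in> interior N"
    and "1/2 < \<gamma>" and "\<gamma> \<le> 1"
    and "\<exists>C. C-lipschitz_on UNIV f"
    and "f 0 = 0"
    and "\<And>x. x \<in> N - {0} \<Longrightarrow> f x > 0"
    and "additive_sde_solution M F B 1 (\<lambda>t x. f x / t powr \<gamma>) (\<lambda>t. 1 / t powr \<gamma>) L"
    and "(\<gamma> = 1 \<and> (\<exists>k1 k2. 0 < k1 \<and> k1 < 1/2 \<and> 0 < k2 \<and> k2 < 1/2 \<and>
            (\<forall>x \<in> N \<inter> {..0}. k1 * \<bar>x\<bar> \<le> f x \<and> f x \<le> k2 * \<bar>x\<bar>))) \<or>
         (\<exists>k c. k > 1 \<and> c > 0 \<and> 1/2 + 1 / (2 * k) < \<gamma> \<and>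
            (\<forall>x \<in> N \<inter> {..0}. c * \<bar>x\<bar> powr k \<le> f x \<and> f x \<le> \<bar>x\<bar> powr k))"
  shows "measure M {\<omega> \<in> space M. ((\<lambda>t. L t \<omega>) \<longlongrightarrow> 0) at_top} > 0"
proof -
  obtain K where K: "K-lipschitz_on UNIV f" using assms(5) by blast
  interpret noisy_flow M F "\<lambda>t \<omega>. L t \<omega> - L 1 \<omega> - integral {1..t} (\<lambda>r. f (L r \<omega>) / r powr \<gamma>)"
      "\<lambda>s t. integral {s..t} (\<lambda>r. (1 / r powr \<gamma>)\<^sup>2)" \<gamma> L f K
    by (rule sde_noisy_flow[OF assms(1,3,4) K assms(6,8)])
  obtain e where e: "0 < e" "ball 0 e \<subseteq> N" using assms(2) by (auto simp: mem_interior)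
  define r where "r = e / 2"
  have r: "0 < r" using e by (simp add: r_def)
  have N: "- y \<in> N \<inter> {..0}" if "0 < y" "y \<le> r" for y
    using e that by (auto simp: r_def dist_real_def intro!: subsetD[OF e(2)])
  have fpos: "0 < f y" if "- r \<le> y" "y < 0" for y
    using assms(7)[of y] N[of "- y"] that by auto
  obtain q \<kappa> \<theta> where "0 < q" "q < \<gamma> - 1 / 2" "0 < \<kappa>" "0 < \<theta>" "\<theta> < 1"
    "\<And>t y. 1 \<le> t \<Longrightarrow> 0 < y \<Longrightarrow> y \<le> r \<Longrightarrow> y \<le> (1 + \<theta>) * (\<kappa> * t powr - q) \<Longrightarrow> f (- y) < q * \<kappa> * t powr (\<gamma> - 1 - q)"
    using assms(9)
  proof (elim disjE conjE exE)
    fix k1 k2 :: real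
    assume "\<gamma> = 1" and k2: "0 < k2" "k2 < 1 / 2"
      and le: "\<forall>x\<in>N \<inter> {..0}. k1 * \<bar>x\<bar> \<le> f x \<and> f x \<le> k2 * \<bar>x\<bar>"
    have "f (- y) \<le> k2 * y" if "0 < y" "y \<le> r" for y using bspec[OF le N[OF that]] that by simp
    from barrier_linear[OF k2 this] show thesis using that \<open>\<gamma> = 1\<close> by auto
  next
    fix k c :: real
    assume k: "1 < k" "1 / 2 + 1 / (2 * k) < \<gamma>"
      and le: "\<forall>x\<in>N \<inter> {..0}. c * \<bar>x\<bar> powr k \<le> f x \<and> f x \<le> \<bar>x\<bar> powr k"
    have "f (- y) \<le> y powr k" if "0 < y" "y \<le> r" for y using bspec[OF le N[OF that]] that by simp
    from barrier_superlinear[OF assms(3,4) k this] show thesis using that by blast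
  qed
  then show ?thesis
    using converges_with_positive_probability[OF r fpos] by blast
qed

end
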